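(* Let $\alpha,\beta$ be integers with $\alpha\equiv 7\pmod 9$ and $\beta\equiv 4\pmod 9$. Then $|G_3|=3^{5}$, the nilpotency class of $G_3$ is $3$, $o(a)=o(b)=9$ and $o(c)=3$.
   Context: $G(\alpha,\beta)=\langle A,B\mid A^{[A,B]}=A^{\alpha},\ B^{[B,A]}=B^{\beta}\rangle$ with $[x,y]=x^{-1}y^{-1}xy$, $y^x=x^{-1}yx$, and $C=[A,B]$. The group $G(\alpha,\beta)$ is finite and nilpotent, hence the direct product of its Sylow subgroups; $G_3$ denotes its Sylow $3$-subgroup and $a,b,c$ denote the images of $A,B,C$ under the canonical projection $G(\alpha,\beta)\to G_3$. $o(x)$ is the order of $x$. *)

theory Defs
  imports "HOL-Algebra.Algebra"
begin

datatype gen = GA | GB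

text \<open>A letter is a generator together with a flag: True means the inverse of the generator.\<close>
type_synonym word = "(gen \<times> bool) list"

fun inv_letter :: "gen \<times> bool \<Rightarrow> gen \<times> bool" where
  "inv_letter (g, e) = (g, \<not> e)"

definition inv_word :: "word \<Rightarrow> word" where
  "inv_word w = rev (map inv_letter w)"

definition pow_word :: "word \<Rightarrow> int \<Rightarrow> word" where
  "pow_word w k = (if 0 \<le> k then concat (replicate (nat k) w)
                   else concat (replicate (nat (- k)) (inv_word w)))"

definition comm_word :: "word \<Rightarrow> word \<Rightarrow> word" where
  "comm_word x y = inv_word x @ inv_word y @ x @ y"

definition conj_word :: "word \<Rightarrow> word \<Rightarrow> word" where
  "conj_word y x = inv_word x @ y @ x"

definition wA :: word where "wA = [(GA, False)]"
definition wB :: word where "wB = [(GB, False)]"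

text \<open>Equality in the group presented by relators R (normal closure of R in the free group).\<close>
inductive pres_eq :: "word set \<Rightarrow> word \<Rightarrow> word \<Rightarrow> bool" for R where
  refl: "pres_eq R u u"
| sym: "pres_eq R u v \<Longrightarrow> pres_eq R v u"
| trans: "pres_eq R u v \<Longrightarrow> pres_eq R v w \<Longrightarrow> pres_eq R u w"
| ctx: "pres_eq R u v \<Longrightarrow> pres_eq R (x @ u @ y) (x @ v @ y)"
| cancel: "pres_eq R [l, inv_letter l] []"
| rel: "r \<in> R \<Longrightarrow> pres_eq R r []"

definition pres_class :: "word set \<Rightarrow> word \<Rightarrow> word set" where
  "pres_class R w = {v. pres_eq R w v}"

definition pres_mult :: "word set \<Rightarrow> word set \<Rightarrow> word set \<Rightarrow> word set" where
  "pres_mult R S T = pres_class R ((SOME u. u \<in> S) @ (SOME v. v \<in> T))"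

definition presented_group :: "word set \<Rightarrow> word set monoid" where
  "presented_group R =
     \<lparr> carrier = range (pres_class R), Group.monoid.mult = pres_mult R, Group.monoid.one = pres_class R [] \<rparr>"

definition relators_G :: "int \<Rightarrow> int \<Rightarrow> word set" where
  "relators_G \<alpha> \<beta> =
     { conj_word wA (comm_word wA wB) @ inv_word (pow_word wA \<alpha>),
       conj_word wB (comm_word wB wA) @ inv_word (pow_word wB \<beta>) }"

definition G_ab :: "int \<Rightarrow> int \<Rightarrow> word set monoid" where
  "G_ab \<alpha> \<beta> = presented_group (relators_G \<alpha> \<beta>)"

definition elA :: "int \<Rightarrow> int \<Rightarrow> word set" where
  "elA \<alpha> \<beta> = pres_class (relators_G \<alpha> \<beta>) wA"
definition elB :: "int \<Rightarrow> int \<Rightarrow> word set" where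
  "elB \<alpha> \<beta> = pres_class (relators_G \<alpha> \<beta>) wB"
definition elC :: "int \<Rightarrow> int \<Rightarrow> word set" where
  "elC \<alpha> \<beta> = pres_class (relators_G \<alpha> \<beta>) (comm_word wA wB)"

definition sylow_subgroup :: "('a, 'b) monoid_scheme \<Rightarrow> nat \<Rightarrow> 'a set \<Rightarrow> bool" where
  "sylow_subgroup G p P \<longleftrightarrow> finite (carrier G) \<and> subgroup P G \<and>
     (\<exists>k. card P = p ^ k) \<and> \<not> p dvd (card (carrier G) div card P)"

text \<open>Elements of order prime to p (in a finite nilpotent group: the product of the
  other Sylow subgroups).\<close>
definition p'_elements :: "('a, 'b) monoid_scheme \<Rightarrow> nat \<Rightarrow> 'a set" where
  "p'_elements G p = {x \<in> carrier G. coprime (group.ord G x) p}"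

text \<open>Canonical projection of G = P x O_p'(G) onto its Sylow p-subgroup P.\<close>
definition sylow_proj :: "('a, 'b) monoid_scheme \<Rightarrow> nat \<Rightarrow> 'a set \<Rightarrow> 'a \<Rightarrow> 'a" where
  "sylow_proj G p P x = (THE y. y \<in> P \<and> inv\<^bsub>G\<^esub> y \<otimes>\<^bsub>G\<^esub> x \<in> p'_elements G p)"

definition commutator :: "('a, 'b) monoid_scheme \<Rightarrow> 'a \<Rightarrow> 'a \<Rightarrow> 'a" where
  "commutator G x y = inv\<^bsub>G\<^esub> x \<otimes>\<^bsub>G\<^esub> inv\<^bsub>G\<^esub> y \<otimes>\<^bsub>G\<^esub> x \<otimes>\<^bsub>G\<^esub> y"

fun lower_central :: "('a, 'b) monoid_scheme \<Rightarrow> nat \<Rightarrow> 'a set" where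
  "lower_central G 0 = carrier G"
| "lower_central G (Suc n) =
     generate G {commutator G x y | x y. x \<in> lower_central G n \<and> y \<in> carrier G}"

definition nilpotency_class :: "('a, 'b) monoid_scheme \<Rightarrow> nat" where
  "nilpotency_class G = (LEAST c. lower_central G c = {\<one>\<^bsub>G\<^esub>})"

definition nilpotent_grp :: "('a, 'b) monoid_scheme \<Rightarrow> bool" where
  "nilpotent_grp G \<longleftrightarrow> (\<exists>c. lower_central G c = {\<one>\<^bsub>G\<^esub>})"

end

theory Submission
  imports "HOL-Number_Theory.Number_Theory" Defs
begin

text \<open>
  In the finite group \<open>G\<close> generated by \<open>A\<close>, \<open>B\<close> one has \<open>A\<^sup>n B = B C\<^sup>n A\<^sup>e\<close> with
  \<open>e = \<alpha> + \<dots> + \<alpha>\<^sup>n\<close>, and symmetrically in \<open>A\<close> and \<open>B\<close>. Conjugating by powers of \<open>C\<close> yields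
  congruences modulo the order of \<open>A\<close> which force every prime divisor of that order to divide \<open>\<alpha> - 1\<close>.
  With this, either \<open>C\<^sup>n\<close> or \<open>A\<^sup>n\<close> or \<open>B\<^sup>n\<close> is a nontrivial central element for a suitable \<open>n\<close>. The same
  holds in every quotient of \<open>G\<close>, so elements of coprime order commute and \<open>G\<close> is the product of the subgroups
  generated by the 3-parts \<open>a\<close>, \<open>b\<close> and by the \<open>3'\<close>-parts of \<open>A\<close>, \<open>B\<close>. In the former, going up a
  central series shows \<open>a\<^sup>9 = b\<^sup>9 = 1\<close>; then \<open>c\<^sup>3 = 1\<close>, \<open>a\<^sup>3\<close> and \<open>b\<^sup>3\<close> are central, and every element has the
  form \<open>a\<^sup>i b\<^sup>j c\<^sup>k\<close>. Two homomorphisms to the symmetric group of degree 9, sending one generator to a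
  9-cycle and the other to a 3-cycle, show that these forms are distinct.
\<close>

text \<open>Finiteness of G comes with \<open>sylow_subgroup\<close>; nilpotency does not and has to
  be extracted from the two relations. The lever is that a power of \<open>A\<close> lying in the
  subgroup generated by \<open>B\<close> commutes with both generators and is therefore central. The
  residues 4 and 7 modulo 9 are exactly those for which 3 divides \<alpha> - 1 once and not twice.
  Hence \<alpha>^3 is 1 modulo 9 but not modulo 27, and this keeps the order of \<open>a\<close>
  down to 9. That the two residues differ makes \<alpha> - \<beta> equal to 3 or -3 modulo 9, so
  that what is known about \<open>C^(\<alpha> - \<beta>)\<close> passes to \<open>C^3\<close>. Two
  homomorphisms are required because each of them kills the cube of the generator that it sends to a
  3-cycle: each generator needs its turn as the 9-cycle.\<close>

hide_const (open) Divisibility.prime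

subsection \<open>Geometric sums\<close>

text \<open>This is (a^n - 1) / (a - 1), kept as a sum so that it makes sense for a = 1 and modulo
  primes dividing a - 1.\<close>

definition geo :: "nat \<Rightarrow> nat \<Rightarrow> nat" where
  "geo a n = (\<Sum>i<n. a ^ i)"

lemma geo_0 [simp]: "geo a 0 = 0"
  by (simp add: geo_def)

lemma geo_Suc: "geo a (Suc n) = a * geo a n + 1"
  unfolding geo_def by (simp add: sum.lessThan_Suc_shift sum_distrib_left del: sum.lessThan_Suc)

lemma geo_add: "geo a (k + l) = geo a k + a ^ k * geo a l"
  by (induction k) (simp_all add: geo_Suc algebra_simps)

lemma geo_mult: "geo a (m * n) = geo a m * geo (a ^ m) n"
proof (induction n)
  case (Suc n)
  have geo_Suc': "geo b (Suc l) = geo b l + b ^ l" for b l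
    by (simp add: geo_def)
  have "geo a (m * Suc n) = geo a (m * n) + a ^ (m * n) * geo a m"
    using geo_add[of a "m * n" m] by (simp add: algebra_simps)
  then show ?case
    using Suc by (simp add: geo_Suc' power_mult algebra_simps)
qed simp

lemma power_eq_geo: "int a ^ n - 1 = (int a - 1) * int (geo a n)"
proof (induction n)
  case (Suc n)
  have "int a ^ Suc n - 1 = int a * (int a ^ n - 1) + (int a - 1)"
    by (simp add: algebra_simps)
  then show ?case
    unfolding Suc.IH by (simp add: geo_Suc algebra_simps)
qed simp

lemma geo_dvd_geo: "m dvd n \<Longrightarrow> geo a m dvd geo a n"
  by (auto simp: geo_mult elim!: dvdE)

lemma cong_geo: "[a = b] (mod k) \<Longrightarrow> [geo a n = geo b n] (mod k)"
  unfolding geo_def by (intro cong_sum cong_pow)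

lemma geo_1 [simp]: "geo (Suc 0) n = n"
  by (simp add: geo_def)

text \<open>Split one prime off: for j = i * r the sum factors as
  \<open>geo a i * geo (a ^ i) r\<close>. Induction handles the first factor; the second is a sum of
  r terms, each 1 modulo r.\<close>

lemma dvd_geo:
  fixes a j :: nat
  assumes "j > 0" "\<And>r. prime r \<Longrightarrow> r dvd j \<Longrightarrow> [a = 1] (mod r)"
  shows "j dvd geo a j"
  using assms
proof (induction j rule: less_induct)
  case (less j)
  show ?case
  proof (cases "j = 1")
    case False
    then obtain r where r: "prime r" "r dvd j"
      using prime_factor_nat by blast
    then obtain i where i: "j = i * r"
      by (metis dvd_div_mult_self)
    have "i dvd geo a i"
      using less r prime_gt_1_nat[OF r(1)] unfolding i
      by (intro less.IH) (auto simp: i)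
    moreover have "r dvd geo (a ^ i) r"
    proof -
      have "[a ^ i = 1 ^ i] (mod r)"
        using less.prems(2) r by (intro cong_pow) auto
      then have "[geo (a ^ i) r = r] (mod r)"
        using cong_geo[of "a ^ i" 1 r r] by simp
      then show ?thesis
        by (simp add: cong_dvd_iff)
    qed
    ultimately show ?thesis
      unfolding i geo_mult by (rule mult_dvd_mono)
  qed simp
qed

text \<open>In a^j - 1 = (a - 1) * geo a j the first factor supplies q and the second supplies j.
  The modulus may therefore exceed the exponent by the factor q.\<close>

lemma power_cong_1:
  fixes a j q :: nat
  assumes "j > 0" "\<And>r. prime r \<Longrightarrow> r dvd j \<Longrightarrow> [a = 1] (mod r)" "[a = 1] (mod q)"
  shows "[a ^ j = 1] (mod (q * j))"
proof -
  have "int q dvd int a - 1"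
    using assms(3) by (metis cong_iff_dvd_diff cong_int_iff of_nat_1)
  moreover have "int j dvd int (geo a j)"
    using dvd_geo[OF assms(1,2)] by simp
  ultimately have "int (q * j) dvd int (a ^ j) - int 1"
    using power_eq_geo[of a j] by (simp add: mult_dvd_mono)
  then show ?thesis
    by (metis cong_iff_dvd_diff cong_int_iff)
qed

text \<open>If the order \<open>d\<close> of \<open>a\<close> modulo \<open>p\<close> were not 1, then \<open>d\<close> divides \<open>m\<close>, its prime factors
  are smaller than \<open>p\<close>, and \<open>j = d / q\<close> for a prime factor \<open>q\<close> of \<open>d\<close> satisfies \<open>a\<^sup>j \<equiv> 1\<close>
  modulo \<open>d\<close>. The hypothesis for this \<open>j\<close> then forces \<open>a\<^sup>j \<equiv> 1\<close> modulo \<open>p\<close>.\<close>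
lemma prime_dvd_imp_cong_1:
  fixes a m p :: nat
  assumes m: "m > 0" "[a ^ m = 1] (mod m)"
    and E: "\<And>j. int m dvd (int (a * geo a (a ^ j)) - int (a ^ (a ^ j + j))) * (int a - 1)\<^sup>2"
    and "prime p" "p dvd m"
  shows "[a = 1] (mod p)"
  using assms(4,5)
proof (induction p rule: less_induct)
  case (less p)
  show ?case
  proof (rule ccontr)
    assume neq: "[a \<noteq> 1] (mod p)"
    have amp: "[a ^ m = 1] (mod p)"
      using m(2) less.prems(2) cong_dvd_modulus_nat by blast
    then have "coprime (a ^ m) p"
      by (metis cong_imp_coprime cong_sym coprime_1_left)
    then have cop: "coprime p a"
      using m(1) by (simp add: coprime_commute)
    define d where "d = ord p a"
    have d: "d dvd m" "d > 0" "d \<noteq> 1"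
      using amp neq cop ord_eq_Suc_0_iff[of p a] by (auto simp: d_def ord_divides')
    have "\<not> p dvd a"
      using cop less.prems(1) by (metis coprime_absorb_left not_prime_unit)
    then have "d dvd p - 1"
      using fermat_theorem[OF less.prems(1)] by (simp add: d_def ord_divides')
    then have dp: "d < p"
      using prime_gt_1_nat[OF less.prems(1)] by (auto dest!: dvd_imp_le)
    have small: "[a = 1] (mod r)" if "prime r" "r dvd d" for r
      using that dp d dvd_imp_le[of r d] by (intro less.IH) auto
    obtain q where q: "prime q" "q dvd d"
      using d(3) prime_factor_nat by blast
    then obtain j where j: "d = q * j" "j > 0"
      using d(2) by (auto elim!: dvdE)
    have jd: "\<not> d dvd j"
      using j prime_gt_1_nat[OF q(1)] by (auto dest: dvd_imp_le)
    have "[a ^ j = 1] (mod d)"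
      unfolding j(1) using small q j by (intro power_cong_1) (auto simp: j)
    then have "[a ^ (a ^ j) = a] (mod p)"
      using order_divides_expdiff[OF cop, of "a ^ j" 1] by (simp add: d_def)
    then have "int p dvd int (a ^ (a ^ j)) - int a"
      by (metis cong_iff_dvd_diff cong_int_iff)
    then obtain t where t: "int (a ^ (a ^ j)) = int a + int p * t"
      by (metis dvdE add.commute diff_add_cancel)
    define n where "n = a ^ j"
    have g: "int a ^ n - 1 = (int a - 1) * int (geo a n)"
      by (rule power_eq_geo)
    \<comment> \<open>One factor a - 1 turns the geometric sum into a^n - 1. As a^n is a modulo p,
      what remains modulo p is a * (a - 1)^2 * (1 - a^j), where only the last factor can
      vanish.\<close>
    have "(int (a * geo a n) - int (a ^ (n + j))) * (int a - 1)\<^sup>2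
        = (int a * (int a ^ n - 1) - int a ^ n * int a ^ j * (int a - 1)) * (int a - 1)"
      unfolding g by (simp add: power_add power2_eq_square algebra_simps)
    also have "int a ^ n = int a + int p * t"
      using t by (simp add: n_def)
    also have "(int a * (int a + int p * t - 1) - (int a + int p * t) * int a ^ j * (int a - 1)) * (int a - 1)
      = int a * (int a - 1) * (int a - 1) * (1 - int a ^ j) +
        int p * ((int a * t - t * int a ^ j * (int a - 1)) * (int a - 1))"
      by (simp add: algebra_simps)
    finally have "int p dvd int a * (int a - 1) * (int a - 1) * (1 - int a ^ j) +
        int p * ((int a * t - t * int a ^ j * (int a - 1)) * (int a - 1))"
      using E[of j] less.prems(2) unfolding n_def by (metis dvd_trans int_dvd_int_iff)
    then have "int p dvd int a * (int a - 1) * (int a - 1) * (1 - int a ^ j)"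
      by (metis dvd_add_left_iff dvd_triv_left)
    moreover have "prime (int p)"
      using less.prems(1) by simp
    moreover have "\<not> int p dvd int a"
      using \<open>\<not> p dvd a\<close> by simp
    moreover have "\<not> int p dvd int a - 1"
      using neq by (metis cong_iff_dvd_diff cong_int_iff of_nat_1)
    ultimately have "int p dvd 1 - int a ^ j"
      by (simp add: prime_dvd_mult_iff)
    then have "[a ^ j = 1] (mod p)"
      by (metis cong_iff_dvd_diff cong_int_iff cong_sym of_nat_1 of_nat_power)
    then show False
      using jd by (simp add: d_def ord_divides')
  qed
qed

subsection \<open>Conjugation in groups\<close>

context group
begin

text \<open>Once products are associated to the right, these rules let the simplifier cancel inside
  longer words.\<close>

lemma inv_cancel_left [simp]:
  "x \<in> carrier G \<Longrightarrow> y \<in> carrier G \<Longrightarrow> inv x \<otimes> (x \<otimes> y) = y"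
  "x \<in> carrier G \<Longrightarrow> y \<in> carrier G \<Longrightarrow> x \<otimes> (inv x \<otimes> y) = y"
  by (simp_all flip: m_assoc)

lemma pow_cong_ord:
  assumes "x \<in> carrier G" "[i = j] (mod ord x)"
  shows "x [^] (i::nat) = x [^] (j::nat)"
proof -
  have "int (ord x) dvd int i - int j"
    using assms(2) by (metis cong_iff_dvd_diff cong_int_iff)
  then have "x [^] int i = x [^] int j"
    using assms(1) by (metis dvd_diff_commute int_pow_eq)
  then show ?thesis
    by (simp add: int_pow_int)
qed

lemma cong_ord_pow:
  assumes "x \<in> carrier G" "x [^] (i::nat) = x [^] (j::nat)"
  shows "[i = j] (mod ord x)"
proof -
  have "x [^] int i = x [^] int j"
    using assms(2) by (simp add: int_pow_int)
  then have "int (ord x) dvd int i - int j"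
    using assms(1) by (metis dvd_diff_commute int_pow_eq)
  then show ?thesis
    by (metis cong_iff_dvd_diff cong_int_iff)
qed

lemma commute_pow:
  assumes "x \<in> carrier G" "y \<in> carrier G" "x \<otimes> y = y \<otimes> x"
  shows "x [^] (n::nat) \<otimes> y = y \<otimes> x [^] n"
  using group_commutes_pow[OF assms(3,1,2)] .

lemma commute_inv:
  assumes "x \<in> carrier G" "y \<in> carrier G" "x \<otimes> y = y \<otimes> x"
  shows "inv x \<otimes> y = y \<otimes> inv x"
proof -
  have "inv x \<otimes> (x \<otimes> y) \<otimes> inv x = inv x \<otimes> (y \<otimes> x) \<otimes> inv x"
    by (simp only: assms(3))
  then show ?thesis
    using assms(1,2) by (simp add: m_assoc)
qed

lemma commute_mult:
  assumes "x \<in> carrier G" "y \<in> carrier G" "g \<in> carrier G"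
    "x \<otimes> g = g \<otimes> x" "y \<otimes> g = g \<otimes> y"
  shows "(x \<otimes> y) \<otimes> g = g \<otimes> (x \<otimes> y)"
proof -
  have "(x \<otimes> y) \<otimes> g = x \<otimes> (g \<otimes> y)"
    using assms by (simp add: m_assoc)
  also have "\<dots> = (g \<otimes> x) \<otimes> y"
    using assms by (simp flip: m_assoc)
  finally show ?thesis
    using assms by (simp add: m_assoc)
qed

lemma commute_generate:
  assumes "S \<subseteq> carrier G" "g \<in> carrier G" "\<And>s. s \<in> S \<Longrightarrow> s \<otimes> g = g \<otimes> s"
    and "x \<in> generate G S"
  shows "x \<otimes> g = g \<otimes> x"
  using assms(4)
proof (induction rule: generate.induct)
  case (eng h1 h2)
  then show ?case
    using assms generate_in_carrier[OF assms(1)] by (intro commute_mult) auto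
qed (use assms commute_inv in auto)

lemma conj_pow:
  assumes "x \<in> carrier G" "c \<in> carrier G" "y \<in> carrier G" "x \<otimes> c = c \<otimes> y"
  shows "x [^] (n::nat) \<otimes> c = c \<otimes> y [^] n"
proof (induction n)
  case (Suc n)
  have "x [^] Suc n \<otimes> c = x [^] n \<otimes> (c \<otimes> y)"
    using assms by (simp add: m_assoc)
  also have "\<dots> = c \<otimes> y [^] Suc n"
    using assms Suc by (simp flip: m_assoc)
  finally show ?case .
qed (use assms in simp)

lemma conj_pow_pow:
  assumes "x \<in> carrier G" "c \<in> carrier G" "x \<otimes> c = c \<otimes> x [^] (a::nat)"
  shows "x [^] (n::nat) \<otimes> c [^] (k::nat) = c [^] k \<otimes> x [^] (n * a ^ k)"
proof (induction k)
  case (Suc k)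
  have "x [^] n \<otimes> c [^] Suc k = c [^] k \<otimes> (x [^] (n * a ^ k) \<otimes> c)"
    using assms Suc by (simp flip: m_assoc)
  also have "\<dots> = c [^] k \<otimes> (c \<otimes> x [^] (n * a ^ Suc k))"
    using conj_pow[OF assms(1,2) _ assms(3), of "n * a ^ k"] assms
    by (simp add: nat_pow_pow mult_ac)
  finally show ?case
    using assms by (simp add: m_assoc)
qed (use assms in simp)

text \<open>Each further \<open>c\<close> that is moved to the left multiplies the exponent already
  collected by a, and a new factor x^a follows; the recursion e \<mapsto> a * e + a is solved by
  \<open>a * geo a n\<close>.\<close>

lemma mult_pow_conj:
  assumes "x \<in> carrier G" "c \<in> carrier G" "x \<otimes> c = c \<otimes> x [^] (a::nat)"
  shows "(c \<otimes> x [^] a) [^] (n::nat) = c [^] n \<otimes> x [^] (a * geo a n)"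
proof (induction n)
  case (Suc n)
  have "(c \<otimes> x [^] a) [^] Suc n = (c [^] n \<otimes> x [^] (a * geo a n)) \<otimes> (c \<otimes> x [^] a)"
    using assms Suc by simp
  also have "\<dots> = c [^] n \<otimes> (x [^] (a * geo a n) \<otimes> c) \<otimes> x [^] a"
    using assms by (simp add: m_assoc)
  also have "\<dots> = c [^] n \<otimes> (c \<otimes> x [^] (a * geo a n * a)) \<otimes> x [^] a"
    using conj_pow_pow[OF assms, of "a * geo a n" 1] assms by simp
  also have "\<dots> = c [^] Suc n \<otimes> x [^] (a * geo a (Suc n))"
    using assms by (simp add: m_assoc nat_pow_mult geo_Suc algebra_simps)
  finally show ?case .
qed (use assms in simp)

text \<open>Conjugation by \<open>c\<close> is injective, so on a finite set it is onto.\<close>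
lemma finite_conj_inv:
  assumes "S \<subseteq> carrier G" "finite S" "c \<in> carrier G"
    and "\<And>x. x \<in> S \<Longrightarrow> c \<otimes> x \<otimes> inv c \<in> S" and "x \<in> S"
  shows "inv c \<otimes> x \<otimes> c \<in> S"
proof -
  have "inj_on (\<lambda>x. c \<otimes> x \<otimes> inv c) S"
    using assms(1,3) by (intro inj_onI) (simp add: subset_iff)
  then have "(\<lambda>x. c \<otimes> x \<otimes> inv c) ` S = S"
    using assms(2,4) by (intro endo_inj_surj) auto
  then obtain y where y: "y \<in> S" "x = c \<otimes> y \<otimes> inv c"
    using assms(5) by blast
  then have "inv c \<otimes> x \<otimes> c = y"
    using subsetD[OF assms(1) y(1)] assms(3) by (simp add: m_assoc)
  then show ?thesis
    using y by simp
qed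

end

subsection \<open>Finite groups satisfying the relations\<close>

text \<open>\<open>C\<close> is a parameter tied to \<open>A\<close> and \<open>B\<close> by the
  relation \<open>AB\<close>, so that the locale passes to quotients, to commuting factors and to
  the exchanged pair. Natural exponents suffice because in a finite group an integer exponent can be
  replaced by a residue.\<close>

locale macdonald_group = group G for G (structure) +
  fixes A B C :: 'a and \<alpha> \<beta> :: nat
  assumes finite_carrier: "finite (carrier G)"
    and A_closed [simp, intro]: "A \<in> carrier G"
    and B_closed [simp, intro]: "B \<in> carrier G"
    and C_closed [simp, intro]: "C \<in> carrier G"
    and gen: "generate G {A, B} = carrier G"
    and AB: "A \<otimes> B = B \<otimes> (A \<otimes> C)"
    and AC: "A \<otimes> C = C \<otimes> A [^] \<alpha>"
    and CB: "C \<otimes> B = B [^] \<beta> \<otimes> C"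
begin

lemma B_inv_C: "B \<otimes> inv C = inv C \<otimes> B [^] \<beta>"
proof -
  have "inv C \<otimes> (C \<otimes> B) \<otimes> inv C = inv C \<otimes> (B [^] \<beta> \<otimes> C) \<otimes> inv C"
    by (simp only: CB)
  then show ?thesis
    by (simp add: m_assoc)
qed

text \<open>Since [B,A] is the inverse of [A,B], exchanging the generators only inverts
  \<open>C\<close>. Every statement about \<open>A\<close> thereby yields one about
  \<open>B\<close>.\<close>

lemma swap: "macdonald_group G B A (inv C) \<beta> \<alpha>"
proof
  show "generate G {B, A} = carrier G"
    using gen by (simp add: insert_commute)
  have "A \<otimes> (B \<otimes> inv C) = (A \<otimes> B) \<otimes> inv C"
    by (simp add: m_assoc)
  also have "\<dots> = B \<otimes> A"
    by (simp add: AB m_assoc)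
  finally show "B \<otimes> A = A \<otimes> (B \<otimes> inv C)" ..
  have "inv C \<otimes> (A \<otimes> C) \<otimes> inv C = inv C \<otimes> (C \<otimes> A [^] \<alpha>) \<otimes> inv C"
    by (simp only: AC)
  then show "inv C \<otimes> A = A [^] \<alpha> \<otimes> inv C"
    by (simp add: m_assoc)
qed (auto simp: finite_carrier B_inv_C)

lemma central_if_commutes:
  assumes "z \<in> carrier G" "z \<otimes> A = A \<otimes> z" "z \<otimes> B = B \<otimes> z" "g \<in> carrier G"
  shows "z \<otimes> g = g \<otimes> z"
proof -
  have "g \<otimes> z = z \<otimes> g"
    by (rule commute_generate[of "{A, B}"]) (use assms gen in auto)
  then show ?thesis ..
qed

lemma A_pow_C_pow: "A [^] (n::nat) \<otimes> C [^] (k::nat) = C [^] k \<otimes> A [^] (n * \<alpha> ^ k)"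
  using AC by (intro conj_pow_pow) auto

lemma C_pow_B_pow: "C [^] (k::nat) \<otimes> B [^] (n::nat) = B [^] (n * \<beta> ^ k) \<otimes> C [^] k"
proof -
  have "B [^] n \<otimes> inv C [^] k = inv C [^] k \<otimes> B [^] (n * \<beta> ^ k)"
    by (rule macdonald_group.A_pow_C_pow[OF swap])
  then have "C [^] k \<otimes> (B [^] n \<otimes> inv (C [^] k)) \<otimes> C [^] k =
      C [^] k \<otimes> (inv (C [^] k) \<otimes> B [^] (n * \<beta> ^ k)) \<otimes> C [^] k"
    by (simp add: nat_pow_inv)
  then show ?thesis
    by (simp add: m_assoc)
qed

lemma A_pow_B: "A [^] (n::nat) \<otimes> B = B \<otimes> (C [^] n \<otimes> A [^] (\<alpha> * geo \<alpha> n))"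
proof -
  have "A [^] n \<otimes> B = B \<otimes> (A \<otimes> C) [^] n"
    by (rule conj_pow) (auto simp: AB)
  then show ?thesis
    using AC by (simp add: mult_pow_conj)
qed

lemma B_pow_A: "B [^] (n::nat) \<otimes> A = A \<otimes> (inv (C [^] n) \<otimes> B [^] (\<beta> * geo \<beta> n))"
  using macdonald_group.A_pow_B[OF swap, of n] by (simp add: nat_pow_inv)

lemma subgroup_B: "subgroup (generate G {B}) G"
  by (rule generate_is_subgroup) auto

lemma generate_B: "generate G {B} = range (\<lambda>n::nat. B [^] n)"
  using generate_pow_nat[OF B_closed] ord_ge_1[OF finite_carrier B_closed] by auto

text \<open>The relation \<open>CB\<close> gives the other direction of conjugation, which sends
  \<open>B\<close> to a power of \<open>B\<close>. Finiteness reverses it.\<close>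

lemma C_pow_normalizes_B:
  assumes "x \<in> generate G {B}"
  shows "inv (C [^] (k::nat)) \<otimes> x \<otimes> C [^] k \<in> generate G {B}"
proof (rule finite_conj_inv)
  show "generate G {B} \<subseteq> carrier G"
    using generate_in_carrier by blast
  then show "finite (generate G {B})"
    using finite_carrier finite_subset by blast
  fix y assume "y \<in> generate G {B}"
  then obtain n :: nat where "y = B [^] n"
    by (auto simp: generate_B)
  then have "C [^] k \<otimes> y \<otimes> inv (C [^] k) = B [^] (n * \<beta> ^ k)"
    by (simp add: C_pow_B_pow m_assoc)
  also have "\<dots> \<in> generate G {B}"
    by (auto simp: generate_B)
  finally show "C [^] k \<otimes> y \<otimes> inv (C [^] k) \<in> generate G {B}" .
qed (use assms in auto)

text \<open>Conjugating \<open>B\<^sup>k A = A C\<^sup>-\<^sup>k B\<^sup>l\<close> by \<open>C\<^sup>j\<close> expresses \<open>A\<^sup>-\<^sup>n B A\<^sup>n\<close> through \<open>C\<^sup>-\<^sup>k\<close> and a power of \<open>B\<close>;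
  comparing with \<open>A\<^sup>n B = B C\<^sup>n A\<^sup>g\<close> gives the relation.\<close>
lemma C_pow_A_pow_in_B:
  fixes j :: nat
  defines "n \<equiv> \<alpha> ^ j" and "k \<equiv> \<beta> ^ j"
  shows "C [^] (int n - int k) \<otimes> A [^] (int (\<alpha> * geo \<alpha> n) - int (\<alpha> ^ (n + j)))
           \<in> generate G {B}" (is "_ \<in> ?H")
proof -
  interpret H: subgroup ?H G
    by (rule subgroup_B)
  define g where "g = \<alpha> * geo \<alpha> n"
  define l where "l = \<beta> * geo \<beta> k"
  define U where "U = inv (C [^] j) \<otimes> B [^] l \<otimes> C [^] j"
  have U: "U \<in> ?H"
    unfolding U_def by (intro C_pow_normalizes_B) (auto simp: generate_B)
  then have Uc: "U \<in> carrier G"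
    by (rule H.mem_carrier)
  \<comment> \<open>The exponents k and n are chosen for this: conjugation by \<open>C^j\<close>
    takes \<open>B^k\<close> back to \<open>B\<close> and takes \<open>A\<close> to
    \<open>A^n\<close>.\<close>
  have 1: "inv (C [^] j) \<otimes> (B [^] k \<otimes> A) \<otimes> C [^] j = B \<otimes> A [^] n"
  proof -
    have "inv (C [^] j) \<otimes> (B [^] k \<otimes> A) \<otimes> C [^] j = inv (C [^] j) \<otimes> (B [^] k \<otimes> (A \<otimes> C [^] j))"
      by (simp add: m_assoc)
    also have "A \<otimes> C [^] j = C [^] j \<otimes> A [^] n"
      using A_pow_C_pow[of 1 j] by (simp add: n_def)
    also have "inv (C [^] j) \<otimes> (B [^] k \<otimes> (C [^] j \<otimes> A [^] n))
        = inv (C [^] j) \<otimes> (B [^] k \<otimes> C [^] j) \<otimes> A [^] n"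
      by (simp add: m_assoc)
    also have "B [^] k \<otimes> C [^] j = C [^] j \<otimes> B"
      using C_pow_B_pow[of j 1] by (simp add: k_def)
    finally show ?thesis
      by (simp add: m_assoc)
  qed
  have 2: "inv (C [^] j) \<otimes> (A \<otimes> (inv (C [^] k) \<otimes> B [^] l)) \<otimes> C [^] j
      = A [^] n \<otimes> (inv (C [^] k) \<otimes> U)"
  proof -
    have comm: "inv (C [^] k) \<otimes> C [^] j = C [^] j \<otimes> inv (C [^] k)"
      by (rule commute_inv) (auto simp: nat_pow_mult add.commute)
    have "A [^] n \<otimes> (inv (C [^] k) \<otimes> U) = inv (C [^] j) \<otimes> (C [^] j \<otimes> A [^] n) \<otimes> (inv (C [^] k) \<otimes> U)"
      using Uc by (simp add: m_assoc)
    also have "C [^] j \<otimes> A [^] n = A \<otimes> C [^] j"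
      using A_pow_C_pow[of 1 j] by (simp add: n_def)
    also have "inv (C [^] j) \<otimes> (A \<otimes> C [^] j) \<otimes> (inv (C [^] k) \<otimes> U)
        = inv (C [^] j) \<otimes> (A \<otimes> ((C [^] j \<otimes> inv (C [^] k)) \<otimes> U))"
      using Uc by (simp add: m_assoc)
    also have "(C [^] j \<otimes> inv (C [^] k)) \<otimes> U = inv (C [^] k) \<otimes> (B [^] l \<otimes> C [^] j)"
      unfolding comm[symmetric] U_def by (simp add: m_assoc)
    finally show ?thesis
      by (simp add: m_assoc)
  qed
  have 3: "B \<otimes> A [^] n = A [^] n \<otimes> (inv (C [^] k) \<otimes> U)"
    using 1 2 B_pow_A[of k] by (simp add: l_def)
  \<comment> \<open>By 3, U is \<open>C^k\<close> times the conjugate of \<open>B\<close> by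
    \<open>A^n\<close>. Rewriting that conjugate with \<open>A_pow_B\<close> and pulling its leading
    \<open>B\<close> out to the left past \<open>C^k\<close> leaves Y, which thus differs from U by
    a power of \<open>B\<close>.\<close>
  define Y where "Y = C [^] k \<otimes> (inv (A [^] g) \<otimes> (inv (C [^] n) \<otimes> A [^] n))"
  have Yc: "Y \<in> carrier G"
    by (simp add: Y_def)
  have "U = C [^] k \<otimes> (inv (A [^] n) \<otimes> (B \<otimes> A [^] n))"
    using Uc by (simp add: 3)
  also have "inv (A [^] n) \<otimes> (B \<otimes> A [^] n) = B \<otimes> (inv (A [^] g) \<otimes> (inv (C [^] n) \<otimes> A [^] n))"
  proof -
    have "inv (A [^] n) \<otimes> B = inv (A [^] n) \<otimes> (B \<otimes> (C [^] n \<otimes> A [^] g)) \<otimes> inv (A [^] g) \<otimes> inv (C [^] n)"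
      by (simp add: m_assoc)
    also have "B \<otimes> (C [^] n \<otimes> A [^] g) = A [^] n \<otimes> B"
      using A_pow_B[of n] by (simp add: g_def)
    also have "inv (A [^] n) \<otimes> (A [^] n \<otimes> B) \<otimes> inv (A [^] g) \<otimes> inv (C [^] n)
        = B \<otimes> (inv (A [^] g) \<otimes> inv (C [^] n))"
      by (simp add: m_assoc)
    finally have "inv (A [^] n) \<otimes> B \<otimes> A [^] n = B \<otimes> (inv (A [^] g) \<otimes> inv (C [^] n)) \<otimes> A [^] n"
      by simp
    then show ?thesis
      by (simp add: m_assoc)
  qed
  also have "C [^] k \<otimes> (B \<otimes> (inv (A [^] g) \<otimes> (inv (C [^] n) \<otimes> A [^] n))) = B [^] (\<beta> ^ k) \<otimes> Y"
  proof -
    have "C [^] k \<otimes> B = B [^] (\<beta> ^ k) \<otimes> C [^] k"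
      using C_pow_B_pow[of k 1] by simp
    then have "(C [^] k \<otimes> B) \<otimes> (inv (A [^] g) \<otimes> (inv (C [^] n) \<otimes> A [^] n))
       = (B [^] (\<beta> ^ k) \<otimes> C [^] k) \<otimes> (inv (A [^] g) \<otimes> (inv (C [^] n) \<otimes> A [^] n))"
      by simp
    then show ?thesis
      by (simp add: m_assoc Y_def)
  qed
  finally have "Y = inv (B [^] (\<beta> ^ k)) \<otimes> U"
    using Yc by simp
  moreover have "B [^] (\<beta> ^ k) \<in> ?H"
    by (auto simp: generate_B)
  ultimately have "Y \<in> ?H"
    using U by simp
  \<comment> \<open>Inverting Y and conjugating by \<open>C^k\<close> moves the factor
    \<open>C^k\<close> to the other end, so that the powers of \<open>C\<close> meet once
    \<open>A^n\<close> has been moved past \<open>C^n\<close>.\<close>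
  then have "inv (C [^] k) \<otimes> inv Y \<otimes> C [^] k \<in> ?H"
    by (intro C_pow_normalizes_B) simp
  also have "inv (C [^] k) \<otimes> inv Y \<otimes> C [^] k = inv (C [^] k) \<otimes> (inv (A [^] n) \<otimes> C [^] n \<otimes> A [^] g)"
    by (simp add: Y_def inv_mult_group m_assoc)
  also have "inv (A [^] n) \<otimes> C [^] n = C [^] n \<otimes> inv (A [^] (\<alpha> ^ (n + j)))"
  proof -
    have "A [^] n \<otimes> C [^] n = C [^] n \<otimes> A [^] (\<alpha> ^ (n + j))"
      using A_pow_C_pow[of n n] by (simp add: n_def power_add mult.commute)
    then have "inv (A [^] n) \<otimes> (A [^] n \<otimes> C [^] n) \<otimes> inv (A [^] (\<alpha> ^ (n + j)))
       = inv (A [^] n) \<otimes> (C [^] n \<otimes> A [^] (\<alpha> ^ (n + j))) \<otimes> inv (A [^] (\<alpha> ^ (n + j)))"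
      by simp
    then show ?thesis
      by (simp add: m_assoc)
  qed
  finally have "inv (C [^] k) \<otimes> (C [^] n \<otimes> inv (A [^] (\<alpha> ^ (n + j))) \<otimes> A [^] g) \<in> ?H" .
  moreover have "inv (C [^] k) \<otimes> C [^] n = C [^] (int n - int k)"
  proof -
    have "inv (C [^] k) \<otimes> C [^] n = C [^] (- int k) \<otimes> C [^] int n"
      by (simp add: int_pow_neg int_pow_int)
    then show ?thesis
      by (simp flip: int_pow_mult)
  qed
  moreover have "inv (A [^] (\<alpha> ^ (n + j))) \<otimes> A [^] g = A [^] (int g - int (\<alpha> ^ (n + j)))"
  proof -
    have "inv (A [^] (\<alpha> ^ (n + j))) \<otimes> A [^] g = A [^] (- int (\<alpha> ^ (n + j))) \<otimes> A [^] int g"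
      by (simp only: int_pow_neg int_pow_int A_closed)
    then show ?thesis
      by (simp flip: int_pow_mult)
  qed
  moreover have "inv (C [^] k) \<otimes> (C [^] n \<otimes> inv (A [^] (\<alpha> ^ (n + j))) \<otimes> A [^] g)
      = (inv (C [^] k) \<otimes> C [^] n) \<otimes> (inv (A [^] (\<alpha> ^ (n + j))) \<otimes> A [^] g)"
    by (simp add: m_assoc)
  ultimately show ?thesis
    by (simp only: g_def)
qed

lemma A_int_pow_C: "A [^] (i::int) \<otimes> C = C \<otimes> A [^] (int \<alpha> * i)"
proof -
  define m where "m = nat (i mod int (ord A))"
  have "int (ord A) > 0"
    using ord_ge_1[OF finite_carrier A_closed] by simp
  then have m: "int (ord A) dvd int m - i"
    by (simp add: m_def mod_eq_dvd_iff[symmetric])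
  have "A [^] i = A [^] int m"
    using m by (simp add: int_pow_eq dvd_diff_commute)
  moreover have "A [^] (int \<alpha> * i) = A [^] int (m * \<alpha>)"
    using dvd_mult[OF m, of "int \<alpha>"] by (simp add: int_pow_eq algebra_simps)
  ultimately show ?thesis
    using A_pow_C_pow[of m 1] by (simp only: int_pow_int) simp
qed

text \<open>Conjugation by \<open>C\<close> normalizes the subgroup of \<open>B\<close>, fixes the
  power of \<open>C\<close> in W and raises \<open>A^E\<close> to the power \<alpha>. Dividing by W
  puts \<open>A^((\<alpha> - 1) E)\<close> into the subgroup of \<open>B\<close>, so it is central.
  It then also commutes with \<open>C\<close>, which costs a second factor \<alpha> - 1.\<close>

lemma int_ord_A_dvd:
  defines "E j \<equiv> int (\<alpha> * geo \<alpha> (\<alpha> ^ j)) - int (\<alpha> ^ (\<alpha> ^ j + j))"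
  shows "int (ord A) dvd E j * (int \<alpha> - 1)\<^sup>2"
proof -
  interpret H: subgroup "generate G {B}" G
    by (rule subgroup_B)
  define e where "e = int (\<alpha> ^ j) - int (\<beta> ^ j)"
  define W where "W = C [^] e \<otimes> A [^] E j"
  have W: "W \<in> generate G {B}"
    unfolding W_def e_def E_def by (rule C_pow_A_pow_in_B)
  have "inv C \<otimes> W \<otimes> C = inv C \<otimes> (C [^] e \<otimes> (A [^] E j \<otimes> C))"
    by (simp add: W_def m_assoc)
  also have "\<dots> = inv C \<otimes> (C [^] e \<otimes> C) \<otimes> A [^] (int \<alpha> * E j)"
    by (simp add: A_int_pow_C m_assoc)
  also have "C [^] e \<otimes> C = C \<otimes> C [^] e"
    using int_pow_mult[of C e 1] int_pow_mult[of C 1 e] by (simp add: add.commute)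
  finally have "inv C \<otimes> W \<otimes> C = C [^] e \<otimes> A [^] (int \<alpha> * E j)"
    by (simp add: m_assoc)
  moreover have "inv C \<otimes> W \<otimes> C \<in> generate G {B}"
    using C_pow_normalizes_B[OF W, of 1] by simp
  ultimately have "inv W \<otimes> (C [^] e \<otimes> A [^] (int \<alpha> * E j)) \<in> generate G {B}"
    using W by simp
  also have "inv W \<otimes> (C [^] e \<otimes> A [^] (int \<alpha> * E j)) = inv (A [^] E j) \<otimes> A [^] (int \<alpha> * E j)"
    by (simp add: W_def inv_mult_group m_assoc)
  also have "\<dots> = A [^] (int \<alpha> * E j - E j)"
    using int_pow_mult[of A "- E j" "int \<alpha> * E j"] by (simp flip: int_pow_neg)
  finally have U: "A [^] (int \<alpha> * E j - E j) \<in> generate G {B}" (is "?U \<in> _") .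
  have "?U \<otimes> B = B \<otimes> ?U"
    using U by (rule commute_generate[rotated 3]) auto
  moreover have "?U \<otimes> A = A \<otimes> ?U"
    using int_pow_mult[of A "int \<alpha> * E j - E j" 1] int_pow_mult[of A 1 "int \<alpha> * E j - E j"]
    by (simp add: add.commute)
  ultimately have "?U \<otimes> C = C \<otimes> ?U"
    using central_if_commutes[of ?U C] by simp
  then have "A [^] (int \<alpha> * (int \<alpha> * E j - E j)) = ?U"
    by (simp add: A_int_pow_C)
  then have "int (ord A) dvd int \<alpha> * (int \<alpha> * E j - E j) - (int \<alpha> * E j - E j)"
    by (simp add: int_pow_eq dvd_diff_commute)
  then show ?thesis
    by (simp add: power2_eq_square algebra_simps)
qed

text \<open>For m the order of \<open>A\<close>, the formula for \<open>A^m B\<close> makes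
  \<open>C^m\<close> a power of \<open>A\<close>. So \<open>C^m\<close> commutes with
  \<open>A\<close>, although it also conjugates \<open>A\<close> to
  \<open>A^(\<alpha>^m)\<close>.\<close>

lemma cong_ord_A: "[\<alpha> ^ ord A = 1] (mod ord A)"
proof -
  let ?m = "ord A"
  have "B \<otimes> (C [^] ?m \<otimes> A [^] (\<alpha> * geo \<alpha> ?m)) = B \<otimes> \<one>"
    using A_pow_B[of ?m] by simp
  then have "C [^] ?m \<otimes> A [^] (\<alpha> * geo \<alpha> ?m) = \<one>"
    by (simp del: r_one)
  then have "C [^] ?m = inv (A [^] (\<alpha> * geo \<alpha> ?m))"
    by (simp add: inv_equality)
  moreover have "inv (A [^] (\<alpha> * geo \<alpha> ?m)) \<otimes> A = A \<otimes> inv (A [^] (\<alpha> * geo \<alpha> ?m))"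
    by (intro commute_inv commute_pow) auto
  ultimately have "C [^] ?m \<otimes> A = A \<otimes> C [^] ?m"
    by simp
  also have "\<dots> = C [^] ?m \<otimes> A [^] (\<alpha> ^ ?m)"
    using A_pow_C_pow[of 1 ?m] by simp
  finally have "A [^] (\<alpha> ^ ?m) = A [^] (1::nat)"
    by simp
  then show ?thesis
    by (intro cong_ord_pow) auto
qed

lemma prime_ord_A: "prime p \<Longrightarrow> p dvd ord A \<Longrightarrow> [\<alpha> = 1] (mod p)"
  using prime_dvd_imp_cong_1[of "ord A" \<alpha> p] ord_ge_1[OF finite_carrier A_closed]
    cong_ord_A int_ord_A_dvd by simp

lemma prime_ord_B: "prime p \<Longrightarrow> p dvd ord B \<Longrightarrow> [\<beta> = 1] (mod p)"
  by (rule macdonald_group.prime_ord_A[OF swap])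

end

section \<open>Nontrivial central elements of prime order\<close>

text \<open>Put d = gcd m n. If p divides m, then m divides p * d and \<open>power_cong_1\<close>
  with q = p gains the missing factor; otherwise m already divides n.\<close>

lemma power_cong_1_dvd:
  fixes a m n p :: nat
  assumes "prime p" "m > 0" "m dvd n * p" "\<And>r. prime r \<Longrightarrow> r dvd m \<Longrightarrow> [a = 1] (mod r)"
  shows "[a ^ n = 1] (mod m)"
proof -
  define d where "d = gcd m n"
  have d: "d > 0" "d dvd m" "d dvd n"
    using assms(2) by (auto simp: d_def)
  have primes: "[a = 1] (mod r)" if "prime r" "r dvd d" for r
    using assms(4) that d(2) dvd_trans by blast
  have "[a ^ d = 1] (mod m)"
  proof (cases "p dvd m")
    case True
    have "m dvd gcd (m * p) (n * p)"
      using assms(3) by simp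
    then have "m dvd p * d"
      by (simp add: d_def gcd_mult_distrib_nat mult.commute)
    moreover have "[a ^ d = 1] (mod (p * d))"
      using d(1) primes assms(4)[OF assms(1) True] by (rule power_cong_1)
    ultimately show ?thesis
      using cong_dvd_modulus_nat by blast
  next
    case False
    then have "m dvd n"
      using assms(1,3) by (meson coprime_commute coprime_dvd_mult_left_iff prime_imp_coprime)
    then have "d = m"
      by (simp add: d_def gcd_nat.absorb1)
    then show ?thesis
      using power_cong_1[OF d(1) primes, of 1] by simp
  qed
  then have "[(a ^ d) ^ (n div d) = 1 ^ (n div d)] (mod m)"
    by (rule cong_pow)
  then show ?thesis
    using d(3) by (simp flip: power_mult)
qed

context macdonald_group
begin

lemma ord_pos [simp]: "ord A > 0" "ord B > 0"
  using ord_ge_1[OF finite_carrier A_closed] ord_ge_1[OF finite_carrier B_closed] by auto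

text \<open>If \<open>C^n\<close> is nontrivial, it is central because \<alpha>^n and \<beta>^n are
  1 modulo the orders of \<open>A\<close> and \<open>B\<close>. If it is trivial, \<open>B\<close>
  normalizes the subgroup of order p generated by \<open>A^n\<close>, and minimality of p forces
  this action to be trivial.\<close>

lemma central_element_of_pow_A:
  assumes "prime p" and AL: "ord A dvd n * p" and BL: "ord B dvd n * p" and An: "A [^] n \<noteq> \<one>"
    and least: "\<And>r. prime r \<Longrightarrow> r dvd ord B \<Longrightarrow> p \<le> r"
  shows "\<exists>z\<in>carrier G. z \<noteq> \<one> \<and> z [^] p = \<one> \<and> (\<forall>g\<in>carrier G. z \<otimes> g = g \<otimes> z)"
proof (cases "C [^] n = \<one>")
  case False
  have "[\<alpha> ^ n = 1] (mod ord A)" "[\<beta> ^ n = 1] (mod ord B)"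
    using power_cong_1_dvd[OF assms(1) ord_pos(1) AL prime_ord_A]
      power_cong_1_dvd[OF assms(1) ord_pos(2) BL prime_ord_B] by blast+
  then have "A [^] (\<alpha> ^ n) = A [^] (1::nat)" "B [^] (\<beta> ^ n) = B [^] (1::nat)"
    by (metis A_closed pow_cong_ord, metis B_closed pow_cong_ord)
  then have "C [^] n \<otimes> A = A \<otimes> C [^] n" "C [^] n \<otimes> B = B \<otimes> C [^] n"
    using A_pow_C_pow[of 1 n] C_pow_B_pow[of n 1] by simp_all
  then have "C [^] n \<otimes> g = g \<otimes> C [^] n" if "g \<in> carrier G" for g
    using central_if_commutes that by simp
  moreover have "(C [^] n) [^] p = \<one>"
  proof -
    \<comment> \<open>This makes both powers of \<open>A\<close> in the formula for
      \<open>A^(n p) B\<close> trivial, so that only \<open>C^(n p)\<close> is left.\<close>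
    have "ord A dvd geo \<alpha> (ord A)"
      using prime_ord_A by (intro dvd_geo) auto
    then have "ord A dvd \<alpha> * geo \<alpha> (n * p)"
      using geo_dvd_geo[OF AL, of \<alpha>] by (meson dvd_mult dvd_trans)
    then have "A [^] (\<alpha> * geo \<alpha> (n * p)) = \<one>" "A [^] (n * p) = \<one>"
      using AL by (simp_all add: pow_eq_id)
    then have "B \<otimes> C [^] (n * p) = B \<otimes> \<one>"
      using A_pow_B[of "n * p"] by simp
    then show ?thesis
      by (simp add: nat_pow_pow del: r_one)
  qed
  ultimately show ?thesis
    using False by auto
next
  case True
  have "n \<noteq> 0"
    using An by (metis nat_pow_0)
  \<comment> \<open>With \<open>C^n\<close> trivial, \<open>B\<close> conjugates \<open>A^n\<close>
    to \<open>A^(\<alpha> * geo \<alpha> n)\<close>. This is a power of \<open>A^n\<close> because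
    gcd n (ord A) divides \<open>geo \<alpha> n\<close>, by way of
    \<open>geo \<alpha> d\<close>.\<close>
  define d where "d = gcd (ord A) n"
  have "d dvd geo \<alpha> d"
    using \<open>n \<noteq> 0\<close> prime_ord_A dvd_trans by (intro dvd_geo) (auto simp: d_def)
  also have "geo \<alpha> d dvd geo \<alpha> n"
    by (rule geo_dvd_geo) (simp add: d_def)
  finally have "gcd n (ord A) dvd \<alpha> * geo \<alpha> n"
    by (simp add: d_def gcd.commute)
  then obtain s where s: "[n * s = \<alpha> * geo \<alpha> n] (mod ord A)"
    using cong_solve_dvd_nat[of n] \<open>n \<noteq> 0\<close> by blast
  define x where "x = A [^] n"
  have x: "x \<in> carrier G" "x \<noteq> \<one>" "x [^] p = \<one>"
    using An AL by (simp_all add: x_def nat_pow_pow pow_eq_id)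
  have ordx: "ord x = p"
    using x assms(1) by (metis ord_eq_1 pow_eq_id prime_nat_iff)
  have xB: "x \<otimes> B = B \<otimes> x [^] s"
    using A_pow_B[of n] True pow_cong_ord[OF A_closed s] by (simp add: x_def nat_pow_pow)
  then have "x = x [^] (s ^ ord B)"
    using conj_pow_pow[OF x(1) B_closed, of s 1 "ord B"] x by simp
  then have st: "[s ^ ord B = 1] (mod p)"
    using cong_ord_pow[OF x(1), of "s ^ ord B" 1] x ordx by simp
  have "\<not> p dvd s"
  proof
    assume "p dvd s"
    then have "p dvd s ^ ord B"
      by (simp add: dvd_power_le[of p s 1, simplified] dvd_trans[OF _ dvd_power])
    then show False
      using st assms(1) by (metis cong_dvd_iff not_prime_unit)
  qed
  then have ord_dvd: "Pocklington.ord p s dvd p - 1" "Pocklington.ord p s dvd ord B"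
    using fermat_theorem[OF assms(1)] st by (simp_all add: ord_divides')
  \<comment> \<open>The order of s modulo p divides both p - 1 and the order of \<open>B\<close>.
    Its prime factors would be smaller than p by the first and at least p by the second.\<close>
  have "Pocklington.ord p s = Suc 0"
  proof (rule ccontr)
    assume "Pocklington.ord p s \<noteq> Suc 0"
    then obtain r where r: "prime r" "r dvd Pocklington.ord p s"
      using prime_factor_nat by auto
    then have "p \<le> r" "r dvd p - 1"
      using ord_dvd least dvd_trans by blast+
    then show False
      using prime_gt_1_nat[OF assms(1)] by (auto dest!: dvd_imp_le)
  qed
  then have "[s = 1] (mod p)"
    by (simp add: ord_eq_Suc_0_iff)
  then have "x [^] s = x [^] (1::nat)"
    using pow_cong_ord[OF x(1), of s 1] by (simp add: ordx)
  then have "x \<otimes> B = B \<otimes> x"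
    using x xB by simp
  moreover have "x \<otimes> A = A \<otimes> x"
    unfolding x_def by (rule commute_pow) auto
  ultimately show ?thesis
    using x central_if_commutes by blast
qed

lemma central_element:
  assumes "carrier G \<noteq> {\<one>}"
  shows "\<exists>p z. prime p \<and> p dvd ord A * ord B \<and> z \<in> carrier G \<and> z \<noteq> \<one> \<and> z [^] p = \<one> \<and>
    (\<forall>g\<in>carrier G. z \<otimes> g = g \<otimes> z)"
proof -
  define L where "L = lcm (ord A) (ord B)"
  have "L \<noteq> 1"
  proof
    assume "L = 1"
    then have "ord A dvd 1" "ord B dvd 1"
      by (metis L_def dvd_lcm1, metis L_def dvd_lcm2)
    then have "A = \<one>" "B = \<one>"
      using ord_eq_1[of A] ord_eq_1[of B] by simp_all
    then show False
      using assms gen generate_one by simp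
  qed
  then have ex: "\<exists>p. prime p \<and> p dvd L"
    using prime_factor_nat by blast
  \<comment> \<open>Taking the least prime of the common multiple supplies the minimality condition
    for both generators at once. As n = L / p is no multiple of L, one of \<open>A^n\<close>,
    \<open>B^n\<close> is nontrivial.\<close>
  define p where "p = (LEAST p. prime p \<and> p dvd L)"
  have p: "prime p" "p dvd L"
    using LeastI_ex[OF ex] by (auto simp: p_def)
  have least: "p \<le> r" if "prime r" "r dvd L" for r
    unfolding p_def using that by (intro Least_le) auto
  define n where "n = L div p"
  have L: "L = n * p"
    using p by (simp add: n_def)
  have Lpos: "L > 0"
    unfolding L_def by (simp add: lcm_pos_nat)
  have dvd: "ord A dvd n * p" "ord B dvd n * p"
    by (simp_all add: L_def flip: L)
  have "\<not> L dvd n"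
    using Lpos L prime_gt_1_nat[OF p(1)] by (auto dest!: dvd_imp_le)
  then have "A [^] n \<noteq> \<one> \<or> B [^] n \<noteq> \<one>"
    by (auto simp: pow_eq_id L_def)
  then have "\<exists>z\<in>carrier G. z \<noteq> \<one> \<and> z [^] p = \<one> \<and> (\<forall>g\<in>carrier G. z \<otimes> g = g \<otimes> z)"
  proof
    assume "A [^] n \<noteq> \<one>"
    then show ?thesis
      using least by (rule central_element_of_pow_A[OF p(1) dvd]) (simp_all add: L_def)
  next
    assume "B [^] n \<noteq> \<one>"
    then show ?thesis
      using least
      by (rule macdonald_group.central_element_of_pow_A[OF swap p(1) dvd(2,1)]) (simp_all add: L_def)
  qed
  moreover have "L dvd ord A * ord B"
    by (simp add: L_def lcm_least)
  then have "p dvd ord A * ord B"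
    using p(2) dvd_trans by blast
  ultimately show ?thesis
    using p(1) by blast
qed

end

subsection \<open>Central series\<close>

lemma (in group) subgroup_nat_pow_closed:
  assumes "subgroup H G" "x \<in> H"
  shows "x [^] (n::nat) \<in> H"
  by (induction n) (use assms in \<open>auto simp: subgroup.one_closed subgroup.m_closed\<close>)

context macdonald_group
begin

lemma quotient_hom:
  assumes "K \<lhd> G"
  shows "group_hom G (G Mod K) (\<lambda>x. K #> x)"
  using assms by (intro group_hom.intro group_hom_axioms.intro is_group normal.factorgroup_is_group
      normal.r_coset_hom_Mod)

lemma hom_image:
  assumes "group_hom G Q \<pi>" "carrier Q = \<pi> ` carrier G"
  shows "macdonald_group Q (\<pi> A) (\<pi> B) (\<pi> C) \<alpha> \<beta>"
proof -
  interpret \<pi>: group_hom G Q \<pi> by fact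
  show ?thesis
  proof
    show "finite (carrier Q)"
      by (simp add: assms(2) finite_carrier)
    have "generate Q (\<pi> ` {A, B}) = \<pi> ` generate G {A, B}"
      by (rule \<pi>.generate_img) auto
    then show "generate Q {\<pi> A, \<pi> B} = carrier Q"
      by (simp add: assms(2) gen)
    show "\<pi> A \<otimes>\<^bsub>Q\<^esub> \<pi> B = \<pi> B \<otimes>\<^bsub>Q\<^esub> (\<pi> A \<otimes>\<^bsub>Q\<^esub> \<pi> C)"
      by (metis AB A_closed B_closed C_closed \<pi>.hom_mult m_closed)
    show "\<pi> A \<otimes>\<^bsub>Q\<^esub> \<pi> C = \<pi> C \<otimes>\<^bsub>Q\<^esub> \<pi> A [^]\<^bsub>Q\<^esub> \<alpha>"
      by (metis AC A_closed C_closed \<pi>.hom_mult \<pi>.hom_nat_pow nat_pow_closed)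
    show "\<pi> C \<otimes>\<^bsub>Q\<^esub> \<pi> B = \<pi> B [^]\<^bsub>Q\<^esub> \<beta> \<otimes>\<^bsub>Q\<^esub> \<pi> C"
      by (metis CB B_closed C_closed \<pi>.hom_mult \<pi>.hom_nat_pow nat_pow_closed)
  qed auto
qed

text \<open>Hides the cosets: membership in K becomes being trivial in Q, and a commutator in K
  becomes commuting images.\<close>

lemma obtain_quotient:
  assumes "K \<lhd> G"
  obtains Q :: "'a set monoid" and \<pi> where "group_hom G Q \<pi>" "macdonald_group Q (\<pi> A) (\<pi> B) (\<pi> C) \<alpha> \<beta>"
    "carrier Q = \<pi> ` carrier G" "\<forall>x\<in>carrier G. \<pi> x = \<one>\<^bsub>Q\<^esub> \<longleftrightarrow> x \<in> K"
    "\<forall>x\<in>carrier G. \<forall>g\<in>carrier G.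
         inv (g \<otimes> x) \<otimes> (x \<otimes> g) \<in> K \<longleftrightarrow> \<pi> x \<otimes>\<^bsub>Q\<^esub> \<pi> g = \<pi> g \<otimes>\<^bsub>Q\<^esub> \<pi> x"
proof -
  have one: "K #> x = \<one>\<^bsub>G Mod K\<^esub> \<longleftrightarrow> x \<in> K" if "x \<in> carrier G" for x
    using assms that coset_join1[of K x] coset_join2[of x K]
    by (auto simp: normal_imp_subgroup subgroup.subset FactGroup_def)
  define Q where "Q = G Mod K"
  define \<pi> where "\<pi> = (\<lambda>x. K #> x)"
  interpret \<pi>: group_hom G Q \<pi>
    unfolding Q_def \<pi>_def by (rule quotient_hom[OF assms])
  have one': "\<pi> x = \<one>\<^bsub>Q\<^esub> \<longleftrightarrow> x \<in> K" if "x \<in> carrier G" for x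
    unfolding Q_def \<pi>_def using that by (rule one)
  have "inv (g \<otimes> x) \<otimes> (x \<otimes> g) \<in> K \<longleftrightarrow> \<pi> x \<otimes>\<^bsub>Q\<^esub> \<pi> g = \<pi> g \<otimes>\<^bsub>Q\<^esub> \<pi> x"
    if "x \<in> carrier G" "g \<in> carrier G" for x g
  proof -
    have "inv (g \<otimes> x) \<otimes> (x \<otimes> g) \<in> K \<longleftrightarrow> inv\<^bsub>Q\<^esub> (\<pi> (g \<otimes> x)) \<otimes>\<^bsub>Q\<^esub> \<pi> (x \<otimes> g) = \<one>\<^bsub>Q\<^esub>"
      using that one'[of "inv (g \<otimes> x) \<otimes> (x \<otimes> g)"] by (simp del: inv_mult_group)
    also have "\<dots> \<longleftrightarrow> \<pi> (x \<otimes> g) = \<pi> (g \<otimes> x)"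
      using that by (metis \<pi>.H.inv_solve_left' \<pi>.H.one_closed \<pi>.H.r_one \<pi>.hom_closed m_closed)
    finally show ?thesis
      using that by simp
  qed
  moreover have "carrier Q = \<pi> ` carrier G"
    by (auto simp: Q_def \<pi>_def FactGroup_def RCOSETS_def)
  moreover from this have "macdonald_group Q (\<pi> A) (\<pi> B) (\<pi> C) \<alpha> \<beta>"
    by (rule hom_image[OF \<pi>.group_hom_axioms])
  ultimately show ?thesis
    using that[of Q \<pi>] \<pi>.group_hom_axioms one' by blast
qed

lemma central_step:
  assumes K: "K \<lhd> G" "K \<noteq> carrier G"
  shows "\<exists>K' p. K' \<lhd> G \<and> K \<subset> K' \<and> prime p \<and> p dvd ord A * ord B \<and>
    (\<forall>x\<in>K'. x [^] p \<in> K) \<and> (\<forall>x\<in>K'. \<forall>g\<in>carrier G. inv (g \<otimes> x) \<otimes> (x \<otimes> g) \<in> K)"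
proof -
  obtain Q :: "'a set monoid" and \<pi> where \<pi>: "group_hom G Q \<pi>"
    and Q: "macdonald_group Q (\<pi> A) (\<pi> B) (\<pi> C) \<alpha> \<beta>" and carrier: "carrier Q = \<pi> ` carrier G"
    and one: "\<forall>x\<in>carrier G. \<pi> x = \<one>\<^bsub>Q\<^esub> \<longleftrightarrow> x \<in> K"
    and comm: "\<forall>x\<in>carrier G. \<forall>g\<in>carrier G.
         inv (g \<otimes> x) \<otimes> (x \<otimes> g) \<in> K \<longleftrightarrow> \<pi> x \<otimes>\<^bsub>Q\<^esub> \<pi> g = \<pi> g \<otimes>\<^bsub>Q\<^esub> \<pi> x"
    by (rule obtain_quotient[OF K(1)])
  interpret \<pi>: group_hom G Q \<pi> by (rule \<pi>)
  interpret Q: macdonald_group Q "\<pi> A" "\<pi> B" "\<pi> C" \<alpha> \<beta> by (rule Q)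
  have Kc: "K \<subseteq> carrier G"
    using K(1) by (simp add: normal_imp_subgroup subgroup.subset)
  have "carrier Q \<noteq> {\<one>\<^bsub>Q\<^esub>}"
  proof
    assume "carrier Q = {\<one>\<^bsub>Q\<^esub>}"
    then have "x \<in> K" if "x \<in> carrier G" for x
      using bspec[OF one that] that carrier by blast
    then show False
      using K(2) Kc by blast
  qed
  from Q.central_element[OF this] obtain p z
    where p: "prime p" "p dvd group.ord Q (\<pi> A) * group.ord Q (\<pi> B)"
    and z: "z \<in> carrier Q" "z \<noteq> \<one>\<^bsub>Q\<^esub>" "z [^]\<^bsub>Q\<^esub> p = \<one>\<^bsub>Q\<^esub>"
      "\<forall>g\<in>carrier Q. z \<otimes>\<^bsub>Q\<^esub> g = g \<otimes>\<^bsub>Q\<^esub> z"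
    by blast
  have "group.ord Q (\<pi> A) dvd ord A" "group.ord Q (\<pi> B) dvd ord B"
    by (simp_all add: \<pi>.H.pow_eq_id[symmetric] flip: \<pi>.hom_nat_pow)
  then have "p dvd ord A * ord B"
    using p(2) by (meson dvd_trans mult_dvd_mono)
  \<comment> \<open>All central elements with trivial p-th power are taken, so that Z is a subgroup
    with normal preimage; z witnesses that the preimage is larger than K.\<close>
  moreover define Z where "Z = {x \<in> carrier Q. x [^]\<^bsub>Q\<^esub> p = \<one>\<^bsub>Q\<^esub> \<and>
      (\<forall>g\<in>carrier Q. x \<otimes>\<^bsub>Q\<^esub> g = g \<otimes>\<^bsub>Q\<^esub> x)}"
  define K' where "K' = {x \<in> carrier G. \<pi> x \<in> Z}"
  have "subgroup Z Q"
  proof (rule \<pi>.H.subgroupI)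
    show "Z \<noteq> {}"
      using z(1,3,4) by (auto simp: Z_def)
    show "inv\<^bsub>Q\<^esub> x \<in> Z" if "x \<in> Z" for x
    proof -
      have "inv\<^bsub>Q\<^esub> x \<otimes>\<^bsub>Q\<^esub> g = g \<otimes>\<^bsub>Q\<^esub> inv\<^bsub>Q\<^esub> x" if "g \<in> carrier Q" for g
        by (rule \<pi>.H.commute_inv) (use \<open>x \<in> Z\<close> that in \<open>auto simp: Z_def\<close>)
      then show ?thesis
        using that by (auto simp: Z_def \<pi>.H.nat_pow_inv)
    qed
    show "x \<otimes>\<^bsub>Q\<^esub> y \<in> Z" if "x \<in> Z" "y \<in> Z" for x y
    proof -
      have xy: "x \<otimes>\<^bsub>Q\<^esub> y = y \<otimes>\<^bsub>Q\<^esub> x" "x \<in> carrier Q" "y \<in> carrier Q"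
        using that unfolding Z_def by blast+
      have "x \<otimes>\<^bsub>Q\<^esub> y \<otimes>\<^bsub>Q\<^esub> g = g \<otimes>\<^bsub>Q\<^esub> (x \<otimes>\<^bsub>Q\<^esub> y)" if "g \<in> carrier Q" for g
        by (rule \<pi>.H.commute_mult) (use \<open>x \<in> Z\<close> \<open>y \<in> Z\<close> that in \<open>auto simp: Z_def\<close>)
      moreover have "x [^]\<^bsub>Q\<^esub> p = \<one>\<^bsub>Q\<^esub>" "y [^]\<^bsub>Q\<^esub> p = \<one>\<^bsub>Q\<^esub>" "x \<otimes>\<^bsub>Q\<^esub> y \<in> carrier Q"
        using that xy(2,3) \<pi>.H.m_closed unfolding Z_def by blast+
      moreover have "(x \<otimes>\<^bsub>Q\<^esub> y) [^]\<^bsub>Q\<^esub> p = x [^]\<^bsub>Q\<^esub> p \<otimes>\<^bsub>Q\<^esub> y [^]\<^bsub>Q\<^esub> p"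
        using xy by (intro \<pi>.H.pow_mult_distrib)
      then have "(x \<otimes>\<^bsub>Q\<^esub> y) [^]\<^bsub>Q\<^esub> p = \<one>\<^bsub>Q\<^esub>"
        using calculation(2,3) by simp
      ultimately show ?thesis
        unfolding Z_def by blast
    qed
  qed (auto simp: Z_def)
  then interpret Z: subgroup Z Q .
  have "K' \<lhd> G"
  proof (rule normal_invI)
    show "subgroup K' G"
      by (rule subgroupI) (auto simp: K'_def intro!: exI[of _ \<one>])
    fix x h assume x: "x \<in> carrier G" and h: "h \<in> K'"
    then have hc: "h \<in> carrier G"
      by (simp add: K'_def)
    have hx: "\<pi> h \<otimes>\<^bsub>Q\<^esub> \<pi> (inv x) = \<pi> (inv x) \<otimes>\<^bsub>Q\<^esub> \<pi> h"
      using h \<pi>.hom_closed[OF inv_closed[OF x]] unfolding K'_def Z_def by blast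
    have "\<pi> (x \<otimes> h \<otimes> inv x) = \<pi> x \<otimes>\<^bsub>Q\<^esub> (\<pi> h \<otimes>\<^bsub>Q\<^esub> \<pi> (inv x))"
      using x hc by (simp add: m_assoc del: \<pi>.hom_inv)
    also have "\<dots> = \<pi> h"
      unfolding hx using x hc by simp
    finally show "x \<otimes> h \<otimes> inv x \<in> K'"
      using x h by (simp add: K'_def)
  qed
  moreover have "K \<subseteq> K'"
  proof
    fix x assume "x \<in> K"
    then have "x \<in> carrier G" "\<pi> x = \<one>\<^bsub>Q\<^esub>"
      using one Kc by blast+
    then show "x \<in> K'"
      unfolding K'_def using Z.one_closed by simp
  qed
  moreover obtain y where y: "y \<in> carrier G" "z = \<pi> y"
    using z(1) carrier by blast
  then have "y \<in> K'"
    using z unfolding K'_def Z_def by blast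
  moreover have "y \<notin> K"
    using y z(2) one by blast
  moreover have "x [^] p \<in> K" if "x \<in> K'" for x
  proof -
    have "x \<in> carrier G" "\<pi> x [^]\<^bsub>Q\<^esub> p = \<one>\<^bsub>Q\<^esub>"
      using that unfolding K'_def Z_def by blast+
    then show ?thesis
      using bspec[OF one, of "x [^] p"] by (simp add: \<pi>.hom_nat_pow)
  qed
  moreover have "inv (g \<otimes> x) \<otimes> (x \<otimes> g) \<in> K" if "x \<in> K'" "g \<in> carrier G" for x g
  proof -
    have "x \<in> carrier G" "\<pi> x \<otimes>\<^bsub>Q\<^esub> \<pi> g = \<pi> g \<otimes>\<^bsub>Q\<^esub> \<pi> x"
      using that \<pi>.hom_closed[OF that(2)] unfolding K'_def Z_def by blast+
    then show ?thesis
      using comm that(2) by blast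
  qed
  ultimately show ?thesis
    using p(1) by (intro exI[of _ K'] exI[of _ p]) auto
qed

text \<open>Induction on |G| - |K|, descending from the whole group; applied at K = {1}, it lets a
  property be pushed down through successive central sections of prime exponent. It stands in for
  nilpotency.\<close>

lemma central_induct [consumes 1, case_names carrier step]:
  assumes "K \<lhd> G"
    and "P (carrier G)"
    and "\<And>K K' p. K \<lhd> G \<Longrightarrow> K' \<lhd> G \<Longrightarrow> prime p \<Longrightarrow> p dvd ord A * ord B \<Longrightarrow> (\<And>x. x \<in> K' \<Longrightarrow> x [^] p \<in> K) \<Longrightarrow>
      (\<And>x g. x \<in> K' \<Longrightarrow> g \<in> carrier G \<Longrightarrow> inv (g \<otimes> x) \<otimes> (x \<otimes> g) \<in> K) \<Longrightarrow> P K' \<Longrightarrow> P K"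
  shows "P K"
  using assms(1)
proof (induction "card (carrier G) - card K" arbitrary: K rule: less_induct)
  case less
  show ?case
  proof (cases "K = carrier G")
    case False
    then obtain K' p where K': "K' \<lhd> G" "K \<subset> K'" "prime p" "p dvd ord A * ord B"
      "\<forall>x\<in>K'. x [^] p \<in> K" "\<forall>x\<in>K'. \<forall>g\<in>carrier G. inv (g \<otimes> x) \<otimes> (x \<otimes> g) \<in> K"
      using central_step[OF less.prems] by blast
    have sub: "K' \<subseteq> carrier G"
      using K'(1) by (simp add: normal_imp_subgroup subgroup.subset)
    then have fin: "finite K'"
      using finite_carrier finite_subset by blast
    have "card K < card K'" "card K' \<le> card (carrier G)"
      using K'(2) sub fin finite_carrier by (auto intro: psubset_card_mono card_mono)
    then have "P K'"
      using K'(1) by (intro less.hyps) auto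
    then show ?thesis
      using assms(3)[OF less.prems K'(1,3,4)] K'(5,6) by blast
  qed (use assms(2) in simp)
qed

text \<open>Each descent from K' to K costs one p-th power, and p divides
  \<open>ord A * ord B\<close>. So no other primes occur in the orders of elements.\<close>

lemma exponent_power: "\<forall>x\<in>carrier G. \<exists>e. x [^] ((ord A * ord B) ^ e) = \<one>"
proof -
  have "\<forall>x\<in>carrier G. \<exists>e. x [^] ((ord A * ord B) ^ e) \<in> {\<one>}"
    using one_is_normal
  proof (induction rule: central_induct)
    case (step K K' p)
    show ?case
    proof
      fix x assume x: "x \<in> carrier G"
      then obtain e where e: "x [^] ((ord A * ord B) ^ e) \<in> K'"
        using step by blast
      obtain t where t: "ord A * ord B = p * t"
        using step(4) by blast
      have "((x [^] ((ord A * ord B) ^ e)) [^] p) [^] t \<in> K"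
        using step(5)[OF e] subgroup_nat_pow_closed[OF normal_imp_subgroup[OF step(1)]] by blast
      then have "x [^] ((ord A * ord B) ^ Suc e) \<in> K"
        using x by (simp add: nat_pow_pow t mult_ac)
      then show "\<exists>e. x [^] ((ord A * ord B) ^ e) \<in> K"
        by blast
    qed
  qed auto
  then show ?thesis
    by simp
qed

end

section \<open>Elements of coprime order commute\<close>

context group
begin

lemma central_commutator_pow:
  assumes "x \<in> carrier G" "y \<in> carrier G" "w \<in> carrier G" "x \<otimes> y = y \<otimes> (x \<otimes> w)"
    "w \<otimes> x = x \<otimes> w" "x [^] (m::nat) = \<one>"
  shows "w [^] m = \<one>"
proof -
  have "x [^] m \<otimes> y = y \<otimes> (x \<otimes> w) [^] m"
    using assms by (intro conj_pow) auto
  also have "(x \<otimes> w) [^] m = x [^] m \<otimes> w [^] m"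
    using assms by (intro pow_mult_distrib) auto
  finally have "y \<otimes> w [^] m = y \<otimes> \<one>"
    using assms by simp
  then show ?thesis
    using assms by (simp del: r_one)
qed

lemma coprime_pow_eq_one:
  assumes "w \<in> carrier G" "w [^] (m::nat) = \<one>" "w [^] (n::nat) = \<one>" "coprime m n"
  shows "w = \<one>"
proof -
  have "ord w dvd 1"
    using assms by (metis coprime_def pow_eq_id is_unit_gcd gcd_greatest)
  then show ?thesis
    using assms(1) ord_eq_1 by auto
qed

text \<open>A commutator that commutes with both entries is killed by any exponent killing either
  entry.\<close>

lemma coprime_central_commutator:
  assumes "x \<in> carrier G" "y \<in> carrier G" "w \<in> carrier G" "x \<otimes> y = y \<otimes> (x \<otimes> w)"
    "w \<otimes> x = x \<otimes> w" "w \<otimes> y = y \<otimes> w" "x [^] (m::nat) = \<one>" "y [^] (n::nat) = \<one>" "coprime m n"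
  shows "w = \<one>"
proof (rule coprime_pow_eq_one)
  show "w [^] m = \<one>"
    using assms(1-5,7) by (rule central_commutator_pow)
  have "x \<otimes> (y \<otimes> inv w) = (y \<otimes> (x \<otimes> w)) \<otimes> inv w"
    unfolding assms(4)[symmetric] using assms(1-3) by (simp add: m_assoc)
  also have "\<dots> = y \<otimes> x"
    using assms(1-3) by (simp add: m_assoc)
  finally have "(inv w) [^] n = \<one>"
    using assms commute_inv[of w y] by (intro central_commutator_pow[of y x "inv w"]) simp_all
  then show "w [^] n = \<one>"
    using assms by (simp add: nat_pow_inv)
qed (use assms in auto)

end

context macdonald_group
begin

text \<open>If the commutator w lies in K', its image modulo K is central, hence killed by both m
  and n, hence trivial. Thus w descends from G to {1}.\<close>

lemma coprime_order_commute:
  assumes "x \<in> carrier G" "y \<in> carrier G" "x [^] (m::nat) = \<one>" "y [^] (n::nat) = \<one>" "coprime m n"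
  shows "x \<otimes> y = y \<otimes> x"
proof -
  define w where "w = inv x \<otimes> inv y \<otimes> x \<otimes> y"
  have w: "w \<in> carrier G" "x \<otimes> y = y \<otimes> (x \<otimes> w)"
    using assms by (auto simp: w_def m_assoc)
  have "w \<in> {\<one>}"
    using one_is_normal
  proof (induction rule: central_induct)
    case (step K K' p)
    obtain Q :: "'a set monoid" and \<pi> where \<pi>: "group_hom G Q \<pi>"
      and "macdonald_group Q (\<pi> A) (\<pi> B) (\<pi> C) \<alpha> \<beta>" "carrier Q = \<pi> ` carrier G"
      and one: "\<forall>x\<in>carrier G. \<pi> x = \<one>\<^bsub>Q\<^esub> \<longleftrightarrow> x \<in> K"
      and comm: "\<forall>x\<in>carrier G. \<forall>g\<in>carrier G.
         inv (g \<otimes> x) \<otimes> (x \<otimes> g) \<in> K \<longleftrightarrow> \<pi> x \<otimes>\<^bsub>Q\<^esub> \<pi> g = \<pi> g \<otimes>\<^bsub>Q\<^esub> \<pi> x"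
      by (rule obtain_quotient[OF step(1)])
    interpret \<pi>: group_hom G Q \<pi> by (rule \<pi>)
    have "\<pi> w = \<one>\<^bsub>Q\<^esub>"
    proof (rule \<pi>.H.coprime_central_commutator)
      show "\<pi> x \<otimes>\<^bsub>Q\<^esub> \<pi> y = \<pi> y \<otimes>\<^bsub>Q\<^esub> (\<pi> x \<otimes>\<^bsub>Q\<^esub> \<pi> w)"
        using w assms(1,2) by (metis \<pi>.hom_mult m_closed)
      show "\<pi> w \<otimes>\<^bsub>Q\<^esub> \<pi> x = \<pi> x \<otimes>\<^bsub>Q\<^esub> \<pi> w"
        using w(1) assms(1) step(6)[OF step(7)] comm by blast
      show "\<pi> w \<otimes>\<^bsub>Q\<^esub> \<pi> y = \<pi> y \<otimes>\<^bsub>Q\<^esub> \<pi> w"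
        using w(1) assms(2) step(6)[OF step(7)] comm by blast
      show "\<pi> x [^]\<^bsub>Q\<^esub> m = \<one>\<^bsub>Q\<^esub>" "\<pi> y [^]\<^bsub>Q\<^esub> n = \<one>\<^bsub>Q\<^esub>"
        using assms by (simp_all flip: \<pi>.hom_nat_pow)
    qed (use assms w in auto)
    then show ?case
      using bspec[OF one w(1)] by simp
  qed (use w in auto)
  then show ?thesis
    using w assms by simp
qed

end

subsection \<open>The case of 3-power order\<close>

lemma mod_9_cases:
  fixes a :: nat
  assumes "a mod 9 \<in> {4, 7}"
  shows "a mod 27 \<in> {4, 13, 22, 7, 16, 25}"
proof -
  have "a mod 27 div 9 < 3" "a mod 27 mod 9 = a mod 9"
    by (simp_all add: div_less_iff_less_mult mod_mod_cancel)
  moreover have "a mod 27 = a mod 27 div 9 * 9 + a mod 27 mod 9"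
    by simp
  moreover from this(1) have "a mod 27 div 9 = 0 \<or> a mod 27 div 9 = 1 \<or> a mod 27 div 9 = 2"
    by linarith
  ultimately show ?thesis
    using assms by auto
qed

lemma geo_9_cong:
  fixes a :: nat
  assumes "a mod 9 \<in> {4, 7}"
  shows "[a * geo a 9 = 9] (mod 27)"
proof -
  have "[a * geo a 9 = (a mod 27) * geo (a mod 27) 9] (mod 27)"
    by (intro cong_mult cong_geo) (auto simp: cong_def)
  then show ?thesis
    using mod_9_cases[OF assms] by (auto simp: geo_def cong_def lessThan_nat_numeral)
qed

lemma geo_3_cong:
  fixes a :: nat
  assumes "a mod 9 \<in> {4, 7}"
  shows "[a * geo a 3 = 3] (mod 9)"
proof -
  have "[a * geo a 3 = (a mod 9) * geo (a mod 9) 3] (mod 9)"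
    by (intro cong_mult cong_geo) (auto simp: cong_def)
  then show ?thesis
    using assms by (auto simp: geo_def cong_def lessThan_nat_numeral)
qed

text \<open>Cubing raises the power of 3 in a - 1 from exactly one to exactly two. The negative part
  is what will exclude elements of order 27.\<close>

lemma cube_cong:
  fixes a :: nat
  assumes "a mod 9 \<in> {4, 7}"
  shows "[a ^ 3 = 1] (mod 9)" "[a ^ 3 \<noteq> 1] (mod 27)"
proof -
  have "[a ^ 3 = (a mod 9) ^ 3] (mod 9)" "[a ^ 3 = (a mod 27) ^ 3] (mod 27)"
    by (simp_all add: cong_def power_mod)
  then show "[a ^ 3 = 1] (mod 9)" "[a ^ 3 \<noteq> 1] (mod 27)"
    using assms mod_9_cases[OF assms] by (auto simp: cong_def)
qed

text \<open>Both sides depend only on a modulo 9: nine consecutive terms of the sum cancel, and a^3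
  is 1. The point is that for j = 1 the exponent of \<open>A\<close> in
  \<open>C_pow_A_pow_in_B\<close> becomes a multiple of 9.\<close>

lemma geo_self_cong:
  fixes a :: nat
  assumes "a mod 9 \<in> {4, 7}"
  shows "[a * geo a a = a ^ (a + 1)] (mod 9)"
proof -
  define r where "r = a mod 9"
  define t where "t = a div 9"
  have t: "a = r + 9 * t"
    by (simp add: r_def t_def)
  have ar: "[a = r] (mod 9)"
    by (simp add: r_def cong_def)
  have "[a * geo a 9 = 0] (mod 9)"
    using cong_dvd_modulus_nat[OF geo_9_cong[OF assms], of 9] by (simp add: cong_def)
  then have "[a * geo a 9 * (a ^ r * geo (a ^ 9) t) = 0] (mod 9)"
    by (metis cong_0_iff dvd_mult2)
  then have "[a * geo a r + a * geo a 9 * (a ^ r * geo (a ^ 9) t) = a * geo a r + 0] (mod 9)"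
    by (intro cong_add) auto
  moreover have "geo a a = geo a r + a ^ r * (geo a 9 * geo (a ^ 9) t)"
    using geo_add[of a r "9 * t"] by (simp only: geo_mult[of a 9 t] t[symmetric])
  then have "a * geo a a = a * geo a r + a * geo a 9 * (a ^ r * geo (a ^ 9) t)"
    by (simp add: algebra_simps)
  ultimately have "[a * geo a a = a * geo a r] (mod 9)"
    by simp
  also have "[a * geo a r = r * geo r r] (mod 9)"
    using ar by (intro cong_mult cong_geo)
  also have "[r * geo r r = r ^ (r + 1)] (mod 9)"
    using assms by (auto simp: r_def geo_def cong_def lessThan_nat_numeral)
  also have "[r ^ (r + 1) = a ^ (r + 1)] (mod 9)"
    using ar by (intro cong_pow) (rule cong_sym)
  also have "[a ^ (r + 1) = a ^ (a + 1)] (mod 9)"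
  proof -
    have "[a ^ (r + 1) * 1 ^ (3 * t) = a ^ (r + 1) * (a ^ 3) ^ (3 * t)] (mod 9)"
      using cube_cong(1)[OF assms] by (intro cong_mult cong_pow) (auto intro: cong_sym)
    also have "a ^ (r + 1) * (a ^ 3) ^ (3 * t) = a ^ (r + 9 * t + 1)"
      by (simp add: power_add mult.assoc flip: power_mult)
    finally show ?thesis
      by (simp only: t[symmetric]) simp
  qed
  finally show ?thesis .
qed

text \<open>Here the residues have to be different: a - b is then 3 or -3 modulo 9, and c = 1 or c =
  2 serves. With equal residues the product would always be 0 modulo 9.\<close>

lemma diff_mult_cong_3:
  fixes a b :: nat
  assumes "a mod 9 = 7 \<and> b mod 9 = 4 \<or> a mod 9 = 4 \<and> b mod 9 = 7"
  shows "\<exists>c::nat. (9::int) dvd (int a - int b) * int c - 3"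
proof -
  have "int a mod 9 = 7 \<and> int b mod 9 = 4 \<or> int a mod 9 = 4 \<and> int b mod 9 = 7"
    using assms by (metis of_nat_mod of_nat_numeral)
  then have "9 dvd (int a - int b) * int 1 - 3 \<or> 9 dvd (int a - int b) * int 2 - 3"
    by presburger
  then show ?thesis
    by blast
qed

text \<open>The disjunction keeps the locale stable under exchanging the generators.\<close>

locale macdonald_group_3 = macdonald_group +
  assumes residues: "\<alpha> mod 9 = 7 \<and> \<beta> mod 9 = 4 \<or> \<alpha> mod 9 = 4 \<and> \<beta> mod 9 = 7"
begin

lemma residues': "\<alpha> mod 9 \<in> {4, 7}" "\<beta> mod 9 \<in> {4, 7}"
  using residues by auto

lemma swap_3: "macdonald_group_3 G B A (inv C) \<beta> \<alpha>"
  using swap residues by (auto simp: macdonald_group_3_def macdonald_group_3_axioms_def)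

lemma C_diff_A_pow_9_in_B:
  "\<exists>e::int. C [^] (int \<alpha> - int \<beta>) \<otimes> (A [^] (9::nat)) [^] e \<in> generate G {B}"
proof -
  have "int 9 dvd int (\<alpha> * geo \<alpha> \<alpha>) - int (\<alpha> ^ (\<alpha> + 1))"
    using geo_self_cong[OF residues'(1)] by (metis cong_iff_dvd_diff cong_int_iff)
  then obtain e where "int (\<alpha> * geo \<alpha> \<alpha>) - int (\<alpha> ^ (\<alpha> + 1)) = 9 * e"
    by auto
  then have "A [^] (int (\<alpha> * geo \<alpha> \<alpha>) - int (\<alpha> ^ (\<alpha> + 1))) = (A [^] (9::nat)) [^] e"
    using int_pow_pow[of A 9 e] int_pow_int[of G A 9] by simp
  then show ?thesis
    using C_pow_A_pow_in_B[of 1] by (intro exI[of _ e]) simp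
qed

lemma C_diff_commute_B:
  assumes "\<And>g. g \<in> carrier G \<Longrightarrow> A [^] (9::nat) \<otimes> g = g \<otimes> A [^] (9::nat)"
  shows "C [^] (int \<alpha> - int \<beta>) \<otimes> B = B \<otimes> C [^] (int \<alpha> - int \<beta>)"
proof -
  obtain e where e: "C [^] (int \<alpha> - int \<beta>) \<otimes> (A [^] (9::nat)) [^] (e::int) \<in> generate G {B}"
    using C_diff_A_pow_9_in_B by blast
  let ?u = "C [^] (int \<alpha> - int \<beta>)" and ?v = "(A [^] (9::nat)) [^] e"
  have uv: "(?u \<otimes> ?v) \<otimes> B = B \<otimes> (?u \<otimes> ?v)"
    using e by (rule commute_generate[rotated 3]) auto
  have v: "?v \<otimes> B = B \<otimes> ?v"
  proof -
    have "A [^] (9::nat) \<in> generate G {A [^] (9::nat)}"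
      by (simp add: generate.incl)
    then have "?v \<in> generate G {A [^] (9::nat)}"
      by (auto simp: generate_pow)
    then show ?thesis
      by (rule commute_generate[rotated 3]) (use assms[OF B_closed] in auto)
  qed
  have "(?u \<otimes> B) \<otimes> ?v = (?u \<otimes> ?v) \<otimes> B"
    by (simp add: m_assoc v)
  also have "\<dots> = (B \<otimes> ?u) \<otimes> ?v"
    using uv by (simp add: m_assoc)
  finally show ?thesis
    by (simp del: m_assoc)
qed

text \<open>In \<open>A^9 B = B C^9 A^e\<close> the exponent e is 9 modulo 27, so \<open>A^e\<close>
  is \<open>A^9\<close> and cancels.\<close>

lemma C_pow_9:
  assumes "A [^] (27::nat) = \<one>" "A [^] (9::nat) \<otimes> B = B \<otimes> A [^] (9::nat)"
  shows "C [^] (9::nat) = \<one>"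
proof -
  have "ord A dvd 27"
    using assms(1) by (simp add: pow_eq_id)
  then have "[\<alpha> * geo \<alpha> 9 = 9] (mod ord A)"
    using geo_9_cong[OF residues'(1)] cong_dvd_modulus_nat by blast
  then have "A [^] (\<alpha> * geo \<alpha> 9) = A [^] (9::nat)"
    by (intro pow_cong_ord) auto
  then have "B \<otimes> (C [^] (9::nat) \<otimes> A [^] (9::nat)) = B \<otimes> A [^] (9::nat)"
    using A_pow_B[of 9] assms(2) by simp
  then have "C [^] (9::nat) \<otimes> A [^] (9::nat) = \<one> \<otimes> A [^] (9::nat)"
    by simp
  then show ?thesis
    by (simp del: l_one)
qed

lemma C_pow_3_eq_diff_pow:
  assumes "C [^] (9::nat) = \<one>"
  shows "\<exists>c::nat. C [^] (3::nat) = (C [^] (int \<alpha> - int \<beta>)) [^] c"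
proof -
  obtain c :: nat where c: "(9::int) dvd (int \<alpha> - int \<beta>) * int c - 3"
    using diff_mult_cong_3[OF residues] by blast
  have "ord C dvd 9"
    using assms by (simp add: pow_eq_id)
  then have "int (ord C) dvd 9"
    by (metis int_dvd_int_iff of_nat_numeral)
  then have "int (ord C) dvd (int \<alpha> - int \<beta>) * int c - 3"
    using c dvd_trans by blast
  then have "C [^] ((int \<alpha> - int \<beta>) * int c) = C [^] (3::int)"
    by (simp add: int_pow_eq dvd_diff_commute)
  then have "(C [^] (int \<alpha> - int \<beta>)) [^] int c = C [^] int 3"
    by (simp add: int_pow_pow)
  then show ?thesis
    by (metis int_pow_int)
qed

text \<open>Centrality of \<open>B^9\<close> makes \<open>C^(\<alpha> - \<beta>)\<close> commute
  with \<open>A\<close>. Since \<open>C^9 = 1\<close>, its powers include \<open>C^3\<close>, which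
  therefore commutes with \<open>A\<close> as well while conjugating it to
  \<open>A^(\<alpha>^3)\<close>. Order 27 would force \<alpha>^3 to be 1 modulo 27.\<close>

lemma A_pow_9_if_central:
  assumes "A [^] (27::nat) = \<one>" "B [^] (27::nat) = \<one>"
    and Az: "\<And>g. g \<in> carrier G \<Longrightarrow> A [^] (9::nat) \<otimes> g = g \<otimes> A [^] (9::nat)"
    and Bz: "\<And>g. g \<in> carrier G \<Longrightarrow> B [^] (9::nat) \<otimes> g = g \<otimes> B [^] (9::nat)"
  shows "A [^] (9::nat) = \<one>"
proof -
  have C9: "C [^] (9::nat) = \<one>"
    using C_pow_9 assms(1) Az by blast
  define u where "u = C [^] (int \<alpha> - int \<beta>)"
  have u: "u \<in> carrier G"
    by (simp add: u_def)
  have "inv C [^] (int \<beta> - int \<alpha>) = u"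
    using int_pow_neg[of C "int \<alpha> - int \<beta>"] by (simp add: u_def int_pow_inv)
  then have "u \<otimes> A = A \<otimes> u"
    using macdonald_group_3.C_diff_commute_B[OF swap_3 Bz] by simp
  moreover obtain c where c: "C [^] (3::nat) = u [^] (c::nat)"
    using C_pow_3_eq_diff_pow[OF C9] by (auto simp: u_def)
  ultimately have "C [^] (3::nat) \<otimes> A = A \<otimes> C [^] (3::nat)"
    unfolding c using u by (intro commute_pow) auto
  then have "C [^] (3::nat) \<otimes> A = C [^] (3::nat) \<otimes> A [^] (\<alpha> ^ 3)"
    using A_pow_C_pow[of 1 3] by simp
  then have "A [^] (\<alpha> ^ 3) = A [^] (1::nat)"
    by simp
  then have "[\<alpha> ^ 3 = 1] (mod ord A)"
    by (intro cong_ord_pow) auto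
  then have "ord A \<noteq> 27"
    using cube_cong(2)[OF residues'(1)] by auto
  moreover have "ord A dvd 3 ^ 3"
    using assms(1) by (simp add: pow_eq_id)
  moreover have "prime (3::nat)"
    by simp
  ultimately obtain i where i: "i \<le> 3" "ord A = 3 ^ i" "ord A \<noteq> 27"
    using divides_primepow_nat by blast
  then have "i \<noteq> 3"
    by auto
  then have "ord A dvd 3 ^ 2"
    unfolding i(2) using i(1) by (intro le_imp_power_dvd) simp
  then show ?thesis
    by (simp add: pow_eq_id)
qed

text \<open>All primes in the descent are 3. If \<open>A^9\<close> and \<open>B^9\<close> lie in K',
  then modulo K they are central with trivial cube, which is the situation of
  \<open>A_pow_9_if_central\<close> in the quotient.\<close>

lemma pow_9:
  assumes "ord A = 3 ^ i" "ord B = 3 ^ j"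
  shows "A [^] (9::nat) = \<one> \<and> B [^] (9::nat) = \<one>"
proof -
  have "A [^] (9::nat) \<in> {\<one>} \<and> B [^] (9::nat) \<in> {\<one>}"
    using one_is_normal
  proof (induction rule: central_induct)
    case (step K K' p)
    have "p dvd 3 ^ (i + j)"
      using step(4) assms by (simp add: power_add)
    then have "p dvd 3"
      using step(3) prime_dvd_power by blast
    then have p: "p = 3"
      using step(3) by (simp add: primes_dvd_imp_eq)
    obtain Q :: "'a set monoid" and \<pi> where \<pi>: "group_hom G Q \<pi>"
      and Q: "macdonald_group Q (\<pi> A) (\<pi> B) (\<pi> C) \<alpha> \<beta>" and carrier: "carrier Q = \<pi> ` carrier G"
      and one: "\<forall>x\<in>carrier G. \<pi> x = \<one>\<^bsub>Q\<^esub> \<longleftrightarrow> x \<in> K"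
      and comm: "\<forall>x\<in>carrier G. \<forall>g\<in>carrier G.
         inv (g \<otimes> x) \<otimes> (x \<otimes> g) \<in> K \<longleftrightarrow> \<pi> x \<otimes>\<^bsub>Q\<^esub> \<pi> g = \<pi> g \<otimes>\<^bsub>Q\<^esub> \<pi> x"
      by (rule obtain_quotient[OF step(1)])
    interpret \<pi>: group_hom G Q \<pi> by (rule \<pi>)
    interpret Q: macdonald_group_3 Q "\<pi> A" "\<pi> B" "\<pi> C" \<alpha> \<beta>
      using Q residues by (auto simp: macdonald_group_3_def macdonald_group_3_axioms_def)
    have central: "\<pi> x [^]\<^bsub>Q\<^esub> (9::nat) \<otimes>\<^bsub>Q\<^esub> g = g \<otimes>\<^bsub>Q\<^esub> \<pi> x [^]\<^bsub>Q\<^esub> (9::nat)"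
      if x: "x \<in> carrier G" "x [^] (9::nat) \<in> K'" and g: "g \<in> carrier Q" for x g
    proof -
      obtain y where y: "y \<in> carrier G" "g = \<pi> y"
        using g carrier by blast
      have "\<pi> (x [^] (9::nat)) \<otimes>\<^bsub>Q\<^esub> g = g \<otimes>\<^bsub>Q\<^esub> \<pi> (x [^] (9::nat))"
        using comm step(6)[OF x(2) y(1)] x(1) y by blast
      then show ?thesis
        using x by (simp add: \<pi>.hom_nat_pow)
    qed
    have exponent: "\<pi> x [^]\<^bsub>Q\<^esub> (27::nat) = \<one>\<^bsub>Q\<^esub>" if x: "x \<in> carrier G" "x [^] (9::nat) \<in> K'" for x
    proof -
      have "x [^] (27::nat) \<in> K"
        using step(5)[OF x(2)] x(1) by (simp add: p nat_pow_pow)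
      then have "\<pi> (x [^] (27::nat)) = \<one>\<^bsub>Q\<^esub>"
        using one x(1) by blast
      then show ?thesis
        using x by (simp add: \<pi>.hom_nat_pow)
    qed
    have "\<pi> A [^]\<^bsub>Q\<^esub> (9::nat) = \<one>\<^bsub>Q\<^esub>"
      using step(7) by (intro Q.A_pow_9_if_central exponent central) auto
    moreover have "\<pi> B [^]\<^bsub>Q\<^esub> (9::nat) = \<one>\<^bsub>Q\<^esub>"
      using step(7)
      by (intro macdonald_group_3.A_pow_9_if_central[OF Q.swap_3] exponent central) auto
    ultimately show ?case
      using one by (metis A_closed B_closed \<pi>.hom_nat_pow nat_pow_closed)
  qed auto
  then show ?thesis
    by simp
qed

end

section \<open>Central series expressed by commutators\<close>

context group
begin

lemma commute_generate_singleton: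
  assumes "x \<in> generate G {y}" "y \<in> carrier G"
  shows "x \<otimes> y = y \<otimes> x"
  using assms(1) by (rule commute_generate[rotated 3]) (use assms(2) in auto)

lemma commutator_eq:
  assumes "x \<in> carrier G" "g \<in> carrier G"
  shows "commutator G x g = inv (g \<otimes> x) \<otimes> (x \<otimes> g)"
  using assms by (simp add: commutator_def inv_mult_group m_assoc)

lemma commutator_closed: "x \<in> carrier G \<Longrightarrow> g \<in> carrier G \<Longrightarrow> commutator G x g \<in> carrier G"
  by (simp add: commutator_def)

text \<open>For normal K this is the preimage of the center of G/K, so iterating it from {1} gives
  the upper central series.\<close>

definition center_mod :: "'a set \<Rightarrow> 'a set" where
  "center_mod K = {x \<in> carrier G. \<forall>g\<in>carrier G. commutator G x g \<in> K}"

lemma center_mod_normal: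
  assumes "K \<lhd> G"
  shows "center_mod K \<lhd> G"
proof -
  interpret K: normal K G by fact
  have conj: "h \<otimes> k \<otimes> inv h \<in> K" "inv h \<otimes> k \<otimes> h \<in> K" if "h \<in> carrier G" "k \<in> K" for h k
    using K.inv_op_closed1 K.inv_op_closed2 that by auto
  have inv: "inv k \<in> K" if "k \<in> K" for k
    using that by simp
  show ?thesis
  proof (rule normal_invI)
    show "subgroup (center_mod K) G"
    proof (rule subgroupI)
      show "center_mod K \<noteq> {}"
        by (auto simp: center_mod_def commutator_def intro!: exI[of _ \<one>])
      show "inv x \<in> center_mod K" if "x \<in> center_mod K" for x
      proof -
        have x: "x \<in> carrier G" "\<And>g. g \<in> carrier G \<Longrightarrow> commutator G x g \<in> K"
          using that by (auto simp: center_mod_def)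
        have "commutator G (inv x) g = x \<otimes> inv (commutator G x g) \<otimes> inv x" if "g \<in> carrier G" for g
          using x(1) that by (simp add: commutator_def m_assoc inv_mult_group)
        then show ?thesis
          using x conj inv by (simp add: center_mod_def)
      qed
      show "x \<otimes> y \<in> center_mod K" if "x \<in> center_mod K" "y \<in> center_mod K" for x y
      proof -
        have xy: "x \<in> carrier G" "\<And>g. g \<in> carrier G \<Longrightarrow> commutator G x g \<in> K"
          "y \<in> carrier G" "\<And>g. g \<in> carrier G \<Longrightarrow> commutator G y g \<in> K"
          using that by (auto simp: center_mod_def)
        have "commutator G (x \<otimes> y) g = (inv y \<otimes> commutator G x g \<otimes> y) \<otimes> commutator G y g"
          if "g \<in> carrier G" for g
          using xy(1,3) that by (simp add: commutator_def m_assoc inv_mult_group)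
        then show ?thesis
          using xy conj by (simp add: center_mod_def)
      qed
    qed (auto simp: center_mod_def)
    fix h x assume h: "h \<in> carrier G" and "x \<in> center_mod K"
    then have x: "x \<in> carrier G" "\<And>g. g \<in> carrier G \<Longrightarrow> commutator G x g \<in> K"
      by (auto simp: center_mod_def)
    have "commutator G (h \<otimes> x \<otimes> inv h) g = h \<otimes> commutator G x (inv h \<otimes> g \<otimes> h) \<otimes> inv h"
      if "g \<in> carrier G" for g
      using x(1) h that by (simp add: commutator_def m_assoc inv_mult_group)
    then show "h \<otimes> x \<otimes> inv h \<in> center_mod K"
      using x h conj by (simp add: center_mod_def)
  qed
qed

lemma lower_central_subset_center_mod:
  assumes "lower_central G n \<subseteq> center_mod K" "subgroup K G"
  shows "lower_central G (Suc n) \<subseteq> K"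
proof -
  have "{commutator G x y | x y. x \<in> lower_central G n \<and> y \<in> carrier G} \<subseteq> K"
    using assms(1) by (auto simp: center_mod_def)
  then show ?thesis
    using generate_subgroup_incl[OF _ assms(2)] by simp
qed

lemma lower_central_one: "\<one> \<in> lower_central G n"
  by (cases n) (auto intro: generate.one)

lemma lower_central_trivial_Suc:
  assumes "lower_central G n = {\<one>}"
  shows "lower_central G (Suc n) = {\<one>}"
proof -
  have one: "commutator G \<one> y = \<one>" if "y \<in> carrier G" for y
    using that by (simp add: commutator_def)
  have "{commutator G x y | x y. x \<in> lower_central G n \<and> y \<in> carrier G}
      = (\<lambda>y. commutator G \<one> y) ` carrier G"
    unfolding assms by blast
  also have "\<dots> = (\<lambda>y. \<one>) ` carrier G"
    using one by (intro image_cong) auto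
  also have "\<dots> = {\<one>}"
    using one_closed by blast
  finally have "{commutator G x y | x y. x \<in> lower_central G n \<and> y \<in> carrier G} = {\<one>}" .
  then show ?thesis
    by (simp add: generate_one)
qed

end

section \<open>Generators with trivial ninth power: normal forms and class\<close>

lemma (in group) ord_eq_9:
  assumes "x \<in> carrier G" "x [^] (9::nat) = \<one>" "x [^] (3::nat) \<noteq> \<one>"
  shows "ord x = 9"
proof -
  have "ord x dvd 3 ^ 2" "prime (3::nat)"
    using assms by (simp_all add: pow_eq_id)
  then obtain i where i: "i \<le> 2" "ord x = 3 ^ i"
    using divides_primepow_nat by blast
  have "\<not> ord x dvd 3"
    using assms by (simp add: pow_eq_id)
  then have "\<not> i \<le> 1"
    unfolding i(2) using le_imp_power_dvd[of i 1 "3::nat"] by auto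
  then have "i = 2"
    using i(1) by simp
  then show ?thesis
    by (simp add: i(2))
qed

locale macdonald_group_9 = macdonald_group_3 +
  assumes A9: "A [^] (9::nat) = \<one>" and B9: "B [^] (9::nat) = \<one>"
begin

lemma swap_9: "macdonald_group_9 G B A (inv C) \<beta> \<alpha>"
  using swap_3 A9 B9 by (simp add: macdonald_group_9_def macdonald_group_9_axioms_def)

lemma C9: "C [^] (9::nat) = \<one>"
proof (rule C_pow_9)
  have "(A [^] (9::nat)) [^] (3::nat) = \<one>"
    by (simp add: A9)
  then show "A [^] (27::nat) = \<one>"
    by (simp add: nat_pow_pow)
qed (simp add: A9)

text \<open>With \<open>A^9 = 1\<close> the power of \<open>A\<close> disappears from
  \<open>C_diff_A_pow_9_in_B\<close>, and \<open>C^3\<close> is a power of what is left.\<close>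

lemma C_pow_3_in_B: "C [^] (3::nat) \<in> generate G {B}"
proof -
  obtain c :: nat where c: "C [^] (3::nat) = (C [^] (int \<alpha> - int \<beta>)) [^] c"
    using C_pow_3_eq_diff_pow[OF C9] by blast
  have "C [^] (int \<alpha> - int \<beta>) \<in> generate G {B}"
    using C_diff_A_pow_9_in_B by (auto simp: A9)
  then show ?thesis
    unfolding c by (rule subgroup_nat_pow_closed[OF subgroup_B])
qed

lemma C_pow_3_in_A: "C [^] (3::nat) \<in> generate G {A}"
proof -
  have "inv (C [^] (3::nat)) \<in> generate G {A}"
    using macdonald_group_9.C_pow_3_in_B[OF swap_9] by (simp add: nat_pow_inv)
  then have "inv (inv (C [^] (3::nat))) \<in> generate G {A}"
    using generate_m_inv_closed[of "{A}"] by blast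
  then show ?thesis
    by simp
qed

lemma A_pow_mod_9: "[i = j] (mod 9) \<Longrightarrow> A [^] (i::nat) = A [^] (j::nat)"
  using A9 pow_cong_ord[of A i j] cong_dvd_modulus_nat[of i j 9] by (simp add: pow_eq_id)

lemma A_pow_3_B: "A [^] (3::nat) \<otimes> B = B \<otimes> (C [^] (3::nat) \<otimes> A [^] (3::nat))"
  using A_pow_B[of 3] A_pow_mod_9[OF geo_3_cong[OF residues'(1)]] by simp

text \<open>\<open>C\<^sup>3\<close> lies in \<open>\<langle>A\<rangle> \<inter> \<langle>B\<rangle>\<close>, hence is central and of the form \<open>A\<^sup>3\<^sup>t\<close>; comparing with
  the action of \<open>B\<close> on \<open>A\<^sup>3\<close> gives \<open>C\<^sup>3\<^sup>t = 1\<close>.\<close>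
lemma C3: "C [^] (3::nat) = \<one>"
proof (cases "A [^] (3::nat) = \<one>")
  case True
  then have "B \<otimes> \<one> = B \<otimes> C [^] (3::nat)"
    using A_pow_3_B by simp
  then show ?thesis
    by (simp del: r_one)
next
  case False
  define w where "w = C [^] (3::nat)"
  have wc: "w \<in> carrier G"
    by (simp add: w_def)
  have wA: "w \<otimes> A = A \<otimes> w" and wB: "w \<otimes> B = B \<otimes> w"
    unfolding w_def using C_pow_3_in_A C_pow_3_in_B by (auto intro!: commute_generate_singleton)
  have ordA: "ord A = 9"
    using A9 False by (rule ord_eq_9[OF A_closed])
  obtain n :: nat where n: "w = A [^] n"
    using C_pow_3_in_A unfolding w_def
      macdonald_group.generate_B[OF swap] by blast
  \<comment> \<open>Being a power of \<open>C\<close>, w is fixed by conjugation with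
    \<open>C\<close>; being \<open>A^n\<close>, it is raised to the power \<alpha>. So 9 divides n *
    (\<alpha> - 1), where 3 divides the second factor only once.\<close>
  have "A [^] n \<otimes> C = C \<otimes> A [^] n"
    unfolding n[symmetric] w_def by (simp flip: nat_pow_Suc nat_pow_Suc2)
  then have "C \<otimes> A [^] (n * \<alpha>) = C \<otimes> A [^] n"
    using A_pow_C_pow[of n 1] by simp
  then have "[n * \<alpha> = n] (mod 9)"
    using cong_ord_pow[of A "n * \<alpha>" n] ordA by simp
  then have "(n * (\<alpha> mod 9)) mod 9 = n mod 9"
    by (simp add: cong_def mod_mult_right_eq)
  then have "n * 4 mod 9 = n mod 9 \<or> n * 7 mod 9 = n mod 9"
    using residues by auto
  then have "9 dvd 3 * n \<or> 9 dvd 6 * n"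
    by (elim disjE) (simp_all add: mod_eq_dvd_iff_nat)
  then have "3 dvd n"
    by presburger
  then obtain t where t: "n = 3 * t"
    by blast
  have "A [^] (3::nat) \<otimes> w = w \<otimes> A [^] (3::nat)"
    using wA wc by (intro commute_pow) auto
  then have "(A [^] (3::nat)) [^] t \<otimes> B = B \<otimes> (w [^] t \<otimes> (A [^] (3::nat)) [^] t)"
    using conj_pow[of "A [^] (3::nat)" B "w \<otimes> A [^] (3::nat)" t] A_pow_3_B wc
    by (simp add: pow_mult_distrib w_def)
  then have "w \<otimes> B = B \<otimes> (w [^] t \<otimes> w)"
    by (simp add: n t nat_pow_pow)
  then have "w [^] t \<otimes> w = \<one> \<otimes> w"
    using wB wc by simp
  then have wt: "w [^] t = \<one>"
    using wc by (simp del: l_one)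
  have w3: "w [^] (3::nat) = \<one>"
    by (simp add: w_def nat_pow_pow C9)
  have "w = \<one>"
  proof (cases "3 dvd t")
    case True
    then obtain s where "n = 9 * s"
      using t by auto
    then have "w = (A [^] (9::nat)) [^] s"
      by (simp add: n nat_pow_pow)
    then show ?thesis
      by (simp add: A9)
  next
    case False
    then have "coprime t 3"
      using prime_imp_coprime[of 3 t] by (simp add: ac_simps)
    then show ?thesis
      using coprime_pow_eq_one[OF wc wt w3] by simp
  qed
  then show ?thesis
    by (simp add: w_def)
qed

lemma A3_central: "g \<in> carrier G \<Longrightarrow> A [^] (3::nat) \<otimes> g = g \<otimes> A [^] (3::nat)"
proof (rule central_if_commutes)
  show "A [^] (3::nat) \<otimes> A = A \<otimes> A [^] (3::nat)"
    by (rule commute_pow) auto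
  show "A [^] (3::nat) \<otimes> B = B \<otimes> A [^] (3::nat)"
    using A_pow_3_B by (simp add: C3)
qed auto

lemma \<alpha>_decomp: "\<exists>t. \<alpha> = 3 * t + 1 \<and> \<not> 3 dvd t"
proof -
  have "\<alpha> = 3 * (\<alpha> div 3) + 1 \<and> \<not> 3 dvd \<alpha> div 3"
    using residues by presburger
  then show ?thesis
    by blast
qed

lemma \<alpha>_power: "\<exists>t. \<alpha> ^ k = 3 * t + 1"
proof -
  obtain s where "\<alpha> = 3 * s + 1"
    using \<alpha>_decomp by blast
  then have "\<alpha> mod 3 = 1"
    by simp
  then have "\<alpha> ^ k mod 3 = 1"
    using power_mod[of \<alpha> 3 k] by simp
  then show ?thesis
    by (metis mult_div_mod_eq)
qed

lemma inv_C_pow: "inv (C [^] (k::nat)) = C [^] (2 * k)"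
proof (rule inv_equality)
  have "C [^] (2 * k) \<otimes> C [^] k = (C [^] (3::nat)) [^] k"
    by (simp add: nat_pow_mult nat_pow_pow)
  then show "C [^] (2 * k) \<otimes> C [^] k = \<one>"
    by (simp add: C3)
qed auto

text \<open>Moving \<open>C\<close> to the right past \<open>A\<close> needs the inverse of \<alpha>
  modulo 9, which is \<alpha>^2 because \<alpha>^3 is 1.\<close>

lemma C_pow_A: "C [^] (k::nat) \<otimes> A = A [^] (\<alpha> ^ (2 * k)) \<otimes> C [^] k"
proof -
  have "[(\<alpha> ^ 3) ^ k = 1 ^ k] (mod 9)"
    by (intro cong_pow cube_cong residues')
  then have "A [^] (\<alpha> ^ (2 * k) * \<alpha> ^ k) = A [^] (1::nat)"
    by (intro A_pow_mod_9) (simp flip: power_mult power_add)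
  then show ?thesis
    by (simp add: A_pow_C_pow)
qed

text \<open>The exponents are left unbounded so that closure under multiplication needs no
  reduction; \<open>carrier_eq_image\<close> bounds them afterwards.\<close>

definition normal_forms :: "'a set" where
  "normal_forms = {A [^] i \<otimes> (B [^] j \<otimes> C [^] k) | (i::nat) (j::nat) (k::nat). True}"

lemma normal_formsI: "A [^] (i::nat) \<otimes> (B [^] (j::nat) \<otimes> C [^] (k::nat)) \<in> normal_forms"
  by (auto simp: normal_forms_def)

lemma normal_forms_closed: "normal_forms \<subseteq> carrier G"
  by (auto simp: normal_forms_def)

lemma normal_forms_mult_B:
  assumes "x \<in> normal_forms"
  shows "x \<otimes> B \<in> normal_forms"
proof -
  obtain i j k :: nat where x: "x = A [^] i \<otimes> (B [^] j \<otimes> C [^] k)"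
    using assms by (auto simp: normal_forms_def)
  have "x \<otimes> B = A [^] i \<otimes> (B [^] j \<otimes> (C [^] k \<otimes> B [^] (1::nat)))"
    by (simp add: x m_assoc)
  also have "\<dots> = A [^] i \<otimes> (B [^] (j + \<beta> ^ k) \<otimes> C [^] k)"
    unfolding C_pow_B_pow by (simp flip: m_assoc nat_pow_mult)
  finally show ?thesis
    using normal_formsI by simp
qed

text \<open>\<open>A\<close> has to travel left. Passing \<open>C^k\<close> creates only an extra
  central power of \<open>A^3\<close>; passing \<open>B^j\<close> creates \<open>C^(-j)\<close>,
  which is \<open>C^(2j)\<close> and moves right past the power of \<open>B\<close>.\<close>

lemma normal_forms_mult_A:
  assumes "x \<in> normal_forms"
  shows "x \<otimes> A \<in> normal_forms"
proof -
  obtain i j k :: nat where x: "x = A [^] i \<otimes> (B [^] j \<otimes> C [^] k)"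
    using assms by (auto simp: normal_forms_def)
  obtain t where t: "\<alpha> ^ (2 * k) = 3 * t + 1"
    using \<alpha>_power by blast
  have central: "A [^] (3 * t) \<otimes> y = y \<otimes> A [^] (3 * t)" if "y \<in> carrier G" for y
    using commute_pow[OF _ that A3_central[OF that], of t] by (simp add: nat_pow_pow)
  define g where "g = \<beta> * geo \<beta> j * \<beta> ^ (2 * j)"
  have "x \<otimes> A = A [^] i \<otimes> (B [^] j \<otimes> (C [^] k \<otimes> A))"
    by (simp add: x m_assoc)
  also have "C [^] k \<otimes> A = A [^] (3 * t) \<otimes> (A \<otimes> C [^] k)"
    unfolding C_pow_A t by (simp add: m_assoc flip: nat_pow_mult)
  also have "B [^] j \<otimes> (A [^] (3 * t) \<otimes> (A \<otimes> C [^] k)) = A [^] (3 * t) \<otimes> ((B [^] j \<otimes> A) \<otimes> C [^] k)"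
    using central[of "B [^] j"] by (metis A_closed B_closed C_closed m_assoc m_closed nat_pow_closed)
  also have "B [^] j \<otimes> A = A \<otimes> (B [^] g \<otimes> C [^] (2 * j))"
    unfolding B_pow_A inv_C_pow C_pow_B_pow g_def by simp
  also have "A [^] i \<otimes> (A [^] (3 * t) \<otimes> ((A \<otimes> (B [^] g \<otimes> C [^] (2 * j))) \<otimes> C [^] k))
     = (A [^] i \<otimes> A [^] (3 * t) \<otimes> A) \<otimes> (B [^] g \<otimes> (C [^] (2 * j) \<otimes> C [^] k))"
    by (simp add: m_assoc)
  also have "\<dots> = A [^] (i + 3 * t + 1) \<otimes> (B [^] g \<otimes> C [^] (2 * j + k))"
    by (simp add: nat_pow_mult)
  finally show ?thesis
    using normal_formsI by (simp only:)
qed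

lemma inv_A: "inv A = A [^] (8::nat)" and inv_B: "inv B = B [^] (8::nat)"
proof -
  have "A [^] (8::nat) \<otimes> A = A [^] (9::nat)" "B [^] (8::nat) \<otimes> B = B [^] (9::nat)"
    by (simp_all flip: nat_pow_Suc)
  then show "inv A = A [^] (8::nat)" "inv B = B [^] (8::nat)"
    using A9 B9 by (auto intro: inv_equality)
qed

text \<open>Inverses of the generators are their eighth powers, so closure under right
  multiplication by \<open>A\<close> and \<open>B\<close> covers the whole generated group.\<close>

lemma carrier_normal_forms: "carrier G = normal_forms"
proof -
  have pow: "x \<otimes> y [^] (n::nat) \<in> normal_forms"
    if "\<And>x. x \<in> normal_forms \<Longrightarrow> x \<otimes> y \<in> normal_forms" "x \<in> normal_forms" "y \<in> carrier G" for x y n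
  proof (induction n)
    case (Suc n)
    have "x \<in> carrier G"
      using that(2) normal_forms_closed by blast
    then have "x \<otimes> y [^] Suc n = (x \<otimes> y [^] n) \<otimes> y"
      using that(3) by (simp add: m_assoc)
    then show ?case
      using that(1)[OF Suc] by simp
  qed (use that normal_forms_closed in auto)
  have "x \<otimes> g \<in> normal_forms" if "g \<in> generate G {A, B}" "x \<in> normal_forms" for x g
    using that
  proof (induction arbitrary: x rule: generate.induct)
    case one
    then have "x \<in> carrier G"
      using normal_forms_closed by blast
    then show ?case
      using one by simp
  next
    case (incl h)
    then show ?case
      using normal_forms_mult_A normal_forms_mult_B by auto
  next
    case (inv h)
    then show ?case
      using pow[OF normal_forms_mult_A] pow[OF normal_forms_mult_B] by (auto simp: inv_A inv_B)
  next
    case (eng h1 h2)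
    have "x \<in> carrier G" "h1 \<in> carrier G" "h2 \<in> carrier G"
      using eng normal_forms_closed gen by auto
    then have "x \<otimes> (h1 \<otimes> h2) = (x \<otimes> h1) \<otimes> h2"
      by (simp add: m_assoc)
    then show ?case
      using eng by simp
  qed
  moreover have "\<one> \<in> normal_forms"
    using normal_formsI[of 0 0 0] by simp
  ultimately have "carrier G \<subseteq> normal_forms"
    using gen by (metis l_one subsetI)
  then show ?thesis
    using normal_forms_closed by blast
qed

lemma carrier_eq_image:
  "carrier G = (\<lambda>(i, j, k). A [^] i \<otimes> (B [^] j \<otimes> C [^] k)) ` ({..<9::nat} \<times> {..<9::nat} \<times> {..<3::nat})"
  (is "_ = ?f ` ?D")
proof
  show "carrier G \<subseteq> ?f ` ?D"
  proof
    fix x assume "x \<in> carrier G"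
    then obtain i j k :: nat where x: "x = A [^] i \<otimes> (B [^] j \<otimes> C [^] k)"
      by (auto simp: carrier_normal_forms normal_forms_def)
    have mod: "y [^] n = y [^] (n mod m)" if "y \<in> carrier G" "y [^] m = \<one>" for y and n m :: nat
      using that by (intro pow_cong_ord) (auto simp: pow_eq_id cong_def mod_mod_cancel)
    have "x = ?f (i mod 9, j mod 9, k mod 3)"
      unfolding x using mod[OF A_closed A9, of i] mod[OF B_closed B9, of j] mod[OF C_closed C3, of k]
      by simp
    then show "x \<in> ?f ` ?D"
      by (rule image_eqI) simp
  qed
qed auto

text \<open>Only i and k are required to be separated, as this is all that a homomorphism sending
  \<open>B\<close> to a 3-cycle can provide; j is recovered by cancellation from the order of
  \<open>B\<close>. The count is 9 * 9 * 3.\<close>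

lemma card_carrier:
  assumes "ord B = 9"
    and "\<And>(i::nat) (j::nat) (k::nat) (i'::nat) (j'::nat) (k'::nat).
      A [^] i \<otimes> (B [^] j \<otimes> C [^] k) = A [^] i' \<otimes> (B [^] j' \<otimes> C [^] k') \<Longrightarrow>
      [i = i'] (mod 9) \<and> [k = k'] (mod 3)"
  shows "card (carrier G) = 243"
proof -
  have "inj_on (\<lambda>(i, j, k). A [^] i \<otimes> (B [^] j \<otimes> C [^] k)) ({..<9::nat} \<times> {..<9::nat} \<times> {..<3::nat})"
  proof (clarsimp simp: inj_on_def)
    fix i j k i' j' k' :: nat
    assume lt: "i < 9" "j < 9" "k < 3" "i' < 9" "j' < 9" "k' < 3"
      and eq: "A [^] i \<otimes> (B [^] j \<otimes> C [^] k) = A [^] i' \<otimes> (B [^] j' \<otimes> C [^] k')"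
    have ik: "i = i'" "k = k'"
      using assms(2)[OF eq] lt by (simp_all add: cong_def)
    then have "B [^] j = B [^] j'"
      using eq by simp
    then have "[j = j'] (mod 9)"
      using cong_ord_pow[of B j j'] assms(1) by simp
    then show "i = i' \<and> j = j' \<and> k = k'"
      using ik lt by (simp add: cong_def)
  qed
  then show ?thesis
    by (simp add: carrier_eq_image card_image card_cartesian_product)
qed

definition center :: "'a set" where "center = center_mod {\<one>}"
definition second_center :: "'a set" where "second_center = center_mod center"

lemma center_normal: "center \<lhd> G" and second_center_normal: "second_center \<lhd> G"
  unfolding center_def second_center_def by (intro center_mod_normal one_is_normal)+

lemma central_in_center:
  assumes "x \<in> carrier G" "\<And>g. g \<in> carrier G \<Longrightarrow> x \<otimes> g = g \<otimes> x"
  shows "x \<in> center"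
proof -
  have "commutator G x g = \<one>" if "g \<in> carrier G" for g
    using assms that by (simp only: commutator_eq) simp
  then show ?thesis
    using assms(1) by (simp add: center_def center_mod_def)
qed

text \<open>The relation gives [A,C] = A^(\<alpha> - 1). It is central as a power of
  \<open>A^3\<close>, and nontrivial when \<open>A\<close> has order 9, since 3 divides \<alpha> - 1
  only once.\<close>

lemma commutator_A_C: "\<alpha> = 3 * t + 1 \<Longrightarrow> commutator G A C = (A [^] (3::nat)) [^] t"
proof -
  assume t: "\<alpha> = 3 * t + 1"
  have "A \<otimes> C = C \<otimes> (A \<otimes> A [^] (3 * t))"
    unfolding AC t by (simp add: nat_pow_mult flip: nat_pow_Suc2)
  then show ?thesis
    by (simp add: commutator_def m_assoc nat_pow_pow)
qed

lemma commutator_A_C_in_center: "commutator G A C \<in> center"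
proof -
  obtain t where "\<alpha> = 3 * t + 1"
    using \<alpha>_decomp by blast
  moreover have "A [^] (3::nat) \<in> center"
    by (intro central_in_center A3_central) auto
  ultimately show ?thesis
    using subgroup_nat_pow_closed[OF normal_imp_subgroup[OF center_normal]] commutator_A_C by metis
qed

lemma commutator_B_inv_C_in_center: "commutator G B (inv C) \<in> center"
  using macdonald_group_9.commutator_A_C_in_center[OF swap_9]
  by (simp add: center_def macdonald_group_9.center_def[OF swap_9])

lemma C_in_second_center: "C \<in> second_center"
proof -
  obtain Q :: "'a set monoid" and \<pi> where \<pi>: "group_hom G Q \<pi>"
    and Q: "macdonald_group Q (\<pi> A) (\<pi> B) (\<pi> C) \<alpha> \<beta>" and carrier: "carrier Q = \<pi> ` carrier G"
    and one: "\<forall>x\<in>carrier G. \<pi> x = \<one>\<^bsub>Q\<^esub> \<longleftrightarrow> x \<in> center"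
    and comm: "\<forall>x\<in>carrier G. \<forall>g\<in>carrier G.
       inv (g \<otimes> x) \<otimes> (x \<otimes> g) \<in> center \<longleftrightarrow> \<pi> x \<otimes>\<^bsub>Q\<^esub> \<pi> g = \<pi> g \<otimes>\<^bsub>Q\<^esub> \<pi> x"
    by (rule obtain_quotient[OF center_normal])
  interpret \<pi>: group_hom G Q \<pi> by (rule \<pi>)
  interpret Q: macdonald_group Q "\<pi> A" "\<pi> B" "\<pi> C" \<alpha> \<beta> by (rule Q)
  have comm': "commutator G x g \<in> center \<longleftrightarrow> \<pi> x \<otimes>\<^bsub>Q\<^esub> \<pi> g = \<pi> g \<otimes>\<^bsub>Q\<^esub> \<pi> x"
    if "x \<in> carrier G" "g \<in> carrier G" for x g
    using comm that by (simp only: commutator_eq)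
  have "\<pi> A \<otimes>\<^bsub>Q\<^esub> \<pi> C = \<pi> C \<otimes>\<^bsub>Q\<^esub> \<pi> A"
    using comm'[of A C] commutator_A_C_in_center by simp
  moreover have "\<pi> (inv C) \<otimes>\<^bsub>Q\<^esub> \<pi> B = \<pi> B \<otimes>\<^bsub>Q\<^esub> \<pi> (inv C)"
    using comm'[of B "inv C"] commutator_B_inv_C_in_center by (simp del: \<pi>.hom_inv)
  then have "inv\<^bsub>Q\<^esub> (\<pi> (inv C)) \<otimes>\<^bsub>Q\<^esub> \<pi> B = \<pi> B \<otimes>\<^bsub>Q\<^esub> inv\<^bsub>Q\<^esub> (\<pi> (inv C))"
    by (intro \<pi>.H.commute_inv) (auto simp del: \<pi>.hom_inv)
  then have "\<pi> C \<otimes>\<^bsub>Q\<^esub> \<pi> B = \<pi> B \<otimes>\<^bsub>Q\<^esub> \<pi> C"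
    by simp
  ultimately have "\<pi> C \<otimes>\<^bsub>Q\<^esub> \<pi> g = \<pi> g \<otimes>\<^bsub>Q\<^esub> \<pi> C" if "g \<in> carrier G" for g
    using Q.central_if_commutes[of "\<pi> C" "\<pi> g"] that by simp
  then show ?thesis
    using comm' by (simp add: second_center_def center_mod_def)
qed

text \<open>Modulo the second center \<open>C\<close> is trivial, so the generators commute and the
  quotient is abelian. This bounds the class by 3.\<close>

lemma commutator_in_second_center:
  assumes "x \<in> carrier G" "g \<in> carrier G"
  shows "commutator G x g \<in> second_center"
proof -
  obtain Q :: "'a set monoid" and \<pi> where \<pi>: "group_hom G Q \<pi>"
    and Q: "macdonald_group Q (\<pi> A) (\<pi> B) (\<pi> C) \<alpha> \<beta>" and carrier: "carrier Q = \<pi> ` carrier G"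
    and one: "\<forall>x\<in>carrier G. \<pi> x = \<one>\<^bsub>Q\<^esub> \<longleftrightarrow> x \<in> second_center"
    and comm: "\<forall>x\<in>carrier G. \<forall>g\<in>carrier G.
       inv (g \<otimes> x) \<otimes> (x \<otimes> g) \<in> second_center \<longleftrightarrow> \<pi> x \<otimes>\<^bsub>Q\<^esub> \<pi> g = \<pi> g \<otimes>\<^bsub>Q\<^esub> \<pi> x"
    by (rule obtain_quotient[OF second_center_normal])
  interpret \<pi>: group_hom G Q \<pi> by (rule \<pi>)
  interpret Q: macdonald_group Q "\<pi> A" "\<pi> B" "\<pi> C" \<alpha> \<beta> by (rule Q)
  have "\<pi> C = \<one>\<^bsub>Q\<^esub>"
    using one C_in_second_center by simp
  then have AB': "\<pi> A \<otimes>\<^bsub>Q\<^esub> \<pi> B = \<pi> B \<otimes>\<^bsub>Q\<^esub> \<pi> A"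
    using Q.AB by simp
  have A: "\<pi> A \<otimes>\<^bsub>Q\<^esub> h = h \<otimes>\<^bsub>Q\<^esub> \<pi> A" and B: "\<pi> B \<otimes>\<^bsub>Q\<^esub> h = h \<otimes>\<^bsub>Q\<^esub> \<pi> B" if "h \<in> carrier Q" for h
    using Q.central_if_commutes[OF _ _ _ that] AB' by simp_all
  have "\<pi> x \<otimes>\<^bsub>Q\<^esub> \<pi> g = \<pi> g \<otimes>\<^bsub>Q\<^esub> \<pi> x"
    using assms A[of "\<pi> x"] B[of "\<pi> x"] by (intro Q.central_if_commutes[of "\<pi> x" "\<pi> g"]) auto
  then show ?thesis
    using comm assms by (simp only: commutator_eq)
qed

lemma lower_central_3: "lower_central G 3 = {\<one>}"
proof -
  have "lower_central G 0 \<subseteq> center_mod second_center"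
    using commutator_in_second_center by (auto simp: center_mod_def)
  then have "lower_central G (Suc 0) \<subseteq> center_mod center"
    using lower_central_subset_center_mod second_center_normal normal_imp_subgroup second_center_def by blast
  then have "lower_central G (Suc (Suc 0)) \<subseteq> center_mod {\<one>}"
    using lower_central_subset_center_mod center_normal normal_imp_subgroup center_def by blast
  then have "lower_central G (Suc (Suc (Suc 0))) \<subseteq> {\<one>}"
    using lower_central_subset_center_mod triv_subgroup by blast
  then show ?thesis
    using lower_central_one[of 3] unfolding numeral_3_eq_3 by blast
qed

lemma nilpotency_class_3:
  assumes "ord A = 9"
  shows "nilpotency_class G = 3"
  unfolding nilpotency_class_def
proof (rule Least_equality)
  show "lower_central G 3 = {\<one>}"
    by (rule lower_central_3)
  fix c assume c: "lower_central G c = {\<one>}"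
  show "3 \<le> c"
  proof (rule ccontr)
    assume "\<not> 3 \<le> c"
    then have "c \<le> 2"
      by simp
    \<comment> \<open>The series starts with G at index 0, so index 2 contains [[A,B],A], the
      inverse of [A,C] = A^(3t), and 9 does not divide 3t.\<close>
    then have "lower_central G 2 = {\<one>}"
      by (induction rule: dec_induct) (use c lower_central_trivial_Suc in \<open>auto simp del: lower_central.simps\<close>)
    moreover have "commutator G A B = C"
      by (simp add: commutator_eq AB inv_mult_group m_assoc)
    then have "C \<in> lower_central G (Suc 0)"
      by (auto intro!: generate.incl)
    then have "commutator G C A \<in> lower_central G (Suc (Suc 0))"
      unfolding lower_central.simps(2)[of G "Suc 0"] using A_closed by (intro generate.incl) blast
    ultimately have "commutator G C A = \<one>"
      by (simp add: numeral_2_eq_2 del: lower_central.simps)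
    moreover have "commutator G A C = inv (commutator G C A)"
      by (simp add: commutator_def inv_mult_group m_assoc)
    ultimately have comm: "commutator G A C = \<one>"
      by simp
    obtain t where t: "\<alpha> = 3 * t + 1" "\<not> 3 dvd t"
      using \<alpha>_decomp by blast
    have "A [^] (3 * t) = \<one>"
      using commutator_A_C[OF t(1)] comm by (simp add: nat_pow_pow)
    then have "9 dvd 3 * t"
      using assms by (simp add: pow_eq_id)
    then show False
      using t(2) by presburger
  qed
qed

end

subsection \<open>The Sylow 3-subgroup\<close>

context group
begin

text \<open>The exponents s and t are Chinese remainder idempotents for
  \<open>ord x = p ^ i * m\<close>. That both parts are powers of x lets them inherit conjugation
  relations of x.\<close>

lemma coprime_pow_split:
  assumes "x \<in> carrier G" "ord x > 0" "prime p"
  shows "\<exists>s t i m. x = x [^] (s::nat) \<otimes> x [^] (t::nat) \<and> (x [^] s) [^] (p ^ i :: nat) = \<one> \<and>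
    (x [^] t) [^] (m::nat) = \<one> \<and> coprime m p"
proof -
  define i where "i = multiplicity p (ord x)"
  obtain m where m: "ord x = p ^ i * m" "\<not> p dvd m"
    using multiplicity_decompose'[of "ord x" p] assms(2,3) unfolding i_def by (metis not_gr_zero not_prime_unit)
  have cop: "coprime p m"
    using assms(3) m(2) by (rule prime_imp_coprime)
  then have "coprime (p ^ i) m"
    by simp
  then obtain s where s: "[s = 1] (mod p ^ i)" "[s = 0] (mod m)"
    using binary_chinese_remainder_nat by blast
  obtain t where t: "[t = 0] (mod p ^ i)" "[t = 1] (mod m)"
    using binary_chinese_remainder_nat \<open>coprime (p ^ i) m\<close> by blast
  have "[s + t = 1 + 0] (mod p ^ i)" "[s + t = 0 + 1] (mod m)"
    by (rule cong_add[OF s(1) t(1)], rule cong_add[OF s(2) t(2)])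
  then have "[s + t = 1] (mod ord x)"
    unfolding m(1) using \<open>coprime (p ^ i) m\<close> by (intro coprime_cong_mult_nat) simp_all
  then have "x [^] (s + t) = x [^] (1::nat)"
    by (intro pow_cong_ord assms)
  then have "x = x [^] s \<otimes> x [^] t"
    using assms(1) by (simp add: nat_pow_mult)
  moreover have "(x [^] s) [^] (p ^ i) = \<one>" "(x [^] t) [^] m = \<one>"
    using s(2) t(1) assms(1) by (simp_all add: nat_pow_pow pow_eq_id m(1) cong_0_iff mult.commute)
  ultimately show ?thesis
    using cop by (metis coprime_commute)
qed

lemma commuting_mult:
  assumes "x \<in> carrier G" "y \<in> carrier G" "x' \<in> carrier G" "y' \<in> carrier G" "y \<otimes> x' = x' \<otimes> y"
  shows "(x \<otimes> y) \<otimes> (x' \<otimes> y') = (x \<otimes> x') \<otimes> (y \<otimes> y')"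
proof -
  have "(x \<otimes> y) \<otimes> (x' \<otimes> y') = x \<otimes> ((y \<otimes> x') \<otimes> y')"
    using assms(1-4) by (simp add: m_assoc)
  then show ?thesis
    unfolding assms(5) using assms(1-4) by (simp add: m_assoc)
qed

lemma commute_generate2:
  assumes "S \<subseteq> carrier G" "T \<subseteq> carrier G" "\<And>s t. s \<in> S \<Longrightarrow> t \<in> T \<Longrightarrow> s \<otimes> t = t \<otimes> s"
    and "x \<in> generate G S" "y \<in> generate G T"
  shows "x \<otimes> y = y \<otimes> x"
proof -
  have y: "y \<in> carrier G"
    using assms(2,5) generate_in_carrier by blast
  have "y \<otimes> s = s \<otimes> y" if "s \<in> S" for s
    by (rule commute_generate[OF assms(2) _ _ assms(5)]) (use assms(1,3) that in auto)
  then show ?thesis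
    using commute_generate[OF assms(1) y _ assms(4)] by metis
qed

lemma nat_pow_restrict: "x [^]\<^bsub>G\<lparr>carrier := H\<rparr>\<^esub> (n::nat) = x [^] n"
  by (simp add: nat_pow_def)

end

context macdonald_group
begin

text \<open>Commutators multiply across the commuting pairs, so \<open>C\<close> is c c'. As a power
  of \<open>A\<close>, a satisfies the relation with \<open>C\<close>; there c' commutes with a and
  cancels, leaving the same relation with c. Likewise for b.\<close>

lemma commuting_factor:
  assumes a: "a = A [^] (s::nat)" "a' = A [^] (s'::nat)" "A = a \<otimes> a'"
    and b: "b = B [^] (u::nat)" "b' = B [^] (u'::nat)" "B = b \<otimes> b'"
    and comm: "\<And>x y. x \<in> {a, b} \<Longrightarrow> y \<in> {a', b'} \<Longrightarrow> x \<otimes> y = y \<otimes> x"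
  shows "C = commutator G a b \<otimes> commutator G a' b'"
    and "macdonald_group (G\<lparr>carrier := generate G {a, b}\<rparr>) a b (commutator G a b) \<alpha> \<beta>"
proof -
  have cl: "a \<in> carrier G" "a' \<in> carrier G" "b \<in> carrier G" "b' \<in> carrier G"
    by (simp_all add: a(1,2) b(1,2))
  define c where "c = commutator G a b"
  define c' where "c' = commutator G a' b'"
  define H where "H = generate G {a, b}"
  define K where "K = generate G {a', b'}"
  have HK: "x \<otimes> y = y \<otimes> x" if "x \<in> H" "y \<in> K" for x y
    by (rule commute_generate2[OF _ _ comm that[unfolded H_def K_def]]) (use cl in auto)
  have sub: "subgroup H G" "subgroup K G"
    unfolding H_def K_def using cl by (auto intro!: generate_is_subgroup)
  interpret H: subgroup H G by (rule sub)
  interpret K: subgroup K G by (rule sub)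
  have in_H: "a \<in> H" "b \<in> H" and in_K: "a' \<in> K" "b' \<in> K"
    by (auto simp: H_def K_def intro: generate.incl)
  have c: "c \<in> H" "c' \<in> K"
    using in_H in_K by (simp_all add: c_def c'_def commutator_def)
  have cc: "c \<in> carrier G" "c' \<in> carrier G"
    using c by auto
  have mult: "(x \<otimes> y) \<otimes> (x' \<otimes> y') = (x \<otimes> x') \<otimes> (y \<otimes> y')" if "x \<in> H" "x' \<in> H" "y \<in> K" "y' \<in> K" for x x' y y'
    using that HK[of x' y] by (intro commuting_mult) auto
  have AB1: "A \<otimes> B = (a \<otimes> b) \<otimes> (a' \<otimes> b')"
    using in_H in_K by (subst a(3), subst b(3)) (rule mult)
  have BA1: "B \<otimes> A = (b \<otimes> a) \<otimes> (b' \<otimes> a')"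
    using in_H in_K by (subst a(3), subst b(3)) (rule mult)
  have "(B \<otimes> A) \<otimes> (c \<otimes> c') = ((b \<otimes> a) \<otimes> c) \<otimes> ((b' \<otimes> a') \<otimes> c')"
    unfolding BA1 using in_H in_K c by (intro mult) auto
  also have "(b \<otimes> a) \<otimes> c = a \<otimes> b"
    using cl by (simp add: c_def commutator_def m_assoc)
  also have "(b' \<otimes> a') \<otimes> c' = a' \<otimes> b'"
    using cl by (simp add: c'_def commutator_def m_assoc)
  finally have "(B \<otimes> A) \<otimes> (c \<otimes> c') = (B \<otimes> A) \<otimes> C"
    unfolding AB1[symmetric] AB by (simp add: m_assoc)
  then have C: "C = c \<otimes> c'"
    using cc by simp
  then show "C = commutator G a b \<otimes> commutator G a' b'"
    by (simp add: c_def c'_def)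
  have "a \<otimes> C = C \<otimes> a [^] \<alpha>"
    using A_pow_C_pow[of s 1] by (simp add: a(1) nat_pow_pow)
  then have "(a \<otimes> c) \<otimes> c' = c \<otimes> (c' \<otimes> a [^] \<alpha>)"
    using cc cl by (simp add: C m_assoc)
  also have "c' \<otimes> a [^] \<alpha> = a [^] \<alpha> \<otimes> c'"
    using HK[of "a [^] \<alpha>" c'] c in_H subgroup_nat_pow_closed[OF sub(1)] by simp
  finally have "(a \<otimes> c) \<otimes> c' = (c \<otimes> a [^] \<alpha>) \<otimes> c'"
    using cc cl by (simp add: m_assoc)
  then have ac: "a \<otimes> c = c \<otimes> a [^] \<alpha>"
    using cc cl by (simp del: m_assoc)
  have "C \<otimes> b = b [^] \<beta> \<otimes> C"
    using C_pow_B_pow[of 1 u] by (simp add: b(1) nat_pow_pow)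
  then have "c \<otimes> (c' \<otimes> b) = (b [^] \<beta> \<otimes> c) \<otimes> c'"
    using cc cl by (simp add: C m_assoc)
  also have "c' \<otimes> b = b \<otimes> c'"
    using HK[of b c'] c in_H by simp
  finally have "(c \<otimes> b) \<otimes> c' = (b [^] \<beta> \<otimes> c) \<otimes> c'"
    using cc cl by (simp add: m_assoc)
  then have cb: "c \<otimes> b = b [^] \<beta> \<otimes> c"
    using cc cl by (simp del: m_assoc)
  have "macdonald_group (G\<lparr>carrier := H\<rparr>) a b c \<alpha> \<beta>"
  proof (intro macdonald_group.intro macdonald_group_axioms.intro)
    show "group (G\<lparr>carrier := H\<rparr>)"
      using sub(1) by (rule subgroup_imp_group)
    show "finite (carrier (G\<lparr>carrier := H\<rparr>))"
      using finite_subset[OF H.subset finite_carrier] by simp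
    show "generate (G\<lparr>carrier := H\<rparr>) {a, b} = carrier (G\<lparr>carrier := H\<rparr>)"
      using generate_consistent[of "{a, b}" H] sub(1) in_H by (simp add: H_def)
    show "a \<otimes>\<^bsub>G\<lparr>carrier := H\<rparr>\<^esub> b = b \<otimes>\<^bsub>G\<lparr>carrier := H\<rparr>\<^esub> (a \<otimes>\<^bsub>G\<lparr>carrier := H\<rparr>\<^esub> c)"
      using cl by (simp add: c_def commutator_def m_assoc)
  qed (use in_H c ac cb in \<open>simp_all add: nat_pow_restrict\<close>)
  then show "macdonald_group (G\<lparr>carrier := generate G {a, b}\<rparr>) a b (commutator G a b) \<alpha> \<beta>"
    by (simp add: H_def c_def)
qed

lemma subgroup_exponent:
  assumes "macdonald_group (G\<lparr>carrier := H\<rparr>) a b c \<alpha> \<beta>" "subgroup H G" "a [^] (k::nat) = \<one>" "b [^] (l::nat) = \<one>" "x \<in> H"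
  shows "\<exists>e. x [^] ((k * l) ^ e) = \<one>"
proof -
  interpret H: macdonald_group "G\<lparr>carrier := H\<rparr>" a b c \<alpha> \<beta> by fact
  have xc: "x \<in> carrier G"
    using assms(2,5) by (rule subgroup.mem_carrier)
  obtain e where "x [^] ((group.ord (G\<lparr>carrier := H\<rparr>) a * group.ord (G\<lparr>carrier := H\<rparr>) b) ^ e) = \<one>"
    using H.exponent_power assms(5) by (auto simp: nat_pow_restrict)
  then have "ord x dvd (group.ord (G\<lparr>carrier := H\<rparr>) a * group.ord (G\<lparr>carrier := H\<rparr>) b) ^ e"
    using xc by (simp add: pow_eq_id)
  also have "group.ord (G\<lparr>carrier := H\<rparr>) a dvd k" "group.ord (G\<lparr>carrier := H\<rparr>) b dvd l"
    using H.pow_eq_id[OF H.A_closed, of k] H.pow_eq_id[OF H.B_closed, of l] assms(3,4)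
    by (simp_all add: nat_pow_restrict)
  then have "(group.ord (G\<lparr>carrier := H\<rparr>) a * group.ord (G\<lparr>carrier := H\<rparr>) b) ^ e dvd (k * l) ^ e"
    by (intro dvd_power_same mult_dvd_mono)
  finally show ?thesis
    using xc pow_eq_id by blast
qed

end

context macdonald_group_3
begin

text \<open>Splitting the two generators is enough: H and K commute elementwise, so the products of
  their elements form a subgroup, and it contains \<open>A\<close> and \<open>B\<close>. That H and
  K have only 3-elements and 3'-elements comes from \<open>exponent_power\<close> inside each
  factor.\<close>

lemma factor_3:
  obtains a a' b b' s s' u u' H K where
    "a = A [^] (s::nat)" "a' = A [^] (s'::nat)" "A = a \<otimes> a'"
    "b = B [^] (u::nat)" "b' = B [^] (u'::nat)" "B = b \<otimes> b'"
    "C = commutator G a b \<otimes> commutator G a' b'"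
    "H = generate G {a, b}" "K = generate G {a', b'}"
    "macdonald_group_9 (G\<lparr>carrier := H\<rparr>) a b (commutator G a b) \<alpha> \<beta>"
    "\<forall>x\<in>H. \<exists>e. x [^] (3 ^ e :: nat) = \<one>" "\<forall>y\<in>K. \<exists>m::nat. coprime m 3 \<and> y [^] m = \<one>"
    "\<forall>x\<in>H. \<forall>y\<in>K. x \<otimes> y = y \<otimes> x" "\<forall>g\<in>carrier G. \<exists>x\<in>H. \<exists>y\<in>K. g = x \<otimes> y"
proof -
  have three: "prime (3::nat)"
    by simp
  obtain s s' i m where A: "A = A [^] (s::nat) \<otimes> A [^] (s'::nat)" "(A [^] s) [^] (3 ^ i :: nat) = \<one>"
    "(A [^] s') [^] (m::nat) = \<one>" "coprime m 3"
    using coprime_pow_split[OF A_closed ord_pos(1) three] by blast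
  obtain u u' j n where B: "B = B [^] (u::nat) \<otimes> B [^] (u'::nat)" "(B [^] u) [^] (3 ^ j :: nat) = \<one>"
    "(B [^] u') [^] (n::nat) = \<one>" "coprime n 3"
    using coprime_pow_split[OF B_closed ord_pos(2) three] by blast
  define a a' b b' where ab: "a = A [^] s" "a' = A [^] s'" "b = B [^] u" "b' = B [^] u'"
  have cl: "a \<in> carrier G" "a' \<in> carrier G" "b \<in> carrier G" "b' \<in> carrier G"
    by (simp_all add: ab)
  have A': "A = a \<otimes> a'" and B': "B = b \<otimes> b'"
    using A(1) B(1) by (simp_all add: ab)
  have exp: "a [^] (3 ^ i :: nat) = \<one>" "a' [^] m = \<one>" "b [^] (3 ^ j :: nat) = \<one>" "b' [^] n = \<one>"
    using A B by (simp_all add: ab)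
  have comm: "x \<otimes> y = y \<otimes> x" if "x \<in> {a, b}" "y \<in> {a', b'}" for x y
  proof (rule coprime_order_commute)
    show "x \<in> carrier G" "y \<in> carrier G"
      using that cl by auto
    show "x [^] (3 ^ i * 3 ^ j :: nat) = \<one>"
      using that exp cl by (auto simp: pow_eq_id)
    show "y [^] (m * n) = \<one>"
      using that exp cl by (auto simp: pow_eq_id)
    show "coprime (3 ^ i * 3 ^ j) (m * n)"
      using A(4) B(4) by (simp add: ac_simps)
  qed
  define H where "H = generate G {a, b}"
  define K where "K = generate G {a', b'}"
  have sub: "subgroup H G" "subgroup K G"
    unfolding H_def K_def using cl by (auto intro!: generate_is_subgroup)
  have HK: "x \<otimes> y = y \<otimes> x" if "x \<in> H" "y \<in> K" for x y
    by (rule commute_generate2[OF _ _ comm that[unfolded H_def K_def]]) (use cl in auto)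
  note factor = commuting_factor[OF ab(1,2) A' ab(3,4) B' comm]
  have A'': "A = a' \<otimes> a" and B'': "B = b' \<otimes> b"
    using A' B' comm by auto
  have comm': "x \<otimes> y = y \<otimes> x" if "x \<in> {a', b'}" "y \<in> {a, b}" for x y
    using comm[OF that(2,1)] by simp
  have mK: "macdonald_group (G\<lparr>carrier := K\<rparr>) a' b' (commutator G a' b') \<alpha> \<beta>"
    unfolding K_def by (rule commuting_factor(2)[OF ab(2,1) A'' ab(4,3) B'' comm'])
  have mH: "macdonald_group (G\<lparr>carrier := H\<rparr>) a b (commutator G a b) \<alpha> \<beta>"
    unfolding H_def by (rule factor(2))
  interpret H: macdonald_group_3 "G\<lparr>carrier := H\<rparr>" a b "commutator G a b" \<alpha> \<beta>
    using mH residues by (auto simp: macdonald_group_3_def macdonald_group_3_axioms_def)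
  have "group.ord (G\<lparr>carrier := H\<rparr>) a dvd 3 ^ i" "group.ord (G\<lparr>carrier := H\<rparr>) b dvd 3 ^ j"
    using H.pow_eq_id[OF H.A_closed, of "3 ^ i"] H.pow_eq_id[OF H.B_closed, of "3 ^ j"] exp
    by (simp_all add: nat_pow_restrict)
  then obtain k l where "group.ord (G\<lparr>carrier := H\<rparr>) a = 3 ^ k" "group.ord (G\<lparr>carrier := H\<rparr>) b = 3 ^ l"
    using divides_primepow_nat[OF three] by blast
  then have m9: "macdonald_group_9 (G\<lparr>carrier := H\<rparr>) a b (commutator G a b) \<alpha> \<beta>"
    using H.pow_9 H.macdonald_group_3_axioms
    by (simp add: macdonald_group_9_def macdonald_group_9_axioms_def)
  have ex1: "\<exists>e. x [^] (3 ^ e :: nat) = \<one>" if "x \<in> H" for x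
    using subgroup_exponent[OF mH sub(1) exp(1,3) that] by (metis power_add power_mult)
  have ex2: "\<exists>m::nat. coprime m 3 \<and> y [^] m = \<one>" if "y \<in> K" for y
    using subgroup_exponent[OF mK sub(2) exp(2,4) that] A(4) B(4)
    by (metis coprime_mult_left_iff coprime_power_left_iff)
  have ex3: "\<exists>x\<in>H. \<exists>y\<in>K. g = x \<otimes> y" if "g \<in> carrier G" for g
  proof -
    interpret H': subgroup H G by (rule sub)
    interpret K': subgroup K G by (rule sub)
    have in_HK: "a \<in> H" "b \<in> H" "a' \<in> K" "b' \<in> K"
      by (auto simp: H_def K_def intro: generate.incl)
    have inv_prod: "inv (x \<otimes> y) = inv x \<otimes> inv y" if "x \<in> H" "y \<in> K" for x y
      using that HK[of "inv x" "inv y"] by (simp add: inv_mult_group)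
    have "g \<in> generate G {A, B}"
      using that gen by simp
    then show ?thesis
    proof (induction rule: generate.induct)
      case one
      then show ?case
        by (metis H'.one_closed K'.one_closed l_one one_closed)
    next
      case (incl h)
      then show ?case
        using A' B' in_HK by auto
    next
      case (inv h)
      then show ?case
        using A' B' in_HK inv_prod H'.m_inv_closed K'.m_inv_closed by (metis insertE singletonD)
    next
      case (eng h1 h2)
      then obtain x1 y1 x2 y2 where "h1 = x1 \<otimes> y1" "h2 = x2 \<otimes> y2" and xy: "x1 \<in> H" "x2 \<in> H" "y1 \<in> K" "y2 \<in> K"
        by blast
      then have "h1 \<otimes> h2 = (x1 \<otimes> x2) \<otimes> (y1 \<otimes> y2)"
        using HK[of x2 y1] by (simp add: commuting_mult)
      then show ?case
        using xy H'.m_closed K'.m_closed by blast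
    qed
  qed
  show ?thesis
  proof (rule that[OF ab(1,2) A' ab(3,4) B' factor(1) H_def K_def m9])
    show "\<forall>x\<in>H. \<exists>e. x [^] (3 ^ e :: nat) = \<one>"
      using ex1 by (rule ballI)
    show "\<forall>y\<in>K. \<exists>m::nat. coprime m 3 \<and> y [^] m = \<one>"
      using ex2 by (rule ballI)
    show "\<forall>x\<in>H. \<forall>y\<in>K. x \<otimes> y = y \<otimes> x"
      using HK by (intro ballI)
    show "\<forall>g\<in>carrier G. \<exists>x\<in>H. \<exists>y\<in>K. g = x \<otimes> y"
      using ex3 by (rule ballI)
  qed
qed

end

section \<open>Identifying the Sylow subgroup and its projection\<close>

context group
begin

text \<open>Raising to the power m removes k, and raising to the power p^e removes h. The surviving
  factor then has two coprime exponents.\<close>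

lemma prime_power_part_eq_one:
  assumes "h \<in> carrier G" "k \<in> carrier G" "h \<otimes> k = k \<otimes> h"
    and "h [^] (p ^ e :: nat) = \<one>" "k [^] (m::nat) = \<one>" "coprime m p"
    and "(h \<otimes> k) [^] (n::nat) = \<one>"
  shows "coprime n p \<Longrightarrow> h = \<one>" and "n = p ^ f \<Longrightarrow> k = \<one>"
proof -
  have prod: "(h \<otimes> k) [^] (n * l) = h [^] (n * l) \<otimes> k [^] (n * l)" for l
    using assms by (intro pow_mult_distrib) auto
  have one: "(h \<otimes> k) [^] (n * l) = \<one>" for l
    using assms by (simp flip: nat_pow_pow)
  have "k [^] (n * m) = \<one>" "h [^] (n * p ^ e) = \<one>"
    using assms by (simp_all add: pow_eq_id)
  then have "h [^] (n * m) = \<one>" "k [^] (n * p ^ e) = \<one>"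
    using prod[of m] one[of m] prod[of "p ^ e"] one[of "p ^ e"] assms(1,2) by auto
  then show "coprime n p \<Longrightarrow> h = \<one>" "n = p ^ f \<Longrightarrow> k = \<one>"
    using coprime_pow_eq_one[OF assms(1) _ assms(4), of "n * m"]
      coprime_pow_eq_one[OF assms(2) assms(5), of "p ^ f * p ^ e"] assms(6) by simp_all
qed

text \<open>The content is uniqueness: for another candidate z and h = z^-1 x, the product h y has
  order prime to p, so its p-part h is trivial.\<close>

lemma sylow_proj_eq:
  assumes "subgroup P G" "x \<in> P" "y \<in> carrier G" "\<forall>h\<in>P. h \<otimes> y = y \<otimes> h"
    and P: "\<forall>h\<in>P. \<exists>e. h [^] (p ^ e :: nat) = \<one>" and y: "y [^] (m::nat) = \<one>" "coprime m p"
  shows "sylow_proj G p P (x \<otimes> y) = x"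
  unfolding sylow_proj_def
proof (rule the_equality)
  interpret P: subgroup P G by fact
  have "coprime (ord y) p"
    using y assms(3) by (metis coprime_divisors dvd_refl pow_eq_id)
  then show "x \<in> P \<and> inv x \<otimes> (x \<otimes> y) \<in> p'_elements G p"
    using assms(2,3) by (simp add: p'_elements_def)
  fix z assume z: "z \<in> P \<and> inv z \<otimes> (x \<otimes> y) \<in> p'_elements G p"
  define h where "h = inv z \<otimes> x"
  have h: "h \<in> P" "h \<in> carrier G"
    using z assms(2) by (simp_all add: h_def)
  then obtain e where e: "h [^] (p ^ e :: nat) = \<one>"
    using P by blast
  have "inv z \<otimes> (x \<otimes> y) = h \<otimes> y"
    using z assms(2,3) by (simp add: h_def m_assoc)
  then have "(h \<otimes> y) [^] ord (h \<otimes> y) = \<one>" "coprime (ord (h \<otimes> y)) p"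
    using z h assms(3) by (simp_all add: p'_elements_def)
  then have "h = \<one>"
    using prime_power_part_eq_one(1)[OF h(2) assms(3) _ e y] assms(4) h(1) by blast
  then show "z = x"
    using z assms(2) by (metis P.mem_carrier h_def inv_closed inv_equality inv_inv)
qed

text \<open>A Sylow subgroup is contained in the factor \<open>H\<close> of \<open>p\<close>-elements, and Lagrange's theorem rules
  out a proper inclusion.\<close>
lemma sylow_subgroup_eq:
  assumes syl: "sylow_subgroup G p P" and "prime p" and H: "subgroup H G" "card H = p ^ l"
    and K: "K \<subseteq> carrier G" "\<forall>y\<in>K. \<exists>m::nat. coprime m p \<and> y [^] m = \<one>"
    and HK: "\<forall>x\<in>H. \<forall>y\<in>K. x \<otimes> y = y \<otimes> x" "\<forall>g\<in>carrier G. \<exists>x\<in>H. \<exists>y\<in>K. g = x \<otimes> y"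
  shows "P = H"
proof -
  obtain k where fin: "finite (carrier G)" and P: "subgroup P G" "card P = p ^ k"
    and ndvd: "\<not> p dvd card (carrier G) div card P"
    using syl by (auto simp: sylow_subgroup_def)
  have pow: "x [^] card S = \<one>" if "subgroup S G" "x \<in> S" for S x
  proof -
    interpret S: group "G\<lparr>carrier := S\<rparr>"
      using that(1) by (rule subgroup_imp_group)
    show ?thesis
      using S.pow_order_eq_1[of x] that(2) by (simp add: order_def nat_pow_restrict)
  qed
  have PH: "P \<subseteq> H"
  proof
    fix x assume x: "x \<in> P"
    then have "x \<in> carrier G"
      by (rule subgroup.mem_carrier[OF P(1)])
    then obtain h y where hy: "h \<in> H" "y \<in> K" "x = h \<otimes> y"
      using HK(2) by blast
    then obtain m where m: "y [^] (m::nat) = \<one>" "coprime m p"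
      using K(2) by blast
    have hyc: "h \<in> carrier G" "y \<in> carrier G" "h \<otimes> y = y \<otimes> h"
      using hy(1,2) subgroup.mem_carrier[OF H(1)] K(1) HK(1) by blast+
    have "h [^] (p ^ l) = \<one>" "(h \<otimes> y) [^] (p ^ k) = \<one>"
      using pow[OF H(1) hy(1)] pow[OF P(1) x] hy(3) H(2) P(2) by simp_all
    then have "y = \<one>"
      using prime_power_part_eq_one(2)[OF hyc _ m] by blast
    then show "x \<in> H"
      using hy hyc by simp
  qed
  have finH: "finite H"
    using finite_subset[OF subgroup.subset[OF H(1)] fin] .
  obtain q where q: "card (carrier G) = card H * q"
    using lagrange[OF H(1)] by (metis mult.commute order_def)
  interpret H: group "G\<lparr>carrier := H\<rparr>"
    using H(1) by (rule subgroup_imp_group)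
  have "subgroup P (G\<lparr>carrier := H\<rparr>)"
    using P(1) H(1) PH by (rule subgroup_incl)
  moreover have "order (G\<lparr>carrier := H\<rparr>) = card H"
    by (simp add: order_def)
  ultimately obtain r where r: "card H = card P * r"
    by (metis H.lagrange mult.commute)
  have "p ^ k > 0" "p > 1"
    using prime_gt_1_nat[OF assms(2)] by auto
  then have "\<not> p dvd r"
    using ndvd by (auto simp: q r P(2) mult.assoc)
  moreover have "r dvd p ^ l"
    using r H(2) by (metis dvd_triv_right)
  ultimately have "r = 1"
    using divides_primepow_nat[OF assms(2)] by (metis dvd_power power_0 neq0_conv)
  then show ?thesis
    using card_subset_eq[OF finH PH] r by simp
qed

end

subsection \<open>Homomorphisms from the presented group\<close>

primrec (in group) eval_letter :: "(gen \<Rightarrow> 'a) \<Rightarrow> gen \<times> bool \<Rightarrow> 'a" where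
  "eval_letter f (g, e) = (if e then inv (f g) else f g)"

primrec (in group) eval_word :: "(gen \<Rightarrow> 'a) \<Rightarrow> word \<Rightarrow> 'a" where
  "eval_word f [] = \<one>"
| "eval_word f (l # w) = eval_letter f l \<otimes> eval_word f w"

context group
begin

context
  fixes f :: "gen \<Rightarrow> 'a"
  assumes f [simp]: "f g \<in> carrier G"
begin

lemma eval_letter_closed [simp]: "eval_letter f l \<in> carrier G"
  by (cases l) auto

lemma eval_word_closed [simp]: "eval_word f w \<in> carrier G"
  by (induction w) auto

lemma eval_word_append: "eval_word f (u @ v) = eval_word f u \<otimes> eval_word f v"
  by (induction u) (auto simp: m_assoc)

lemma eval_inv_letter: "eval_letter f (inv_letter l) = inv (eval_letter f l)"
  by (cases l) auto

lemma eval_inv_word: "eval_word f (inv_word w) = inv (eval_word f w)"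
  by (induction w) (auto simp: inv_word_def eval_word_append eval_inv_letter inv_mult_group)

lemma eval_replicate: "eval_word f (concat (replicate n w)) = eval_word f w [^] n"
proof (induction n)
  case (Suc n)
  then show ?case
    using nat_pow_Suc2[of "eval_word f w" n] by (simp add: eval_word_append)
qed simp

lemma eval_pow_word: "eval_word f (pow_word w k) = eval_word f w [^] k"
proof (cases "0 \<le> k")
  case True
  then show ?thesis
    by (simp add: pow_word_def eval_replicate pow_nat)
next
  case False
  then have "eval_word f w [^] k = inv (eval_word f w [^] nat (- k))"
    by (subst int_pow_def2) simp
  then show ?thesis
    using False by (simp add: pow_word_def eval_replicate eval_inv_word int_pow_inv)
qed

lemma eval_pres_eq:
  assumes "pres_eq R u v" "\<And>r. r \<in> R \<Longrightarrow> eval_word f r = \<one>"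
  shows "eval_word f u = eval_word f v"
  using assms(1)
  by induction (auto simp: eval_word_append eval_inv_letter assms(2))

lemma eval_comm_word:
  "eval_word f (comm_word u v) = commutator G (eval_word f u) (eval_word f v)"
  by (simp add: comm_word_def eval_word_append eval_inv_word commutator_def m_assoc)

lemma eval_wA: "eval_word f wA = f GA" and eval_wB: "eval_word f wB = f GB"
  by (simp_all add: wA_def wB_def)

text \<open>Both directions serve: one admits a pair of elements as images of the generators, the
  other reads the relations off in the presented group. The right side has the inverse-free shape of
  the locale.\<close>

lemma eval_relators:
  fixes \<alpha> \<beta> :: int
  defines "c \<equiv> commutator G (f GA) (f GB)"
  shows "(\<forall>r\<in>relators_G \<alpha> \<beta>. eval_word f r = \<one>) \<longleftrightarrow>
    f GA \<otimes> c = c \<otimes> f GA [^] \<alpha> \<and> c \<otimes> f GB = f GB [^] \<beta> \<otimes> c"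
proof -
  have c: "c \<in> carrier G"
    by (simp add: c_def commutator_closed)
  have "commutator G (f GB) (f GA) = inv c"
    by (simp add: c_def commutator_def inv_mult_group m_assoc)
  then have "(\<forall>r\<in>relators_G \<alpha> \<beta>. eval_word f r = \<one>) \<longleftrightarrow>
     inv c \<otimes> (f GA \<otimes> c) \<otimes> inv (f GA [^] \<alpha>) = \<one> \<and> (c \<otimes> f GB) \<otimes> inv c \<otimes> inv (f GB [^] \<beta>) = \<one>"
    using c by (simp add: relators_G_def conj_word_def eval_word_append eval_inv_word eval_comm_word
        eval_pow_word eval_wA eval_wB c_def[symmetric] m_assoc)
  also have "inv c \<otimes> (f GA \<otimes> c) \<otimes> inv (f GA [^] \<alpha>) = \<one> \<longleftrightarrow> inv c \<otimes> (f GA \<otimes> c) = f GA [^] \<alpha>"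
    using c inv_solve_right'[of \<one> "inv c \<otimes> (f GA \<otimes> c)" "f GA [^] \<alpha>"] by auto
  also have "\<dots> \<longleftrightarrow> f GA \<otimes> c = c \<otimes> f GA [^] \<alpha>"
    using c inv_solve_left'[of "f GA [^] \<alpha>" c "f GA \<otimes> c"] by auto
  also have "(c \<otimes> f GB) \<otimes> inv c \<otimes> inv (f GB [^] \<beta>) = \<one> \<longleftrightarrow> (c \<otimes> f GB) \<otimes> inv c = f GB [^] \<beta>"
    using c inv_solve_right'[of \<one> "(c \<otimes> f GB) \<otimes> inv c" "f GB [^] \<beta>"] by auto
  also have "\<dots> \<longleftrightarrow> c \<otimes> f GB = f GB [^] \<beta> \<otimes> c"
    using c inv_solve_right'[of "f GB [^] \<beta>" "c \<otimes> f GB" c] by auto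
  finally show ?thesis .
qed

end

end

lemma pres_class_eq_iff: "pres_class R u = pres_class R v \<longleftrightarrow> pres_eq R u v"
  unfolding pres_class_def by (metis (mono_tags) Collect_cong mem_Collect_eq pres_eq.refl pres_eq.sym pres_eq.trans)

lemma some_pres_class: "pres_eq R w (SOME u. u \<in> pres_class R w)"
  using someI[of "\<lambda>u. u \<in> pres_class R w" w] by (simp add: pres_class_def pres_eq.refl)

lemma pres_eq_append: "pres_eq R u u' \<Longrightarrow> pres_eq R v v' \<Longrightarrow> pres_eq R (u @ v) (u' @ v')"
  using pres_eq.ctx[of R u u' "[]" v] pres_eq.ctx[of R v v' u' "[]"] pres_eq.trans by fastforce

lemma pres_mult_class: "pres_mult R (pres_class R u) (pres_class R v) = pres_class R (u @ v)"
  unfolding pres_mult_def pres_class_eq_iff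
  by (intro pres_eq_append pres_eq.sym[OF some_pres_class])

lemma pres_eq_inv_word: "pres_eq R (inv_word w @ w) []"
proof (induction w)
  case (Cons l w)
  have "pres_eq R [inv_letter l, l] []"
    using pres_eq.cancel[of R "inv_letter l"] by (cases l) simp
  then have "pres_eq R (inv_word w @ [inv_letter l, l] @ w) (inv_word w @ [] @ w)"
    by (rule pres_eq.ctx)
  then show ?case
    using Cons pres_eq.trans by (fastforce simp: inv_word_def)
qed (simp add: inv_word_def pres_eq.refl)

lemma group_presented_group: "group (presented_group R)"
proof (rule groupI)
  fix x assume "x \<in> carrier (presented_group R)"
  then obtain w where w: "x = pres_class R w"
    by (auto simp: presented_group_def)
  show "\<exists>y\<in>carrier (presented_group R). y \<otimes>\<^bsub>presented_group R\<^esub> x = \<one>\<^bsub>presented_group R\<^esub>"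
    by (rule bexI[of _ "pres_class R (inv_word w)"])
      (auto simp: presented_group_def pres_mult_class w pres_class_eq_iff pres_eq_inv_word)
qed (auto simp: presented_group_def pres_mult_class)

lemma presented_group_hom:
  assumes "group M" "\<And>g. f g \<in> carrier M" "\<And>r. r \<in> R \<Longrightarrow> group.eval_word M f r = \<one>\<^bsub>M\<^esub>"
  shows "\<exists>h. group_hom (presented_group R) M h \<and> (\<forall>w. h (pres_class R w) = group.eval_word M f w)"
proof -
  interpret M: group M by fact
  define h where "h S = M.eval_word f (SOME w. w \<in> S)" for S
  have h: "h (pres_class R w) = M.eval_word f w" for w
    unfolding h_def using M.eval_pres_eq[OF assms(2) some_pres_class assms(3)] by metis
  have "h \<in> hom (presented_group R) M"
    by (rule homI)
      (auto simp: presented_group_def pres_mult_class h M.eval_word_append[OF assms(2)] M.eval_word_closed[OF assms(2)])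
  then have "group_hom (presented_group R) M h"
    by (intro group_hom.intro group_hom_axioms.intro group_presented_group assms(1))
  then show ?thesis
    using h by blast
qed

text \<open>Evaluating at the classes of the generators is the class map itself, so facts about
  evaluation become facts about the presented group.\<close>

lemma eval_word_presented_group:
  "group.eval_word (presented_group R) (\<lambda>g. pres_class R [(g, False)]) w = pres_class R w"
proof -
  interpret G: group "presented_group R" by (rule group_presented_group)
  have mult: "pres_class R u \<otimes>\<^bsub>presented_group R\<^esub> pres_class R v = pres_class R (u @ v)" for u v
    by (simp add: presented_group_def pres_mult_class)
  have one: "\<one>\<^bsub>presented_group R\<^esub> = pres_class R []"
    by (simp add: presented_group_def)
  have closed: "pres_class R u \<in> carrier (presented_group R)" for u
    by (simp add: presented_group_def)
  have "inv\<^bsub>presented_group R\<^esub> (pres_class R [(g, False)]) = pres_class R [(g, True)]" for g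
  proof (rule G.inv_equality)
    show "pres_class R [(g, True)] \<otimes>\<^bsub>presented_group R\<^esub> pres_class R [(g, False)] = \<one>\<^bsub>presented_group R\<^esub>"
      using pres_eq.cancel[of R "(g, True)"] by (simp add: mult one pres_class_eq_iff)
  qed (auto simp: closed)
  then have "G.eval_letter (\<lambda>g. pres_class R [(g, False)]) l = pres_class R [l]" for l
    by (cases l) auto
  then show ?thesis
    by (induction w) (auto simp: one mult)
qed

subsection \<open>Two permutation representations\<close>

text \<open>With \<open>rot\<close>, \<open>tri\<close> for \<open>A\<close>, \<open>B\<close>, and also with \<open>tri\<^sup>2\<close>, \<open>rot\<close>, the commutator \<open>C\<close> is \<open>dbl\<close>.\<close>
definition rot :: "nat \<Rightarrow> nat" where
  "rot x = (if x = 0 \<or> x > 9 then x else if x = 9 then 1 else x + 1)"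

definition tri :: "nat \<Rightarrow> nat" where
  "tri x = (if x = 3 then 9 else if x = 9 then 6 else if x = 6 then 3 else x)"

text \<open>As cycles, \<open>tri\<close> is (3 9 6) and \<open>dbl\<close> is (2 5 8)(3 9 6). On
  each residue class modulo 3 they act as shifts by multiples of 3, while \<open>rot\<close>
  permutes the classes; all three lie in the wreath product of two cyclic groups of order 3.\<close>

definition dbl :: "nat \<Rightarrow> nat" where
  "dbl x = (if x = 2 then 5 else if x = 5 then 8 else if x = 8 then 2 else tri x)"

lemma interval_1_9: "{1..9} = {1, 2, 3, 4, 5, 6, 7, 8, 9::nat}"
  by auto

lemma perm_closed:
  "rot \<in> carrier (sym_group 9)" "tri \<in> carrier (sym_group 9)" "tri \<circ> tri \<in> carrier (sym_group 9)"
  "dbl \<in> carrier (sym_group 9)"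
proof -
  have rot: "rot permutes {1..9}"
    by (rule inj_imp_permutes) (auto simp: rot_def inj_on_def split: if_splits)
  have tri: "tri permutes {1..9}"
    by (rule inj_imp_permutes) (auto simp: tri_def inj_on_def)
  have dbl: "dbl permutes {1..9}"
    unfolding interval_1_9
    by (rule inj_imp_permutes) (auto simp: dbl_def tri_def inj_on_def)
  show "rot \<in> carrier (sym_group 9)" "tri \<in> carrier (sym_group 9)" "tri \<circ> tri \<in> carrier (sym_group 9)"
    "dbl \<in> carrier (sym_group 9)"
    using rot tri dbl permutes_compose[OF tri tri] by (simp_all add: sym_group_carrier)
qed

lemma sym_group_pow: "p [^]\<^bsub>sym_group n\<^esub> (k::nat) = p ^^ k"
  by (induction k) (simp_all add: sym_group_mult sym_group_one funpow_swap1 fun_eq_iff)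

lemma sym_group_9_ext:
  assumes "p \<in> carrier (sym_group 9)" "q \<in> carrier (sym_group 9)"
    "\<And>x. x \<in> {1, 2, 3, 4, 5, 6, 7, 8, 9} \<Longrightarrow> p x = q x"
  shows "p = q"
proof
  fix x
  show "p x = q x"
    using assms permutes_not_in[of p "{1..9}" x] permutes_not_in[of q "{1..9}" x] interval_1_9
    by (cases "x \<in> {1..9}") (auto simp: sym_group_carrier)
qed

lemma rot_pow: "y < 9 \<Longrightarrow> (rot ^^ i) (Suc y) = Suc ((y + i) mod 9)"
  by (induction i) (auto simp: rot_def mod_Suc)

lemma tri_pow: "x \<notin> {3, 6, 9} \<Longrightarrow> (tri ^^ i) x = x"
  by (induction i) (auto simp: tri_def)

lemma dbl_pow_1: "(dbl ^^ i) (Suc 0) = Suc 0"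
  by (induction i) (auto simp: dbl_def tri_def)

lemma dbl_pow_2: "(dbl ^^ i) 2 = 2 + 3 * (i mod 3)"
proof (induction i)
  case (Suc i)
  have "i mod 3 = 0 \<or> i mod 3 = 1 \<or> i mod 3 = 2"
    by linarith
  then show ?case
    using Suc by (auto simp: dbl_def tri_def mod_Suc)
qed simp

text \<open>The point 1 is fixed by \<open>tri\<close> and \<open>dbl\<close>, so its image reveals
  i modulo 9. The point 2 is moved by \<open>dbl\<close> within {2, 5, 8}, which \<open>tri\<close>
  fixes pointwise, so its image then reveals k modulo 3.\<close>

lemma perm_normal_form_inj:
  assumes "rot ^^ i \<circ> (tri ^^ j \<circ> dbl ^^ k) = rot ^^ i' \<circ> (tri ^^ j' \<circ> dbl ^^ k')"
  shows "[i = i'] (mod 9) \<and> [k = k'] (mod 3)"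
proof -
  have 1: "(rot ^^ i) ((tri ^^ j) ((dbl ^^ k) x)) = (rot ^^ i') ((tri ^^ j') ((dbl ^^ k') x))" for x
    using fun_cong[OF assms, of x] by simp
  have i: "i mod 9 = i' mod 9"
    using 1[of "Suc 0"] rot_pow[of 0 i] rot_pow[of 0 i'] by (simp add: dbl_pow_1 tri_pow)
  have "(tri ^^ j) ((dbl ^^ k) 2) = Suc (1 + 3 * (k mod 3))" for j k
  proof -
    have "k mod 3 = 0 \<or> k mod 3 = 1 \<or> k mod 3 = 2"
      by linarith
    then show ?thesis
      using tri_pow[of "Suc (Suc 0)" j] tri_pow[of 5 j] tri_pow[of 8 j] by (auto simp: dbl_pow_2)
  qed
  then have "Suc ((1 + 3 * (k mod 3) + i) mod 9) = Suc ((1 + 3 * (k' mod 3) + i') mod 9)"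
    using 1[of 2] by (simp add: rot_pow)
  then have "[1 + 3 * (k mod 3) + i = 1 + 3 * (k' mod 3) + i'] (mod 9)"
    by (simp add: cong_def)
  also have "[1 + 3 * (k' mod 3) + i' = 1 + 3 * (k' mod 3) + i] (mod 9)"
    using i by (intro cong_add) (auto simp: cong_def)
  finally have "[1 + 3 * (k mod 3) + i = 1 + 3 * (k' mod 3) + i] (mod 9)" .
  then have "[3 * (k mod 3) = 3 * (k' mod 3)] (mod 9)"
    by (simp only: cong_add_rcancel_nat cong_add_lcancel_nat)
  then have "k mod 3 = k' mod 3"
    by (simp add: cong_def)
  then show ?thesis
    using i by (simp add: cong_def)
qed

lemma (in group) int_pow_mod:
  assumes "x \<in> carrier G" "x [^] (n::nat) = \<one>" "n > 0"
  shows "x [^] (k::int) = x [^] nat (k mod int n)"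
proof -
  have "int (ord x) dvd int n"
    using assms by (simp add: pow_eq_id)
  then have "int (ord x) dvd k - k mod int n"
    by (meson dvd_minus_mod dvd_trans)
  then have "x [^] k = x [^] (k mod int n)"
    using assms(1) by (metis dvd_diff_commute int_pow_eq)
  then show ?thesis
    using assms(3) by (simp add: pow_nat)
qed

text \<open>The exponents 7 and 4 stand for \<alpha> and \<beta>; the trivial ninth powers make
  reduction modulo 9 legitimate.\<close>

lemma perm_relations:
  "rot \<circ> tri = tri \<circ> (rot \<circ> dbl)"
  "rot \<circ> dbl = dbl \<circ> rot ^^ 7"
  "dbl \<circ> tri = tri ^^ 4 \<circ> dbl"
  "(tri \<circ> tri) \<circ> rot = rot \<circ> ((tri \<circ> tri) \<circ> dbl)"
  "(tri \<circ> tri) \<circ> dbl = dbl \<circ> (tri \<circ> tri) ^^ 7"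
  "dbl \<circ> rot = rot ^^ 4 \<circ> dbl"
  "rot ^^ 9 = id" "tri ^^ 9 = id" "(tri \<circ> tri) ^^ 9 = id"
proof -
  interpret S: group "sym_group 9" by (rule sym_group_is_group)
  have comp: "p \<circ> q \<in> carrier (sym_group 9)"
    if "p \<in> carrier (sym_group 9)" "q \<in> carrier (sym_group 9)" for p q
    using S.m_closed[OF that] by (simp add: sym_group_mult)
  have pow: "p ^^ n \<in> carrier (sym_group 9)" if "p \<in> carrier (sym_group 9)" for p n
    using S.nat_pow_closed[OF that, of n] by (simp add: sym_group_pow)
  have id: "id \<in> carrier (sym_group 9)"
    using S.one_closed by (simp add: sym_group_one)
  have pows: "(p ^^ 4) x = p (p (p (p x)))" "(p ^^ 7) x = p (p (p (p (p (p (p x))))))"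
    "(p ^^ 9) x = p (p (p (p (p (p (p (p (p x))))))))" for p :: "nat \<Rightarrow> nat" and x
    by (simp_all add: numeral_eq_Suc)
  have vals:
    "rot (Suc 0) = 2" "rot 2 = 3" "rot 3 = 4" "rot 4 = 5" "rot 5 = 6" "rot 6 = 7" "rot 7 = 8" "rot 8 = 9"
    "rot 9 = Suc 0" "tri (Suc 0) = Suc 0" "tri 2 = 2" "tri 3 = 9" "tri 4 = 4" "tri 5 = 5" "tri 6 = 3"
    "tri 7 = 7" "tri 8 = 8" "tri 9 = 6" "dbl (Suc 0) = Suc 0" "dbl 2 = 5" "dbl 3 = 9" "dbl 4 = 4"
    "dbl 5 = 8" "dbl 6 = 3" "dbl 7 = 7" "dbl 8 = 2" "dbl 9 = 6"
    by (simp_all add: rot_def tri_def dbl_def)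
  note closed = comp pow id perm_closed
  show "rot \<circ> tri = tri \<circ> (rot \<circ> dbl)" "rot \<circ> dbl = dbl \<circ> rot ^^ 7"
    "dbl \<circ> tri = tri ^^ 4 \<circ> dbl" "(tri \<circ> tri) \<circ> rot = rot \<circ> ((tri \<circ> tri) \<circ> dbl)"
    "(tri \<circ> tri) \<circ> dbl = dbl \<circ> (tri \<circ> tri) ^^ 7" "dbl \<circ> rot = rot ^^ 4 \<circ> dbl"
    "rot ^^ 9 = id" "tri ^^ 9 = id" "(tri \<circ> tri) ^^ 9 = id"
    by (rule sym_group_9_ext, (intro closed)[1], (intro closed)[1],
      (elim insertE emptyE; simp add: pows vals))+
qed

section \<open>The presented group, its homomorphisms and the conclusion\<close>

lemma commutator_eqI:
  assumes "group G" "x \<in> carrier G" "y \<in> carrier G" "c \<in> carrier G"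
    "x \<otimes>\<^bsub>G\<^esub> y = y \<otimes>\<^bsub>G\<^esub> (x \<otimes>\<^bsub>G\<^esub> c)"
  shows "commutator G x y = c"
proof -
  interpret group G by fact
  show ?thesis
    using assms by (simp add: commutator_eq inv_mult_group m_assoc)
qed

lemma G_ab_hom:
  fixes \<alpha> \<beta> :: int
  assumes "group S" "x \<in> carrier S" "y \<in> carrier S" "c \<in> carrier S"
    and xy: "x \<otimes>\<^bsub>S\<^esub> y = y \<otimes>\<^bsub>S\<^esub> (x \<otimes>\<^bsub>S\<^esub> c)"
    and "x \<otimes>\<^bsub>S\<^esub> c = c \<otimes>\<^bsub>S\<^esub> x [^]\<^bsub>S\<^esub> \<alpha>" "c \<otimes>\<^bsub>S\<^esub> y = y [^]\<^bsub>S\<^esub> \<beta> \<otimes>\<^bsub>S\<^esub> c"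
  obtains h where "group_hom (G_ab \<alpha> \<beta>) S h" "h (elA \<alpha> \<beta>) = x" "h (elB \<alpha> \<beta>) = y" "h (elC \<alpha> \<beta>) = c"
proof -
  interpret S: group S by fact
  define f where "f g = (case g of GA \<Rightarrow> x | GB \<Rightarrow> y)" for g
  have f: "f g \<in> carrier S" for g
    using assms(2,3) by (cases g) (simp_all add: f_def)
  have fAB: "f GA = x" "f GB = y"
    by (simp_all add: f_def)
  have c: "commutator S x y = c"
    using assms(1-4) xy by (rule commutator_eqI)
  have "\<forall>r\<in>relators_G \<alpha> \<beta>. S.eval_word f r = \<one>\<^bsub>S\<^esub>"
    using S.eval_relators[OF f, of \<alpha> \<beta>] assms(6,7) by (simp add: fAB c)
  then obtain h where h: "group_hom (G_ab \<alpha> \<beta>) S h" "\<And>w. h (pres_class (relators_G \<alpha> \<beta>) w) = S.eval_word f w"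
    unfolding G_ab_def using presented_group_hom[OF assms(1), of f "relators_G \<alpha> \<beta>"] f by blast
  show ?thesis
    by (rule that[OF h(1)])
      (simp_all add: elA_def elB_def elC_def h(2) S.eval_wA[OF f] S.eval_wB[OF f] S.eval_comm_word[OF f] fAB c)
qed

lemma G_ab_relations:
  fixes \<alpha> \<beta> :: int
  shows "group (G_ab \<alpha> \<beta>)"
    "elA \<alpha> \<beta> \<in> carrier (G_ab \<alpha> \<beta>)" "elB \<alpha> \<beta> \<in> carrier (G_ab \<alpha> \<beta>)"
    "elC \<alpha> \<beta> = commutator (G_ab \<alpha> \<beta>) (elA \<alpha> \<beta>) (elB \<alpha> \<beta>)"
    "elA \<alpha> \<beta> \<otimes>\<^bsub>G_ab \<alpha> \<beta>\<^esub> elC \<alpha> \<beta> = elC \<alpha> \<beta> \<otimes>\<^bsub>G_ab \<alpha> \<beta>\<^esub> elA \<alpha> \<beta> [^]\<^bsub>G_ab \<alpha> \<beta>\<^esub> \<alpha>"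
    "elC \<alpha> \<beta> \<otimes>\<^bsub>G_ab \<alpha> \<beta>\<^esub> elB \<alpha> \<beta> = elB \<alpha> \<beta> [^]\<^bsub>G_ab \<alpha> \<beta>\<^esub> \<beta> \<otimes>\<^bsub>G_ab \<alpha> \<beta>\<^esub> elC \<alpha> \<beta>"
    "generate (G_ab \<alpha> \<beta>) {elA \<alpha> \<beta>, elB \<alpha> \<beta>} = carrier (G_ab \<alpha> \<beta>)"
proof -
  let ?R = "relators_G \<alpha> \<beta>"
  define f where "f g = pres_class ?R [(g, False)]" for g
  interpret G: group "G_ab \<alpha> \<beta>"
    unfolding G_ab_def by (rule group_presented_group)
  show "group (G_ab \<alpha> \<beta>)" ..
  have f: "f g \<in> carrier (G_ab \<alpha> \<beta>)" for g
    by (simp add: f_def G_ab_def presented_group_def)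
  have eval: "G.eval_word f w = pres_class ?R w" for w
    unfolding G_ab_def f_def by (rule eval_word_presented_group)
  have AB: "elA \<alpha> \<beta> = f GA" "elB \<alpha> \<beta> = f GB"
    by (simp_all add: elA_def elB_def f_def wA_def wB_def)
  show "elA \<alpha> \<beta> \<in> carrier (G_ab \<alpha> \<beta>)" "elB \<alpha> \<beta> \<in> carrier (G_ab \<alpha> \<beta>)"
    by (simp_all add: AB f)
  show C: "elC \<alpha> \<beta> = commutator (G_ab \<alpha> \<beta>) (elA \<alpha> \<beta>) (elB \<alpha> \<beta>)"
    unfolding elC_def eval[symmetric] G.eval_comm_word[OF f] G.eval_wA[OF f] G.eval_wB[OF f] AB ..
  have "G.eval_word f r = \<one>\<^bsub>G_ab \<alpha> \<beta>\<^esub>" if "r \<in> ?R" for r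
  proof -
    have "\<one>\<^bsub>G_ab \<alpha> \<beta>\<^esub> = pres_class ?R []"
      by (simp add: G_ab_def presented_group_def)
    then show ?thesis
      using pres_eq.rel[OF that] by (simp only: eval pres_class_eq_iff)
  qed
  then have "f GA \<otimes>\<^bsub>G_ab \<alpha> \<beta>\<^esub> elC \<alpha> \<beta> = elC \<alpha> \<beta> \<otimes>\<^bsub>G_ab \<alpha> \<beta>\<^esub> f GA [^]\<^bsub>G_ab \<alpha> \<beta>\<^esub> \<alpha> \<and>
    elC \<alpha> \<beta> \<otimes>\<^bsub>G_ab \<alpha> \<beta>\<^esub> f GB = f GB [^]\<^bsub>G_ab \<alpha> \<beta>\<^esub> \<beta> \<otimes>\<^bsub>G_ab \<alpha> \<beta>\<^esub> elC \<alpha> \<beta>"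
    unfolding C AB using G.eval_relators[where f = f, OF f, of \<alpha> \<beta>] by blast
  then show "elA \<alpha> \<beta> \<otimes>\<^bsub>G_ab \<alpha> \<beta>\<^esub> elC \<alpha> \<beta> = elC \<alpha> \<beta> \<otimes>\<^bsub>G_ab \<alpha> \<beta>\<^esub> elA \<alpha> \<beta> [^]\<^bsub>G_ab \<alpha> \<beta>\<^esub> \<alpha>"
    "elC \<alpha> \<beta> \<otimes>\<^bsub>G_ab \<alpha> \<beta>\<^esub> elB \<alpha> \<beta> = elB \<alpha> \<beta> [^]\<^bsub>G_ab \<alpha> \<beta>\<^esub> \<beta> \<otimes>\<^bsub>G_ab \<alpha> \<beta>\<^esub> elC \<alpha> \<beta>"
    by (simp_all add: AB)
  have sub: "subgroup (generate (G_ab \<alpha> \<beta>) {f GA, f GB}) (G_ab \<alpha> \<beta>)"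
    using f by (intro G.generate_is_subgroup) auto
  interpret H: subgroup "generate (G_ab \<alpha> \<beta>) {f GA, f GB}" "G_ab \<alpha> \<beta>" by (rule sub)
  have gen: "f g \<in> generate (G_ab \<alpha> \<beta>) {f GA, f GB}" for g
    by (cases g) (auto intro: generate.incl)
  have letter: "G.eval_letter f l \<in> generate (G_ab \<alpha> \<beta>) {f GA, f GB}" for l
    using gen by (cases l) auto
  have "G.eval_word f w \<in> generate (G_ab \<alpha> \<beta>) {f GA, f GB}" for w
    by (induction w) (use letter in auto)
  then have "range (pres_class ?R) \<subseteq> generate (G_ab \<alpha> \<beta>) {f GA, f GB}"
    unfolding eval by blast
  moreover have "carrier (G_ab \<alpha> \<beta>) = range (pres_class ?R)"
    by (simp add: G_ab_def presented_group_def)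
  ultimately show "generate (G_ab \<alpha> \<beta>) {elA \<alpha> \<beta>, elB \<alpha> \<beta>} = carrier (G_ab \<alpha> \<beta>)"
    unfolding AB using H.subset by (intro equalityI) simp_all
qed

text \<open>The image of y' is killed by 9 and by m, which is prime to 3. So a homomorphism under
  which x has trivial ninth power sees only the 3-part of x.\<close>

lemma (in group_hom) hom_coprime_part:
  assumes "x \<in> carrier G" "y = x [^] (s::nat)" "y' = x [^] (t::nat)" "x = y \<otimes> y'"
    and "y' [^] (m::nat) = \<one>" "coprime m (3::nat)" and "h x [^]\<^bsub>H\<^esub> (9::nat) = \<one>\<^bsub>H\<^esub>"
  shows "h y = h x"
proof -
  have cl: "y \<in> carrier G" "y' \<in> carrier G"
    using assms(1) by (simp_all add: assms(2,3))
  have "h y' [^]\<^bsub>H\<^esub> m = \<one>\<^bsub>H\<^esub>"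
    using assms(5) cl by (simp flip: hom_nat_pow)
  moreover have "h y' [^]\<^bsub>H\<^esub> (9::nat) = \<one>\<^bsub>H\<^esub>"
  proof -
    have "h y' [^]\<^bsub>H\<^esub> (9::nat) = (h x [^]\<^bsub>H\<^esub> (9::nat)) [^]\<^bsub>H\<^esub> t"
      using assms(1) by (simp add: assms(3) hom_nat_pow H.nat_pow_pow mult.commute)
    then show ?thesis
      by (simp add: assms(7))
  qed
  moreover have "coprime m (3 ^ 2)"
    using assms(6) by (metis coprime_power_right_iff)
  then have "coprime m 9"
    by simp
  ultimately have "h y' = \<one>\<^bsub>H\<^esub>"
    using H.coprime_pow_eq_one[of "h y'" m 9] cl by simp
  moreover have "h x = h y \<otimes>\<^bsub>H\<^esub> h y'"
    using cl by (subst assms(4)) simp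
  ultimately show ?thesis
    using cl by simp
qed

theorem theorem10p1:
  fixes \<alpha> \<beta> :: int and P :: "word set set"
  assumes "\<alpha> mod 9 = 7" and "\<beta> mod 9 = 4"
    and "sylow_subgroup (G_ab \<alpha> \<beta>) 3 P"
  shows "card P = 3 ^ 5
    \<and> nilpotent_grp ((G_ab \<alpha> \<beta>)\<lparr>carrier := P\<rparr>)
    \<and> nilpotency_class ((G_ab \<alpha> \<beta>)\<lparr>carrier := P\<rparr>) = 3
    \<and> group.ord (G_ab \<alpha> \<beta>) (sylow_proj (G_ab \<alpha> \<beta>) 3 P (elA \<alpha> \<beta>)) = 9
    \<and> group.ord (G_ab \<alpha> \<beta>) (sylow_proj (G_ab \<alpha> \<beta>) 3 P (elB \<alpha> \<beta>)) = 9
    \<and> group.ord (G_ab \<alpha> \<beta>) (sylow_proj (G_ab \<alpha> \<beta>) 3 P (elC \<alpha> \<beta>)) = 3"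
proof -
  define G where "G = G_ab \<alpha> \<beta>"
  define A where "A = elA \<alpha> \<beta>"
  define B where "B = elB \<alpha> \<beta>"
  define C where "C = elC \<alpha> \<beta>"
  note rels = G_ab_relations[of \<alpha> \<beta>, folded G_def A_def B_def C_def]
  interpret G: group G by (rule rels(1))
  have fin: "finite (carrier G)"
    using assms(3) by (simp add: sylow_subgroup_def G_def)
  \<comment> \<open>The factor \<open>order G\<close> allows exponents to be reduced modulo N; the
    factor 9 preserves the residues of \<alpha> and \<beta> modulo 9.\<close>
  define N where "N = 9 * order G"
  have N: "N > 0" "\<And>x. x \<in> carrier G \<Longrightarrow> x [^]\<^bsub>G\<^esub> N = \<one>\<^bsub>G\<^esub>"
  proof -
    show "N > 0"
      using fin by (simp add: N_def G.order_gt_0_iff_finite)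
    show "x [^]\<^bsub>G\<^esub> N = \<one>\<^bsub>G\<^esub>" if "x \<in> carrier G" for x
      using G.pow_order_eq_1[OF that] that by (simp add: N_def G.pow_eq_id)
  qed
  define \<alpha>' where "\<alpha>' = nat (\<alpha> mod int N)"
  define \<beta>' where "\<beta>' = nat (\<beta> mod int N)"
  have mod9: "nat (k mod int N) mod 9 = nat (k mod 9)" for k
  proof -
    have "int (nat (k mod int N) mod 9) = k mod int N mod 9"
      using N(1) by (simp add: zmod_int)
    also have "\<dots> = k mod 9"
      by (simp add: N_def mod_mod_cancel)
    finally show ?thesis
      by linarith
  qed
  interpret M: macdonald_group_3 G A B C \<alpha>' \<beta>'
  proof
    have Cc: "C \<in> carrier G"
      by (simp add: rels(2-4) G.commutator_closed)
    then show "C \<in> carrier G" .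
    show "A \<otimes>\<^bsub>G\<^esub> B = B \<otimes>\<^bsub>G\<^esub> (A \<otimes>\<^bsub>G\<^esub> C)"
      using rels(2,3) by (simp add: rels(4) commutator_def G.m_assoc)
    show "A \<otimes>\<^bsub>G\<^esub> C = C \<otimes>\<^bsub>G\<^esub> A [^]\<^bsub>G\<^esub> \<alpha>'"
      unfolding rels(5) \<alpha>'_def using G.int_pow_mod[OF rels(2) N(2)[OF rels(2)] N(1)] by simp
    show "C \<otimes>\<^bsub>G\<^esub> B = B [^]\<^bsub>G\<^esub> \<beta>' \<otimes>\<^bsub>G\<^esub> C"
      unfolding rels(6) \<beta>'_def using G.int_pow_mod[OF rels(3) N(2)[OF rels(3)] N(1)] by simp
    show "\<alpha>' mod 9 = 7 \<and> \<beta>' mod 9 = 4 \<or> \<alpha>' mod 9 = 4 \<and> \<beta>' mod 9 = 7"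
      unfolding \<alpha>'_def \<beta>'_def mod9 by (simp add: assms)
  qed (use fin rels in auto)
  obtain a a' b b' s s' u u' H K where
    a: "a = A [^]\<^bsub>G\<^esub> (s::nat)" "a' = A [^]\<^bsub>G\<^esub> (s'::nat)" "A = a \<otimes>\<^bsub>G\<^esub> a'"
    and b: "b = B [^]\<^bsub>G\<^esub> (u::nat)" "b' = B [^]\<^bsub>G\<^esub> (u'::nat)" "B = b \<otimes>\<^bsub>G\<^esub> b'"
    and C: "C = commutator G a b \<otimes>\<^bsub>G\<^esub> commutator G a' b'"
    and H: "H = generate G {a, b}" and K: "K = generate G {a', b'}"
    and m9: "macdonald_group_9 (G\<lparr>carrier := H\<rparr>) a b (commutator G a b) \<alpha>' \<beta>'"
    and H3: "\<forall>x\<in>H. \<exists>e. x [^]\<^bsub>G\<^esub> (3 ^ e :: nat) = \<one>\<^bsub>G\<^esub>"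
    and K3: "\<forall>y\<in>K. \<exists>m::nat. coprime m 3 \<and> y [^]\<^bsub>G\<^esub> m = \<one>\<^bsub>G\<^esub>"
    and HK: "\<forall>x\<in>H. \<forall>y\<in>K. x \<otimes>\<^bsub>G\<^esub> y = y \<otimes>\<^bsub>G\<^esub> x"
    and G: "\<forall>g\<in>carrier G. \<exists>x\<in>H. \<exists>y\<in>K. g = x \<otimes>\<^bsub>G\<^esub> y"
    by (rule M.factor_3)
  define c where "c = commutator G a b"
  define c' where "c' = commutator G a' b'"
  interpret H: macdonald_group_9 "G\<lparr>carrier := H\<rparr>" a b c \<alpha>' \<beta>'
    unfolding c_def by (rule m9)
  have cl: "a \<in> carrier G" "a' \<in> carrier G" "b \<in> carrier G" "b' \<in> carrier G"
    using rels(2,3) by (simp_all add: a(1,2) b(1,2))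
  have sub: "subgroup H G" "subgroup K G"
    unfolding H K using cl by (auto intro!: G.generate_is_subgroup)
  interpret Hs: subgroup H G by (rule sub)
  interpret Ks: subgroup K G by (rule sub)
  have in_H: "a \<in> H" "b \<in> H" "c \<in> H" and in_K: "a' \<in> K" "b' \<in> K"
    using H.A_closed H.B_closed H.C_closed by (auto simp: K intro: generate.incl)
  then have "c' \<in> K"
    by (simp add: c'_def commutator_def)
  note pow9 = H.A9 H.B9 H.C3
  have pow9': "a [^]\<^bsub>G\<^esub> (9::nat) = \<one>\<^bsub>G\<^esub>" "b [^]\<^bsub>G\<^esub> (9::nat) = \<one>\<^bsub>G\<^esub>" "c [^]\<^bsub>G\<^esub> (3::nat) = \<one>\<^bsub>G\<^esub>"
    using pow9 by (simp_all add: G.nat_pow_restrict)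
  interpret S: group "sym_group 9" by (rule sym_group_is_group)
  have pow: "p [^]\<^bsub>sym_group 9\<^esub> k = p ^^ nat (k mod 9)"
    if "p \<in> carrier (sym_group 9)" "p ^^ 9 = id" for p and k :: int
    using S.int_pow_mod[OF that(1), of 9 k] that(2) by (simp add: sym_group_pow sym_group_one)
  have homs: "h a = h A" "h b = h B" "h c = h C"
    if "group_hom G (sym_group 9) h" "(h A) ^^ 9 = id" "(h B) ^^ 9 = id" for h
  proof -
    interpret h: group_hom G "sym_group 9" h by fact
    obtain m n :: nat where m: "coprime m 3" "a' [^]\<^bsub>G\<^esub> m = \<one>\<^bsub>G\<^esub>" and n: "coprime n 3" "b' [^]\<^bsub>G\<^esub> n = \<one>\<^bsub>G\<^esub>"
      using K3 in_K by blast
    show ha: "h a = h A"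
      using that(2) by (intro h.hom_coprime_part[OF rels(2) a m(2,1)]) (simp add: sym_group_pow sym_group_one)
    show hb: "h b = h B"
      using that(3) by (intro h.hom_coprime_part[OF rels(3) b n(2,1)]) (simp add: sym_group_pow sym_group_one)
    show "h c = h C"
      unfolding c_def rels(4) commutator_def using cl rels(2,3) ha hb
      by (simp only: h.hom_mult h.hom_inv G.m_closed G.inv_closed)
  qed
  obtain h where h: "group_hom G (sym_group 9) h" "h A = rot" "h B = tri" "h C = dbl"
    unfolding G_def A_def B_def C_def
    by (rule G_ab_hom[of "sym_group 9" rot tri dbl \<alpha> \<beta>])
      (use perm_closed perm_relations S.group_axioms in \<open>simp_all add: sym_group_mult pow assms\<close>)
  interpret h: group_hom G "sym_group 9" h by (rule h(1))
  have h': "h a = rot" "h b = tri" "h c = dbl"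
    using homs[OF h(1)] perm_relations by (simp_all add: h)
  \<comment> \<open>The first map kills \<open>b^3\<close>, so the order of b needs this one.
    Sending \<open>A\<close> to \<open>tri\<close> itself would give the commutator
    \<open>dbl^-1\<close>, hence exponent 7 on \<open>rot\<close>; squaring \<open>tri\<close> turns
    it into \<open>dbl\<close> with exponent 4, as \<beta> demands.\<close>
  obtain h2 where h2: "group_hom G (sym_group 9) h2" "h2 A = tri \<circ> tri" "h2 B = rot"
    unfolding G_def A_def B_def
    by (rule G_ab_hom[of "sym_group 9" "tri \<circ> tri" rot dbl \<alpha> \<beta>])
      (use perm_closed perm_relations S.group_axioms in \<open>simp_all add: sym_group_mult pow assms\<close>)
  interpret h2: group_hom G "sym_group 9" h2 by (rule h2(1))
  have h2': "h2 b = rot"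
    using homs[OF h2(1)] perm_relations by (simp add: h2)
  have rot3: "rot ^^ 3 \<noteq> id"
    using rot_pow[of 0 3] by auto
  have a3: "a [^]\<^bsub>G\<^esub> (3::nat) \<noteq> \<one>\<^bsub>G\<^esub>"
    using h.hom_nat_pow[OF cl(1), of 3] h'(1) rot3 by (auto simp: sym_group_pow sym_group_one)
  have b3: "b [^]\<^bsub>G\<^esub> (3::nat) \<noteq> \<one>\<^bsub>G\<^esub>"
    using h2.hom_nat_pow[OF cl(3), of 3] h2' rot3 by (auto simp: sym_group_pow sym_group_one)
  have "dbl \<noteq> id"
    by (auto simp: fun_eq_iff dbl_def intro!: exI[of _ 2])
  then have c1: "c \<noteq> \<one>\<^bsub>G\<^esub>"
    using h.hom_one h'(3) by (auto simp: sym_group_one)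
  have ordH: "group.ord (G\<lparr>carrier := H\<rparr>) a = 9" "group.ord (G\<lparr>carrier := H\<rparr>) b = 9"
    using pow9 a3 b3 by (auto intro!: H.ord_eq_9 simp: G.nat_pow_restrict)
  have cardH: "card H = 3 ^ 5"
  proof -
    have "[i = i'] (mod 9) \<and> [k = k'] (mod 3)"
      if "a [^]\<^bsub>G\<^esub> i \<otimes>\<^bsub>G\<^esub> (b [^]\<^bsub>G\<^esub> j \<otimes>\<^bsub>G\<^esub> c [^]\<^bsub>G\<^esub> k) = a [^]\<^bsub>G\<^esub> i' \<otimes>\<^bsub>G\<^esub> (b [^]\<^bsub>G\<^esub> j' \<otimes>\<^bsub>G\<^esub> c [^]\<^bsub>G\<^esub> k')"
      for i j k i' j' k' :: nat
    proof (rule perm_normal_form_inj)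
      have "h (a [^]\<^bsub>G\<^esub> i \<otimes>\<^bsub>G\<^esub> (b [^]\<^bsub>G\<^esub> j \<otimes>\<^bsub>G\<^esub> c [^]\<^bsub>G\<^esub> k)) = rot ^^ i \<circ> (tri ^^ j \<circ> dbl ^^ k)" for i j k :: nat
        using cl Hs.mem_carrier[OF in_H(3)] by (simp add: h.hom_nat_pow h' sym_group_pow sym_group_mult)
      then show "rot ^^ i \<circ> (tri ^^ j \<circ> dbl ^^ k) = rot ^^ i' \<circ> (tri ^^ j' \<circ> dbl ^^ k')"
        using that by metis
    qed
    then have "card (carrier (G\<lparr>carrier := H\<rparr>)) = 243"
      by (intro H.card_carrier ordH) (simp add: G.nat_pow_restrict)
    then show ?thesis
      by simp
  qed
  have PH: "P = H"
    by (rule G.sylow_subgroup_eq[OF assms(3)[folded G_def] _ sub(1) cardH Ks.subset K3 HK G]) simp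
  have proj: "sylow_proj G 3 P (x \<otimes>\<^bsub>G\<^esub> y) = x" if xy: "x \<in> H" "y \<in> K" for x y
  proof -
    obtain m :: nat where "y [^]\<^bsub>G\<^esub> m = \<one>\<^bsub>G\<^esub>" "coprime m 3"
      using K3 xy(2) by blast
    then show ?thesis
      unfolding PH using xy HK H3 Ks.mem_carrier[OF xy(2)] by (intro G.sylow_proj_eq[OF sub(1)]) blast+
  qed
  have projs: "sylow_proj G 3 P A = a" "sylow_proj G 3 P B = b" "sylow_proj G 3 P C = c"
    using proj[OF in_H(1) in_K(1)] proj[OF in_H(2) in_K(2)] proj[OF in_H(3) \<open>c' \<in> K\<close>]
    by (simp_all add: c_def c'_def flip: a(3) b(3) C)
  have "G.ord c dvd 3"
    using pow9'(3) Hs.mem_carrier[OF in_H(3)] by (simp add: G.pow_eq_id)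
  moreover have "G.ord c \<noteq> 1"
    using c1 G.ord_eq_1[OF Hs.mem_carrier[OF in_H(3)]] by simp
  moreover have "prime (3::nat)"
    by simp
  ultimately have "G.ord c = 3"
    by (metis prime_nat_iff)
  moreover have "G.ord a = 9" "G.ord b = 9"
    using pow9' a3 b3 cl by (auto intro!: G.ord_eq_9)
  moreover have "nilpotency_class (G\<lparr>carrier := P\<rparr>) = 3" "nilpotent_grp (G\<lparr>carrier := P\<rparr>)"
    unfolding PH nilpotent_grp_def using H.nilpotency_class_3[OF ordH(1)] H.lower_central_3 by auto
  ultimately show ?thesis
    using cardH PH projs by (simp add: G_def A_def B_def C_def)
qed

end
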